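(* Let $0<\varepsilon_1\le\varepsilon_2\le h$ and let $E$ be the quadrilateral with vertices $P_1=(0,h)$, $P_2=(0,0)$, $P_3=(\varepsilon_1,h)$, $P_4=(\varepsilon_2,0)$, and let $\widetilde e$ be the edge joining $P_3$ and $P_4$. There is a constant $C$ independent of $\varepsilon_1,\varepsilon_2,h$ such that for every $v_h\in V_E$ with $v_h|_{\widetilde e}=0$ it holds $$|v_h|_{H^1(E)}^2\le C\,s_E(v_h,v_h),$$ where $s_E(v,w):=\int_0^h\frac{v(0,y)\,w(0,y)}{\kappa(y)}\,dy$ and $\kappa(y)=(h-y)\frac{\varepsilon_2-\varepsilon_1}{h}+\varepsilon_1$.
   Context: $\kappa(y)$ is the length of the horizontal segment of $E$ at height $y$. $V_E$ is the enhanced virtual element space of order one on $E$: $V_E=\{v\in H^1(E):v_{|\partial E}\in B_{\partial E},\ \Delta v\in\mathbb P_1(E),\ \int_E(v-\Pi^\nabla_Ev)q_1=0\ \forall q_1\in\mathbb P_1(E)\}$, where $B_{\partial E}$ is the space of continuous functions on $\partial E$ affine on each edge, and $\Pi^\nabla_E:H^1(E)\to\mathbb P_1(E)$ is defined by $(\nabla(v-\Pi^\nabla_Ev),\nabla q)_{L^2(E)}=0$ for all $q\in\mathbb P_1(E)$ and $\int_{\partial E}(v-\Pi^\nabla_Ev)=0$. *)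

theory Defs
  imports "HOL-Analysis.Analysis"
begin

section \<open>Square integrable functions and classical calculus in the plane\<close>

type_synonym pt = "real \<times> real"

text \<open>Elements of \<open>L\<^sup>2\<close> and \<open>H\<^sup>1\<close> are represented by Lebesgue measurable functions on the whole
  space; values outside the set are irrelevant, and every notion below is invariant under
  changes on null sets.\<close>

definition L2 :: "'a::euclidean_space set \<Rightarrow> ('a \<Rightarrow> 'b::euclidean_space) \<Rightarrow> bool" where
  "L2 S f \<longleftrightarrow> set_borel_measurable lebesgue S f \<and> set_integrable lebesgue S (\<lambda>z. (norm (f z))\<^sup>2)"

definition pderiv :: "pt \<Rightarrow> (pt \<Rightarrow> real) \<Rightarrow> pt \<Rightarrow> real" where
  "pderiv i f z = frechet_derivative f (at z) i"

definition grad :: "(pt \<Rightarrow> real) \<Rightarrow> pt \<Rightarrow> pt" where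
  "grad f z = (\<Sum>i\<in>Basis. pderiv i f z *\<^sub>R i)"

definition laplace :: "(pt \<Rightarrow> real) \<Rightarrow> pt \<Rightarrow> real" where
  "laplace f z = (\<Sum>i\<in>Basis. pderiv i (pderiv i f) z)"

primrec Ck :: "nat \<Rightarrow> (pt \<Rightarrow> real) \<Rightarrow> bool" where
  "Ck 0 f \<longleftrightarrow> continuous_on UNIV f"
| "Ck (Suc k) f \<longleftrightarrow> f differentiable_on UNIV \<and> (\<forall>i\<in>Basis. Ck k (pderiv i f))"

definition smooth :: "(pt \<Rightarrow> real) \<Rightarrow> bool" where
  "smooth f \<longleftrightarrow> (\<forall>k. Ck k f)"

definition test_fun :: "pt set \<Rightarrow> (pt \<Rightarrow> real) \<Rightarrow> bool" where
  "test_fun E \<phi> \<longleftrightarrow> smooth \<phi> \<and> compact (closure {z. \<phi> z \<noteq> 0}) \<and> closure {z. \<phi> z \<noteq> 0} \<subseteq> E"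

definition P1 :: "(pt \<Rightarrow> real) set" where
  "P1 = {p. \<exists>c w. p = (\<lambda>z. c + w \<bullet> z)}"

section \<open>The Sobolev space \<open>H\<^sup>1\<close>\<close>

definition is_weak_grad :: "pt set \<Rightarrow> (pt \<Rightarrow> real) \<Rightarrow> (pt \<Rightarrow> pt) \<Rightarrow> bool" where
  "is_weak_grad E v G \<longleftrightarrow> L2 E G \<and>
     (\<forall>\<phi>. test_fun E \<phi> \<longrightarrow> (\<forall>i\<in>Basis.
        (LINT z:E|lebesgue. v z * pderiv i \<phi> z) = - (LINT z:E|lebesgue. (G z \<bullet> i) * \<phi> z)))"

definition H1 :: "pt set \<Rightarrow> (pt \<Rightarrow> real) set" where
  "H1 E = {v. L2 E v \<and> (\<exists>G. is_weak_grad E v G)}"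

text \<open>The weak gradient is determined up to a null set.\<close>

definition wgrad :: "pt set \<Rightarrow> (pt \<Rightarrow> real) \<Rightarrow> pt \<Rightarrow> pt" where
  "wgrad E v = (SOME G. is_weak_grad E v G)"

definition H1_seminorm :: "pt set \<Rightarrow> (pt \<Rightarrow> real) \<Rightarrow> real" where
  "H1_seminorm E v = sqrt (LINT z:E|lebesgue. (norm (wgrad E v z))\<^sup>2)"

definition laplacian_is :: "pt set \<Rightarrow> (pt \<Rightarrow> real) \<Rightarrow> (pt \<Rightarrow> real) \<Rightarrow> bool" where
  "laplacian_is E v p \<longleftrightarrow> (\<forall>\<phi>. test_fun E \<phi> \<longrightarrow>
     (LINT z:E|lebesgue. v z * laplace \<phi> z) = (LINT z:E|lebesgue. p z * \<phi> z))"

section \<open>Convex polygons and traces\<close>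

text \<open>A convex polygon is given by the list of its vertices in cyclic order.\<close>

definition polygon :: "pt list \<Rightarrow> pt set" where
  "polygon vs = interior (convex hull (set vs))"

definition edges :: "pt list \<Rightarrow> (pt \<times> pt) set" where
  "edges vs = set (zip vs (rotate1 vs))"

definition bdry :: "pt list \<Rightarrow> pt set" where
  "bdry vs = (\<Union>(a, b)\<in>edges vs. closed_segment a b)"

text \<open>Integral over the boundary with respect to arc length.\<close>

definition bdry_integral :: "pt list \<Rightarrow> (pt \<Rightarrow> real) \<Rightarrow> real" where
  "bdry_integral vs g =
     (\<Sum>(a, b)\<in>edges vs. dist a b * (LINT t:{0..1}|lebesgue. g (linepath a b t)))"

text \<open>The trace on the boundary of \<open>v \<in> H\<^sup>1\<close>: the \<open>L\<^sup>2\<close> limit of the boundary values of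
  functions that are smooth up to the boundary and converge to \<open>v\<close> in \<open>H\<^sup>1\<close>.\<close>

definition is_trace :: "pt list \<Rightarrow> (pt \<Rightarrow> real) \<Rightarrow> (pt \<Rightarrow> real) \<Rightarrow> bool" where
  "is_trace vs v g \<longleftrightarrow>
     (\<forall>(a, b)\<in>edges vs. L2 {0..1} (\<lambda>t. g (linepath a b t))) \<and>
     (\<exists>\<phi>. (\<forall>n. smooth (\<phi> n)) \<and>
        (\<lambda>n::nat. LINT z:polygon vs|lebesgue. (\<phi> n z - v z)\<^sup>2) \<longlonglongrightarrow> 0 \<and>
        (\<lambda>n. LINT z:polygon vs|lebesgue. (norm (grad (\<phi> n) z - wgrad (polygon vs) v z))\<^sup>2) \<longlonglongrightarrow> 0 \<and>
        (\<lambda>n. bdry_integral vs (\<lambda>z. (\<phi> n z - g z)\<^sup>2)) \<longlonglongrightarrow> 0)"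

text \<open>The trace is determined almost everywhere on the boundary.\<close>

definition tr :: "pt list \<Rightarrow> (pt \<Rightarrow> real) \<Rightarrow> pt \<Rightarrow> real" where
  "tr vs v = (SOME g. is_trace vs v g)"

section \<open>The enhanced virtual element space of order one\<close>

definition B_bdry :: "pt list \<Rightarrow> (pt \<Rightarrow> real) set" where
  "B_bdry vs = {g. continuous_on (bdry vs) g \<and>
     (\<forall>(a, b)\<in>edges vs. \<exists>p\<in>P1. \<forall>z\<in>closed_segment a b. g z = p z)}"

definition Pi_nabla :: "pt list \<Rightarrow> (pt \<Rightarrow> real) \<Rightarrow> pt \<Rightarrow> real" where
  "Pi_nabla vs v = (THE p. p \<in> P1 \<and>
     (\<forall>q\<in>P1. (LINT z:polygon vs|lebesgue. (wgrad (polygon vs) v z - grad p z) \<bullet> grad q z) = 0) \<and>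
     bdry_integral vs (\<lambda>z. tr vs v z - p z) = 0)"

definition V_space :: "pt list \<Rightarrow> (pt \<Rightarrow> real) set" where
  "V_space vs = {v \<in> H1 (polygon vs).
     (\<exists>g\<in>B_bdry vs. is_trace vs v g) \<and>
     (\<exists>p\<in>P1. laplacian_is (polygon vs) v p) \<and>
     (\<forall>q\<in>P1. (LINT z:polygon vs|lebesgue. (v z - Pi_nabla vs v z) * q z) = 0)}"

section \<open>The quadrilateral and the stabilization form\<close>

text \<open>The vertices in cyclic order, i.e. \<open>P\<^sub>1, P\<^sub>2, P\<^sub>4, P\<^sub>3\<close>: the listing \<open>P\<^sub>1, P\<^sub>2, P\<^sub>3, P\<^sub>4\<close> would be
  self-intersecting.\<close>

definition quad :: "real \<Rightarrow> real \<Rightarrow> real \<Rightarrow> pt list" where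
  "quad h \<epsilon>\<^sub>1 \<epsilon>\<^sub>2 = [(0, h), (0, 0), (\<epsilon>\<^sub>2, 0), (\<epsilon>\<^sub>1, h)]"

definition kappa :: "real \<Rightarrow> real \<Rightarrow> real \<Rightarrow> real \<Rightarrow> real" where
  "kappa h \<epsilon>\<^sub>1 \<epsilon>\<^sub>2 y = (h - y) * ((\<epsilon>\<^sub>2 - \<epsilon>\<^sub>1) / h) + \<epsilon>\<^sub>1"

definition s_E :: "real \<Rightarrow> real \<Rightarrow> real \<Rightarrow> (pt \<Rightarrow> real) \<Rightarrow> (pt \<Rightarrow> real) \<Rightarrow> real" where
  "s_E h \<epsilon>\<^sub>1 \<epsilon>\<^sub>2 v w = (LINT y:{0..h}|lebesgue.
     tr (quad h \<epsilon>\<^sub>1 \<epsilon>\<^sub>2) v (0, y) * tr (quad h \<epsilon>\<^sub>1 \<epsilon>\<^sub>2) w (0, y) / kappa h \<epsilon>\<^sub>1 \<epsilon>\<^sub>2 y)"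

lemma kappa_slice:
  assumes "0 < \<epsilon>\<^sub>1" "\<epsilon>\<^sub>1 \<le> \<epsilon>\<^sub>2" "0 < h" "y \<in> {0..h}"
  shows "{x. (x, y) \<in> convex hull (set (quad h \<epsilon>\<^sub>1 \<epsilon>\<^sub>2))} = {0..kappa h \<epsilon>\<^sub>1 \<epsilon>\<^sub>2 y}"
proof
  let ?T = "{z::pt. (1, 0) \<bullet> z \<ge> 0} \<inter> {z. (1, (\<epsilon>\<^sub>2 - \<epsilon>\<^sub>1) / h) \<bullet> z \<le> \<epsilon>\<^sub>2}"
  have "convex hull (set (quad h \<epsilon>\<^sub>1 \<epsilon>\<^sub>2)) \<subseteq> ?T"
    using assms
    by (intro hull_minimal convex_Int convex_halfspace_ge convex_halfspace_le)
       (auto simp: quad_def field_simps)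
  moreover have "kappa h \<epsilon>\<^sub>1 \<epsilon>\<^sub>2 y = \<epsilon>\<^sub>2 - (\<epsilon>\<^sub>2 - \<epsilon>\<^sub>1) / h * y"
    using assms by (simp add: kappa_def field_simps)
  ultimately show "{x. (x, y) \<in> convex hull (set (quad h \<epsilon>\<^sub>1 \<epsilon>\<^sub>2))} \<subseteq> {0..kappa h \<epsilon>\<^sub>1 \<epsilon>\<^sub>2 y}"
    by fastforce
next
  let ?H = "convex hull (set (quad h \<epsilon>\<^sub>1 \<epsilon>\<^sub>2))"
  show "{0..kappa h \<epsilon>\<^sub>1 \<epsilon>\<^sub>2 y} \<subseteq> {x. (x, y) \<in> ?H}"
  proof
    fix x assume x: "x \<in> {0..kappa h \<epsilon>\<^sub>1 \<epsilon>\<^sub>2 y}"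
    define k where "k = kappa h \<epsilon>\<^sub>1 \<epsilon>\<^sub>2 y"
    define t where "t = y / h"
    have t: "0 \<le> t" "t \<le> 1" and y: "y = t * h" using assms by (auto simp: t_def)
    have k: "k = (1 - t) * \<epsilon>\<^sub>2 + t * \<epsilon>\<^sub>1"
      using assms by (simp add: k_def kappa_def y field_simps)
    have "0 \<le> (1 - t) * (\<epsilon>\<^sub>2 - \<epsilon>\<^sub>1)" using assms t by simp
    then have kpos: "k > 0" using assms k by (simp add: algebra_simps)
    have in4: "(0, h) \<in> ?H" "(0, 0) \<in> ?H" "(\<epsilon>\<^sub>2, 0) \<in> ?H" "(\<epsilon>\<^sub>1, h) \<in> ?H"
      by (auto simp: quad_def intro: hull_inc)
    have comb: "(1 - s) *\<^sub>R a + s *\<^sub>R b \<in> ?H" if "a \<in> ?H" "b \<in> ?H" "0 \<le> s" "s \<le> 1" for a b s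
      using that by (intro convexD) auto
    have l: "(0, y) \<in> ?H" using comb[OF in4(2) in4(1) t] by (simp add: y)
    have r: "(k, y) \<in> ?H" using comb[OF in4(3) in4(4) t] by (simp add: y k)
    have "0 \<le> x / k" "x / k \<le> 1" using x kpos by (auto simp: k_def[symmetric])
    from comb[OF l r this] have "(x, y) \<in> ?H" using kpos by (simp add: algebra_simps)
    then show "x \<in> {x. (x, y) \<in> ?H}" by simp
  qed
qed

end

theory Submission
  imports Defs
begin

text \<open>Let \<open>w\<close> be the lifting of the boundary values that is affine on every horizontal segment of
  \<open>E\<close>; its energy is bounded by \<open>s\<^sub>E(v, v)\<close>. Since \<open>v - w\<close> has trace zero, it is an \<open>H\<^sup>1\<close> limit of
  test functions, so with \<open>p = \<Delta>v\<close> and the enhancement constraint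
  \<open>\<bar>v\<bar>\<^sup>2 = (\<nabla>v, \<nabla>w) - (p, \<Pi>v - w)\<close>. Here \<open>\<Pi>v = \<Pi>w\<close> is bounded by the two nodal values on the left
  edge, and testing \<open>\<Delta>v = p\<close> with \<open>p\<close> times a bump gives \<open>\<epsilon>\<^sub>2 \<parallel>p\<parallel> \<le> C \<bar>v\<bar>\<close>, so that both terms are
  at most \<open>C \<bar>v\<bar> s\<^sub>E(v, v)\<^sup>1\<^sup>/\<^sup>2\<close>.\<close>

section \<open>Smooth functions on the line\<close>

text \<open>The ratios of \<open>e1\<close>, \<open>e2\<close> and \<open>h\<close> are arbitrary,
  so constants obtained by mapping to the unit square, which involve \<open>e2 / e1\<close>, are not
  admissible in the final bound. Density of test functions and uniqueness of traces enter only
  through limits and may use such constants. Every estimate that survives uses explicit geometry: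
  the weight \<open>1 / kappa\<close> cancels the width of a horizontal slice, the bump sits where
  the element is about \<open>e2\<close> wide, and \<open>e2 \<le> h\<close> gives
  \<open>slope \<le> 1\<close>. The enhancement constraint removes \<open>v\<close> itself: tested
  with \<open>p\<close>, it puts the projection in place of \<open>v\<close>, so no bound of
  \<open>v\<close> in \<open>L2\<close> is required. With \<open>m\<close> the larger nodal value in
  modulus on the left edge, the remaining term is at most a multiple of
  \<open>sup |p| * m * e2 * h\<close>. This factors into
  \<open>sup |p| * e2 * sqrt (e2 * h)\<close>, bounded by the seminorm, and
  \<open>m * sqrt (h / e2)\<close>, bounded by the square root of \<open>s_E\<close>, with no power
  of \<open>h / e2\<close> left over. Traces are \<open>L2\<close> limits known only almost
  everywhere, hence the work with strips and null sets.\<close>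

primrec Ck1 :: "nat \<Rightarrow> (real \<Rightarrow> real) \<Rightarrow> bool" where
  "Ck1 0 f \<longleftrightarrow> continuous_on UNIV f"
| "Ck1 (Suc k) f \<longleftrightarrow> (\<exists>f'. (\<forall>x. (f has_real_derivative f' x) (at x)) \<and> Ck1 k f')"

lemma Ck1_SucI: "(\<And>x. (f has_real_derivative f' x) (at x)) \<Longrightarrow> Ck1 k f' \<Longrightarrow> Ck1 (Suc k) f"
  unfolding Ck1.simps by (rule exI[of _ f']) simp

lemma Ck1_SucE:
  assumes "Ck1 (Suc k) f"
  obtains f' where "\<And>x. (f has_real_derivative f' x) (at x)" "Ck1 k f'"
  using assms unfolding Ck1.simps by blast

lemma Ck1_continuous:
  assumes "Ck1 k f" shows "continuous_on UNIV f"
proof (cases k)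
  case (Suc m)
  with assms obtain f' where "\<And>x. (f has_real_derivative f' x) (at x)"
    by (auto elim: Ck1_SucE)
  then show ?thesis by (intro continuous_at_imp_continuous_on ballI DERIV_isCont)
qed (use assms in simp)

lemma Ck1_SucD: "Ck1 (Suc k) f \<Longrightarrow> Ck1 k f"
proof (induction k arbitrary: f)
  case 0
  then show ?case using Ck1_continuous[OF 0] by simp
next
  case (Suc k)
  then show ?case by (metis Ck1.simps(2))
qed

lemma Ck1_const: "Ck1 k (\<lambda>_. c)"
proof (induction k arbitrary: c)
  case (Suc k)
  show ?case using Suc[of 0] by (auto intro!: exI[of _ "\<lambda>_. 0"])
qed auto

lemma Ck1_affine: "Ck1 k (\<lambda>x. c + a * x)"
proof (cases k)
  case (Suc k)
  show ?thesis
    unfolding Suc Ck1.simps by (rule exI[of _ "\<lambda>_. a"]) (auto intro!: derivative_eq_intros Ck1_const)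
qed (auto intro!: continuous_intros)

lemma Ck1_add: "Ck1 k f \<Longrightarrow> Ck1 k g \<Longrightarrow> Ck1 k (\<lambda>x. f x + g x)"
proof (induction k arbitrary: f g)
  case (Suc k)
  obtain f' g' where d: "\<And>x. (f has_real_derivative f' x) (at x)"
    "\<And>x. (g has_real_derivative g' x) (at x)" and C: "Ck1 k f'" "Ck1 k g'"
    using Suc.prems by (blast elim!: Ck1_SucE)
  show ?case by (rule Ck1_SucI[OF DERIV_add[OF d] Suc.IH[OF C]])
qed (auto intro!: continuous_intros)

lemma Ck1_mult: "Ck1 k f \<Longrightarrow> Ck1 k g \<Longrightarrow> Ck1 k (\<lambda>x. f x * g x)"
proof (induction k arbitrary: f g)
  case (Suc k)
  obtain f' g' where d: "\<And>x. (f has_real_derivative f' x) (at x)"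
    "\<And>x. (g has_real_derivative g' x) (at x)" and C: "Ck1 k f'" "Ck1 k g'"
    using Suc.prems by (blast elim!: Ck1_SucE)
  have "Ck1 k (\<lambda>x. f' x * g x + g' x * f x)"
    using Suc.prems[THEN Ck1_SucD] C by (intro Ck1_add Suc.IH)
  then show ?case by (rule Ck1_SucI[OF DERIV_mult[OF d]])
qed (auto intro!: continuous_intros)

lemma Ck1_inverse: "(\<And>x. f x \<noteq> 0) \<Longrightarrow> Ck1 k f \<Longrightarrow> Ck1 k (\<lambda>x. inverse (f x))"
proof (induction k arbitrary: f)
  case (Suc k)
  obtain f' where d: "\<And>x. (f has_real_derivative f' x) (at x)" and C: "Ck1 k f'"
    using Suc.prems by (blast elim!: Ck1_SucE)
  have I: "Ck1 k (\<lambda>x. inverse (f x))"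
    by (rule Suc.IH[OF Suc.prems(1) Ck1_SucD[OF Suc.prems(2)]])
  have "((\<lambda>x. inverse (f x)) has_real_derivative ((-1) * f' x) * (inverse (f x) * inverse (f x))) (at x)" for x
    using DERIV_inverse_fun[OF d Suc.prems(1), of x] by (simp add: power2_eq_square)
  moreover have "Ck1 k (\<lambda>x. ((-1) * f' x) * (inverse (f x) * inverse (f x)))"
    by (intro Ck1_mult I C Ck1_const)
  ultimately show ?case by (rule Ck1_SucI)
qed (auto intro!: continuous_intros)

lemma Ck1_comp_affine: "Ck1 k f \<Longrightarrow> Ck1 k (\<lambda>x. f (c + a * x))"
proof (induction k arbitrary: f)
  case 0
  then show ?case by (auto intro!: continuous_intros continuous_on_compose2[of UNIV f])
next
  case (Suc k)
  obtain f' where d: "\<And>x. (f has_real_derivative f' x) (at x)" and C: "Ck1 k f'"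
    using Suc.prems by (blast elim!: Ck1_SucE)
  have "((\<lambda>x. f (c + a * x)) has_real_derivative f' (c + a * x) * a) (at x)" for x
    by (rule DERIV_chain2[OF d]) (auto intro!: derivative_eq_intros)
  moreover have "Ck1 k (\<lambda>x. f' (c + a * x) * a)"
    by (rule Ck1_mult[OF Suc.IH[OF C] Ck1_const])
  ultimately show ?case by (rule Ck1_SucI)
qed

section \<open>Flat functions and a smooth transition on the line\<close>

definition flat :: "nat \<Rightarrow> real \<Rightarrow> real" where
  "flat j x = (if x \<le> 0 then 0 else inverse x ^ j * exp (- inverse x))"

text \<open>The decay of \<open>exp (- inverse x)\<close> beats every inverse power, and on the left
  the function is zero. The case \<open>Suc j\<close> is the difference quotient of
  \<open>flat j\<close> at 0, so this limit also yields the derivative there.\<close>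

lemma flat_tendsto_0: "(flat j \<longlongrightarrow> 0) (at 0)"
proof -
  have "((\<lambda>x. inverse x ^ j / exp (inverse x)) \<longlongrightarrow> (0::real)) (at_right 0)"
    by (rule filterlim_compose[OF tendsto_power_div_exp_0 filterlim_inverse_at_top_right])
  then have "(flat j \<longlongrightarrow> 0) (at_right 0)"
    by (rule Lim_transform_eventually)
      (auto simp: eventually_at_filter flat_def exp_minus divide_simps)
  moreover have "(flat j \<longlongrightarrow> 0) (at_left 0)"
    by (rule Lim_transform_eventually[OF tendsto_const]) (auto simp: eventually_at_filter flat_def)
  ultimately show ?thesis by (simp add: filterlim_at_split)
qed

text \<open>Differentiation stays inside the span of the family, which is why \<open>flat\<close>
  carries the exponent \<open>j\<close>: smoothness of all members follows by one induction on the
  order with \<open>j\<close> arbitrary.\<close>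

lemma flat_deriv: "(flat j has_real_derivative flat (j+2) x + (- real j) * flat (j+1) x) (at x)"
proof -
  consider "x < 0" | "x = 0" | "x > 0" by linarith
  then show ?thesis
  proof cases
    case 1
    have "((\<lambda>_. 0) has_real_derivative 0) (at x)" by simp
    then have "(flat j has_real_derivative 0) (at x)"
      by (rule has_field_derivative_transform_within_open[of _ _ _ "{..<0}"])
        (use 1 in \<open>auto simp: flat_def\<close>)
    then show ?thesis using 1 by (simp add: flat_def)
  next
    case 2
    have "((\<lambda>h. flat j h / h) \<longlongrightarrow> 0) (at 0)"
      by (rule Lim_transform_eventually[OF flat_tendsto_0[of "Suc j"]])
        (auto simp: eventually_at_filter flat_def divide_simps)
    then show ?thesis using 2 by (simp add: DERIV_def flat_def)
  next
    case 3
    have "((\<lambda>x. inverse x ^ j * exp (- inverse x)) has_real_derivative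
        real j * inverse x ^ (j - 1) * (- (inverse x * inverse x)) * exp (- inverse x)
        + inverse x ^ j * (exp (- inverse x) * (inverse x * inverse x))) (at x)"
      using 3 by (auto intro!: derivative_eq_intros)
    also have "real j * inverse x ^ (j - 1) * (- (inverse x * inverse x)) * exp (- inverse x)
        + inverse x ^ j * (exp (- inverse x) * (inverse x * inverse x))
        = flat (j+2) x + (- real j) * flat (j+1) x"
      \<comment> \<open>The power rule leaves the truncated exponent \<open>j - 1\<close>; at
        \<open>j = 0\<close> the factor \<open>real j\<close> kills that term.\<close>
      using 3 by (cases j) (simp_all add: flat_def algebra_simps)
    finally have "((\<lambda>x. inverse x ^ j * exp (- inverse x)) has_real_derivative
        flat (j+2) x + (- real j) * flat (j+1) x) (at x)" .
    then show ?thesis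
      by (rule has_field_derivative_transform_within_open[of _ _ _ "{0<..}"])
        (use 3 in \<open>auto simp: flat_def\<close>)
  qed
qed

lemma Ck1_flat: "Ck1 k (flat j)"
proof (induction k arbitrary: j)
  case 0
  show ?case unfolding Ck1.simps by (intro continuous_at_imp_continuous_on ballI DERIV_isCont[OF flat_deriv])
next
  case (Suc k)
  show ?case
    by (rule Ck1_SucI[OF flat_deriv]) (intro Ck1_add Ck1_mult Ck1_const Suc)
qed

text \<open>The classical quotient of flat functions. The denominator is positive because
  \<open>x\<close> and \<open>1 - x\<close> cannot both be nonpositive; \<open>1 + (-1) * x\<close>
  is the argument form that \<open>Ck1_comp_affine\<close> expects.\<close>

definition step :: "real \<Rightarrow> real" where
  "step x = flat 0 x * inverse (flat 0 x + flat 0 (1 + (-1) * x))"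

lemma flat_nonneg: "0 \<le> flat j x" and flat_pos: "0 < x \<Longrightarrow> 0 < flat j x"
  by (auto simp: flat_def)

lemma step_denominator: "flat 0 x + flat 0 (1 + (-1) * x) > 0"
  using flat_nonneg[of 0 x] flat_nonneg[of 0 "1 + (-1) * x"] flat_pos[of x 0] flat_pos[of "1 + (-1) * x" 0]
  by linarith

lemma Ck1_step: "Ck1 k step"
  unfolding step_def[abs_def] using step_denominator
  by (intro Ck1_mult Ck1_inverse Ck1_add Ck1_flat Ck1_comp_affine) (metis less_irrefl)

lemma step_0: "x \<le> 0 \<Longrightarrow> step x = 0"
  by (simp add: step_def flat_def)

lemma step_1: "1 \<le> x \<Longrightarrow> step x = 1"
  by (simp add: step_def flat_def)

lemma step_ge_0: "0 \<le> step x"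
  unfolding step_def using flat_nonneg step_denominator[of x, THEN less_imp_le] by simp

lemma step_le_1: "step x \<le> 1"
proof -
  have "flat 0 x \<le> flat 0 x + flat 0 (1 + (-1) * x)" using flat_nonneg by simp
  then show ?thesis unfolding step_def using step_denominator[of x]
    by (metis divide_inverse divide_le_eq_1_pos)
qed

text \<open>The derivative is continuous and vanishes off \<open>{0..1}\<close>, where
  \<open>step\<close> is locally constant. The bound sets the size of all cutoff gradients; the
  vanishing beyond 1 confines them to the transition zone.\<close>

lemma step_deriv_bounded:
  obtains step' B where "\<And>x. (step has_real_derivative step' x) (at x)" "\<And>x. \<bar>step' x\<bar> \<le> B"
    "\<And>x. 1 < x \<Longrightarrow> step' x = 0"
proof -
  obtain s' where d: "\<And>x. (step has_real_derivative s' x) (at x)" and c: "Ck1 0 s'"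
    using Ck1_step[of "Suc 0"] by (auto elim!: Ck1_SucE simp del: Ck1.simps)
  have z: "s' x = 0" if "x < 0 \<or> x > 1" for x
  proof -
    have "open (if x < 0 then {..<0} else {1<..} :: real set)" by simp
    from has_field_derivative_transform_within_open[OF d this, of _ "\<lambda>_. if x < 0 then 0 else 1"]
    have "((\<lambda>_. if x < 0 then 0 else 1) has_real_derivative s' x) (at x)"
      using that by (auto simp: step_0 step_1 split: if_splits)
    then show ?thesis by (rule DERIV_unique) simp
  qed
  have "bounded (s' ` {0..1})"
    using c by (intro compact_imp_bounded compact_continuous_image) (auto intro: continuous_on_subset)
  then obtain B where "B > 0" "\<And>x. x \<in> {0..1} \<Longrightarrow> \<bar>s' x\<bar> \<le> B"
    unfolding bounded_pos by auto
  then have "\<bar>s' x\<bar> \<le> B" for x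
    using z[of x] by (cases "x \<in> {0..1}") auto
  with d z that show ?thesis by blast
qed

section \<open>Smooth functions in the plane\<close>

lemma Basis_pt: "(Basis :: pt set) = {(1, 0), (0, 1)}"
  by (auto simp: Basis_prod_def)

lemma pderiv_eq: "(f has_derivative D) (at z) \<Longrightarrow> Defs.pderiv i f z = D i"
  unfolding Defs.pderiv_def by (metis frechet_derivative_at)

lemma grad_eq:
  assumes "(f has_derivative (\<lambda>w. G \<bullet> w)) (at z)"
  shows "grad f z = G"
  unfolding grad_def pderiv_eq[OF assms] by (rule euclidean_representation)

lemma grad_inner_Basis: "i \<in> Basis \<Longrightarrow> grad f z \<bullet> i = Defs.pderiv i f z"
  unfolding grad_def by simp

lemma Ck_SucI:
  assumes "\<And>z. (f has_derivative D z) (at z)" "\<And>i. i \<in> Basis \<Longrightarrow> Ck k (\<lambda>z. D z i)"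
  shows "Ck (Suc k) f"
proof -
  have "Defs.pderiv i f = (\<lambda>z. D z i)" for i using pderiv_eq[OF assms(1)] by blast
  moreover have "f differentiable_on UNIV"
    using assms(1) by (auto simp: differentiable_on_def differentiable_def)
  ultimately show ?thesis using assms(2) by simp
qed

text \<open>Differentiability is built into \<open>Ck\<close>, and a linear map is determined by its
  values on \<open>Basis\<close>, so the total derivative is the inner product with
  \<open>grad\<close>. Gradients of sums, products and compositions are computed in this form
  through \<open>grad_eq\<close>.\<close>

lemma Ck_has_derivative:
  assumes "Ck (Suc k) f"
  shows "(f has_derivative (\<lambda>w. grad f z \<bullet> w)) (at z)"
proof -
  have "f differentiable (at z)" using assms unfolding Ck.simps differentiable_on_def by blast
  then obtain D where D: "(f has_derivative D) (at z)" unfolding differentiable_def by blast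
  then interpret linear D by (rule has_derivative_linear)
  have "D w = grad f z \<bullet> w" for w
  proof -
    have "D w = D (\<Sum>i\<in>Basis. (w \<bullet> i) *\<^sub>R i)" by (simp only: euclidean_representation)
    also have "\<dots> = (\<Sum>i\<in>Basis. (w \<bullet> i) *\<^sub>R D i)" by (simp only: sum scale)
    also have "\<dots> = grad f z \<bullet> w"
      unfolding grad_def pderiv_eq[OF D] inner_sum_left inner_scaleR_left
      by (simp add: inner_commute mult.commute)
    finally show ?thesis .
  qed
  then have "D = (\<lambda>w. grad f z \<bullet> w)" by (rule ext)
  with D show ?thesis by simp
qed

lemma Ck_continuous: "Ck k f \<Longrightarrow> continuous_on UNIV f"
  by (cases k) (auto intro: differentiable_imp_continuous_on)

lemma Ck_SucD: "Ck (Suc k) f \<Longrightarrow> Ck k f"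
proof (induction k arbitrary: f)
  case 0
  then show ?case using Ck_continuous[OF 0] by simp
qed auto

lemma Ck_const: "Ck k (\<lambda>_. c)"
proof (induction k arbitrary: c)
  case (Suc k)
  show ?case by (rule Ck_SucI[OF has_derivative_const Suc])
qed auto

lemma Ck_add: "Ck k f \<Longrightarrow> Ck k g \<Longrightarrow> Ck k (\<lambda>z. f z + g z)"
proof (induction k arbitrary: f g)
  case (Suc k)
  note d = Suc.prems[THEN Ck_has_derivative]
  show ?case
    by (rule Ck_SucI[OF has_derivative_add[OF d] Suc.IH])
      (use Suc.prems in \<open>auto simp: grad_inner_Basis\<close>)
qed (auto intro!: continuous_intros)

lemma Ck_mult: "Ck k f \<Longrightarrow> Ck k g \<Longrightarrow> Ck k (\<lambda>z. f z * g z)"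
proof (induction k arbitrary: f g)
  case (Suc k)
  note d = Suc.prems[THEN Ck_has_derivative]
  show ?case
    by (rule Ck_SucI[OF has_derivative_mult[OF d] Ck_add[OF Suc.IH Suc.IH]])
      (use Suc.prems Suc.prems[THEN Ck_SucD] in \<open>auto simp: grad_inner_Basis\<close>)
qed (auto intro!: continuous_intros)

text \<open>Profiles of one variable composed with affine forms, together with sums and products,
  generate every concrete smooth function needed in the plane: cutoffs, affine functions, the
  lifting and the bump.\<close>

lemma Ck_comp_affine: "Ck1 k f \<Longrightarrow> Ck k (\<lambda>z. f (c + a \<bullet> z))"
proof (induction k arbitrary: f)
  case 0
  then show ?case by (auto intro!: continuous_intros continuous_on_compose2[of UNIV f])
next
  case (Suc k)
  from Suc.prems obtain f' where d: "\<And>x. (f has_real_derivative f' x) (at x)" and C: "Ck1 k f'"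
    by (blast elim!: Ck1_SucE)
  have "((\<lambda>z. f (c + a \<bullet> z)) has_derivative (\<lambda>w. f' (c + a \<bullet> z) * (a \<bullet> w))) (at z)" for z
    by (rule has_derivative_compose[of "\<lambda>z. c + a \<bullet> z", OF _ d[unfolded has_field_derivative_def]])
      (auto intro!: derivative_eq_intros)
  then show ?case
    by (rule Ck_SucI) (rule Ck_mult[OF Suc.IH[OF C] Ck_const])
qed

lemma smooth_const: "smooth (\<lambda>_. c)"
  unfolding smooth_def by (blast intro: Ck_const)

lemma smooth_add: "smooth f \<Longrightarrow> smooth g \<Longrightarrow> smooth (\<lambda>z. f z + g z)"
  unfolding smooth_def by (blast intro: Ck_add)

lemma smooth_mult: "smooth f \<Longrightarrow> smooth g \<Longrightarrow> smooth (\<lambda>z. f z * g z)"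
  unfolding smooth_def by (blast intro: Ck_mult)

lemma smooth_diff: "smooth f \<Longrightarrow> smooth g \<Longrightarrow> smooth (\<lambda>z. f z - g z)"
  using smooth_add[of f "\<lambda>z. (-1) * g z"] smooth_mult[OF smooth_const, of g "-1"] by simp

lemma smooth_comp_affine: "(\<And>k. Ck1 k f) \<Longrightarrow> smooth (\<lambda>z. f (c + a \<bullet> z))"
  unfolding smooth_def by (blast intro: Ck_comp_affine)

lemma smooth_P1:
  assumes "p \<in> P1" shows "smooth p"
proof -
  obtain c w where "p = (\<lambda>z. c + w \<bullet> z)" using assms unfolding P1_def by blast
  moreover have "smooth (\<lambda>z. (\<lambda>x. 0 + 1 * x) (c + w \<bullet> z))"
    by (rule smooth_comp_affine[OF Ck1_affine])
  ultimately show ?thesis by simp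
qed

lemma smooth_has_derivative: "smooth f \<Longrightarrow> (f has_derivative (\<lambda>w. grad f z \<bullet> w)) (at z)"
  unfolding smooth_def by (blast intro: Ck_has_derivative)

lemma smooth_pderiv: "smooth f \<Longrightarrow> i \<in> Basis \<Longrightarrow> smooth (Defs.pderiv i f)"
  unfolding smooth_def by (meson Ck.simps(2))

lemma smooth_continuous: "smooth f \<Longrightarrow> continuous_on A f"
  unfolding smooth_def using Ck_continuous continuous_on_subset by blast

lemma smooth_grad_continuous: "smooth f \<Longrightarrow> continuous_on A (grad f)"
  unfolding grad_def[abs_def] by (intro continuous_intros smooth_continuous smooth_pderiv)

lemma grad_diff: "smooth f \<Longrightarrow> smooth g \<Longrightarrow> grad (\<lambda>z. f z - g z) z = grad f z - grad g z"
  by (rule grad_eq) (auto intro!: derivative_eq_intros smooth_has_derivative simp: inner_diff_left)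

lemma grad_mult: "smooth f \<Longrightarrow> smooth g \<Longrightarrow>
    grad (\<lambda>z. f z * g z) z = f z *\<^sub>R grad g z + g z *\<^sub>R grad f z"
  by (rule grad_eq) (auto intro!: derivative_eq_intros smooth_has_derivative simp: inner_add_left)

lemma grad_comp_affine:
  assumes "(f has_real_derivative d) (at (c + a \<bullet> z))"
  shows "grad (\<lambda>z. f (c + a \<bullet> z)) z = d *\<^sub>R a"
proof (rule grad_eq)
  have "((\<lambda>z. c + a \<bullet> z) has_derivative (\<lambda>w. a \<bullet> w)) (at z)"
    by (auto intro!: derivative_eq_intros)
  from has_derivative_compose[OF this assms[unfolded has_field_derivative_def]]
  show "((\<lambda>z. f (c + a \<bullet> z)) has_derivative (\<lambda>w. (d *\<^sub>R a) \<bullet> w)) (at z)"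
    by simp
qed

lemma grad_P1: "grad (\<lambda>z. c + w \<bullet> z) z = w"
  by (rule grad_eq) (auto intro!: derivative_eq_intros)

section \<open>Test functions and their supports\<close>

lemma test_funI:
  assumes "smooth \<phi>" "\<And>z. \<phi> z \<noteq> 0 \<Longrightarrow> z \<in> K" "compact K" "K \<subseteq> E"
  shows "test_fun E \<phi>"
proof -
  have s: "closure {z. \<phi> z \<noteq> 0} \<subseteq> K"
    by (rule closure_minimal) (use assms compact_imp_closed in auto)
  have "compact (K \<inter> closure {z. \<phi> z \<noteq> 0})"
    by (intro compact_Int_closed assms closed_closure)
  with s assms show ?thesis by (simp add: test_fun_def inf_absorb2)
qed

lemma test_fun_mult:
  assumes "test_fun E \<phi>" "smooth \<psi>" shows "test_fun E (\<lambda>z. \<phi> z * \<psi> z)"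
  by (rule test_funI[of _ "closure {z. \<phi> z \<noteq> 0}"])
    (use assms closure_subset[of "{z. \<phi> z \<noteq> 0}"] in \<open>auto simp: test_fun_def intro: smooth_mult\<close>)

lemma pderiv_outside_support:
  assumes "z \<notin> closure {z. \<phi> z \<noteq> 0}"
  shows "Defs.pderiv i \<phi> z = 0"
proof -
  have "(\<phi> has_derivative (\<lambda>_. 0)) (at z)"
    by (rule has_derivative_transform_within_open[of "\<lambda>_. 0" _ _ _ "- closure {z. \<phi> z \<noteq> 0}"])
      (use assms closure_subset[of "{z. \<phi> z \<noteq> 0}"] in auto)
  then show ?thesis by (simp add: pderiv_eq)
qed

lemma test_fun_pderiv:
  assumes "test_fun E \<phi>" "i \<in> Basis" shows "test_fun E (Defs.pderiv i \<phi>)"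
proof (rule test_funI[of _ "closure {z. \<phi> z \<noteq> 0}"])
  show "z \<in> closure {z. \<phi> z \<noteq> 0}" if "Defs.pderiv i \<phi> z \<noteq> 0" for z
    using that pderiv_outside_support by blast
qed (use assms in \<open>auto simp: test_fun_def intro: smooth_pderiv\<close>)

lemma test_fun_outside: "test_fun E \<phi> \<Longrightarrow> z \<notin> E \<Longrightarrow> \<phi> z = 0"
  unfolding test_fun_def using closure_subset[of "{z. \<phi> z \<noteq> 0}"] by auto

section \<open>Square integrable functions\<close>

text \<open>\<open>L2\<close> refers to \<open>lebesgue\<close> and a set; a version for an
  arbitrary measure lets one collection of Hilbert space estimates serve both the element and the
  unit interval that parametrizes an edge.\<close>

definition square_integrable :: "'a measure \<Rightarrow> ('a \<Rightarrow> 'b::euclidean_space) \<Rightarrow> bool" where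
  "square_integrable M f \<longleftrightarrow> f \<in> borel_measurable M \<and> integrable M (\<lambda>x. (norm (f x))\<^sup>2)"

lemma L2_iff_square_integrable:
  assumes "S \<in> sets lebesgue"
  shows "L2 S f \<longleftrightarrow> square_integrable (lebesgue_on S) f"
  using assms unfolding L2_def square_integrable_def set_borel_measurable_def
  by (simp add: borel_measurable_restrict_space_iff integrable_restrict_space set_integrable_def)

lemma LINT_restrict:
  assumes "S \<in> sets lebesgue"
  shows "(LINT z:S|lebesgue. f z :: 'b::euclidean_space) = (\<integral>z. f z \<partial>lebesgue_on S)"
  using assms by (simp add: integral_restrict_space set_lebesgue_integral_def)

lemma inner_le_sum_squares: "\<bar>a \<bullet> b\<bar> \<le> (norm a)\<^sup>2 + (norm (b :: 'a :: real_inner))\<^sup>2"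
proof -
  have "\<bar>a \<bullet> b\<bar> \<le> norm a * norm b" by (rule Cauchy_Schwarz_ineq2)
  also have "\<dots> \<le> (norm a)\<^sup>2 + (norm b)\<^sup>2"
    using sum_squares_bound[of "norm a" "norm b"] mult_nonneg_nonneg[OF norm_ge_zero[of a] norm_ge_zero[of b]]
    by linarith
  finally show ?thesis .
qed

lemma norm_add_sq: "(norm (a + b))\<^sup>2 \<le> 2 * (norm a)\<^sup>2 + 2 * (norm (b :: 'a :: real_inner))\<^sup>2"
proof -
  have "(norm (a + b))\<^sup>2 + (norm (a - b))\<^sup>2 = 2 * (norm a)\<^sup>2 + 2 * (norm b)\<^sup>2"
    by (simp add: power2_norm_eq_inner inner_add_left inner_add_right inner_diff_left
        inner_diff_right inner_commute)
  then show ?thesis using zero_le_power2[of "norm (a - b)"] by linarith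
qed

lemma square_integrable_measurable: "square_integrable M f \<Longrightarrow> f \<in> borel_measurable M"
  by (simp add: square_integrable_def)

lemma square_integrable_inner:
  assumes "square_integrable M f" "square_integrable M g" shows "integrable M (\<lambda>x. f x \<bullet> g x)"
proof (rule Bochner_Integration.integrable_bound)
  show "integrable M (\<lambda>x. (norm (f x))\<^sup>2 + (norm (g x))\<^sup>2)"
    using assms by (simp add: square_integrable_def)
  show "(\<lambda>x. f x \<bullet> g x) \<in> borel_measurable M"
    using assms[THEN square_integrable_measurable] by measurable
  show "AE x in M. norm (f x \<bullet> g x) \<le> norm ((norm (f x))\<^sup>2 + (norm (g x))\<^sup>2)"
    using inner_le_sum_squares by auto
qed

lemma square_integrable_mult: "square_integrable M f \<Longrightarrow> square_integrable M g \<Longrightarrow> integrable M (\<lambda>x. f x * (g x :: real))"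
  using square_integrable_inner[of M f g] by simp

lemma square_integrable_add:
  assumes "square_integrable M f" "square_integrable M g" shows "square_integrable M (\<lambda>x. f x + g x)"
  unfolding square_integrable_def
proof
  show m: "(\<lambda>x. f x + g x) \<in> borel_measurable M"
    using assms[THEN square_integrable_measurable] by measurable
  show "integrable M (\<lambda>x. (norm (f x + g x))\<^sup>2)"
  proof (rule Bochner_Integration.integrable_bound)
    show "integrable M (\<lambda>x. 2 * (norm (f x))\<^sup>2 + 2 * (norm (g x))\<^sup>2)"
      using assms by (simp add: square_integrable_def)
    show "AE x in M. norm ((norm (f x + g x))\<^sup>2) \<le> norm (2 * (norm (f x))\<^sup>2 + 2 * (norm (g x))\<^sup>2)"
      using norm_add_sq by auto
    show "(\<lambda>x. (norm (f x + g x))\<^sup>2) \<in> borel_measurable M" using m by measurable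
  qed
qed

lemma square_integrable_scaleR: "square_integrable M f \<Longrightarrow> square_integrable M (\<lambda>x. c *\<^sub>R f x)"
  unfolding square_integrable_def by (auto simp: power_mult_distrib)

lemma square_integrable_minus: "square_integrable M f \<Longrightarrow> square_integrable M (\<lambda>x. - f x)"
  using square_integrable_scaleR[of M f "-1"] by simp

lemma square_integrable_diff: "square_integrable M f \<Longrightarrow> square_integrable M g \<Longrightarrow> square_integrable M (\<lambda>x. f x - g x)"
  using square_integrable_add[OF _ square_integrable_minus, of M f g] by simp

lemma square_integrable_bounded:
  assumes "finite_measure M" "f \<in> borel_measurable M" "\<And>x. x \<in> space M \<Longrightarrow> norm (f x) \<le> B"
  shows "square_integrable M f"
proof -
  interpret finite_measure M by fact
  have "integrable M (\<lambda>x. (norm (f x))\<^sup>2)"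
    by (rule integrable_const_bound[of _ "B\<^sup>2"])
      (use assms in \<open>auto intro!: power_mono AE_I2\<close>)
  with assms show ?thesis by (simp add: square_integrable_def)
qed

lemma square_integrable_integrable:
  assumes "finite_measure M" "square_integrable M f" shows "integrable M f"
proof -
  interpret finite_measure M by fact
  have i: "integrable M (\<lambda>x. 1 + (norm (f x))\<^sup>2)" using assms by (simp add: square_integrable_def)
  have "norm (f x) \<le> norm (1 + (norm (f x))\<^sup>2)" for x
    using sum_squares_bound[of "norm (f x)" 1] norm_ge_zero[of "f x"]
    unfolding real_norm_def power_one mult_1_right by linarith
  then show ?thesis
    using Bochner_Integration.integrable_bound[OF i square_integrable_measurable[OF assms(2)]] by blast
qed

text \<open>Discriminant argument for the nonnegative quadratic
  \<open>A - 2 * t * B + t\<^sup>2 * C\<close>, which works with functions directly and needs no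
  identification up to null sets.\<close>

lemma square_integrable_Cauchy_Schwarz_sq:
  assumes "square_integrable M f" "square_integrable M g"
  shows "(\<integral>x. f x \<bullet> g x \<partial>M)\<^sup>2 \<le> (\<integral>x. (norm (f x))\<^sup>2 \<partial>M) * (\<integral>x. (norm (g x))\<^sup>2 \<partial>M)"
proof -
  define A B C where "A = (\<integral>x. (norm (f x))\<^sup>2 \<partial>M)" and "B = (\<integral>x. f x \<bullet> g x \<partial>M)"
    and "C = (\<integral>x. (norm (g x))\<^sup>2 \<partial>M)"
  have q: "0 \<le> A - 2 * t * B + t\<^sup>2 * C" for t
  proof -
    have "0 \<le> (\<integral>x. (norm (f x - t *\<^sub>R g x))\<^sup>2 \<partial>M)" by simp
    also have "(\<lambda>x. (norm (f x - t *\<^sub>R g x))\<^sup>2)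
        = (\<lambda>x. (norm (f x))\<^sup>2 - 2 * t * (f x \<bullet> g x) + t\<^sup>2 * (norm (g x))\<^sup>2)"
      unfolding power2_norm_eq_inner
      by (auto simp: inner_diff_left inner_diff_right inner_commute power2_eq_square algebra_simps)
    also have "integral\<^sup>L M \<dots> = A - 2 * t * B + t\<^sup>2 * C"
      using assms square_integrable_inner[OF assms] by (simp add: A_def B_def C_def square_integrable_def)
    finally show ?thesis .
  qed
  have C: "C \<ge> 0" and A: "A \<ge> 0" by (simp_all add: C_def A_def)
  have "B\<^sup>2 \<le> A * C"
  proof (cases "C = 0")
    case True
    have "B = 0"
    proof (rule ccontr)
      assume "B \<noteq> 0"
      \<comment> \<open>For \<open>C = 0\<close> the quadratic is affine in \<open>t\<close>; at
        this \<open>t\<close> it equals -1.\<close>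
      then show False using q[of "(A + 1) / (2 * B)"] True by (simp add: field_simps)
    qed
    then show ?thesis using True by simp
  next
    case False
    with C have "C > 0" by simp
    \<comment> \<open>\<open>B / C\<close> minimizes the quadratic.\<close>
    then show ?thesis using q[of "B / C"] by (simp add: field_simps power2_eq_square)
  qed
  then show ?thesis by (simp add: A_def B_def C_def)
qed

lemma square_integrable_Cauchy_Schwarz:
  assumes "square_integrable M f" "square_integrable M g"
  shows "\<bar>\<integral>x. f x \<bullet> g x \<partial>M\<bar> \<le> sqrt (\<integral>x. (norm (f x))\<^sup>2 \<partial>M) * sqrt (\<integral>x. (norm (g x))\<^sup>2 \<partial>M)"
  using real_sqrt_le_mono[OF square_integrable_Cauchy_Schwarz_sq[OF assms]] by (simp add: real_sqrt_mult)

text \<open>By Cauchy-Schwarz, pairing with a fixed square integrable function is continuous; this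
  carries identities for test functions over to their limits.\<close>

lemma square_integrable_inner_tendsto:
  assumes "square_integrable M f" "\<And>n. square_integrable M (g n)" "square_integrable M g'"
    and "(\<lambda>n. \<integral>x. (norm (g n x - g' x))\<^sup>2 \<partial>M) \<longlonglongrightarrow> 0"
  shows "(\<lambda>n. \<integral>x. f x \<bullet> g n x \<partial>M) \<longlonglongrightarrow> (\<integral>x. f x \<bullet> g' x \<partial>M)"
proof (rule Lim_null[THEN iffD2], rule Lim_null_comparison)
  show "\<forall>\<^sub>F n in sequentially. norm ((\<integral>x. f x \<bullet> g n x \<partial>M) - (\<integral>x. f x \<bullet> g' x \<partial>M))
      \<le> sqrt (\<integral>x. (norm (f x))\<^sup>2 \<partial>M) * sqrt (\<integral>x. (norm (g n x - g' x))\<^sup>2 \<partial>M)"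
  proof (rule always_eventually, rule allI)
    fix n
    have "(\<integral>x. f x \<bullet> g n x \<partial>M) - (\<integral>x. f x \<bullet> g' x \<partial>M) = (\<integral>x. f x \<bullet> (g n x - g' x) \<partial>M)"
      using assms(1-3) by (simp add: inner_diff_right Bochner_Integration.integral_diff square_integrable_inner)
    then show "norm ((\<integral>x. f x \<bullet> g n x \<partial>M) - (\<integral>x. f x \<bullet> g' x \<partial>M))
      \<le> sqrt (\<integral>x. (norm (f x))\<^sup>2 \<partial>M) * sqrt (\<integral>x. (norm (g n x - g' x))\<^sup>2 \<partial>M)"
      using square_integrable_Cauchy_Schwarz[OF assms(1) square_integrable_diff[OF assms(2,3)], of n] by simp
  qed
  show "(\<lambda>n. sqrt (\<integral>x. (norm (f x))\<^sup>2 \<partial>M) * sqrt (\<integral>x. (norm (g n x - g' x))\<^sup>2 \<partial>M)) \<longlonglongrightarrow> 0"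
    using tendsto_mult_right_zero[OF tendsto_real_sqrt[OF assms(4), simplified]] by simp
qed

lemma square_integrable_norm_add_le:
  assumes "square_integrable M f" "square_integrable M g"
  shows "(\<integral>x. (norm (f x + g x))\<^sup>2 \<partial>M) \<le> 2 * (\<integral>x. (norm (f x))\<^sup>2 \<partial>M) + 2 * (\<integral>x. (norm (g x))\<^sup>2 \<partial>M)"
proof -
  have "(\<integral>x. (norm (f x + g x))\<^sup>2 \<partial>M) \<le> (\<integral>x. 2 * (norm (f x))\<^sup>2 + 2 * (norm (g x))\<^sup>2 \<partial>M)"
    using assms square_integrable_add[OF assms] by (intro integral_mono norm_add_sq) (auto simp: square_integrable_def)
  also have "\<dots> = 2 * (\<integral>x. (norm (f x))\<^sup>2 \<partial>M) + 2 * (\<integral>x. (norm (g x))\<^sup>2 \<partial>M)"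
    using assms by (simp add: square_integrable_def)
  finally show ?thesis .
qed

lemma continuous_bounded_on_bounded:
  fixes f :: "'a::euclidean_space \<Rightarrow> 'b::euclidean_space"
  assumes "continuous_on UNIV f" "bounded S"
  obtains B where "B > 0" "\<And>x. x \<in> S \<Longrightarrow> norm (f x) \<le> B"
proof -
  have "bounded (f ` closure S)"
    using assms by (intro compact_imp_bounded compact_continuous_image)
      (auto intro: continuous_on_subset)
  then obtain B where "B > 0" "\<And>x. x \<in> closure S \<Longrightarrow> norm (f x) \<le> B"
    unfolding bounded_pos by auto
  then show ?thesis using that closure_subset by blast
qed

lemma finite_measure_lebesgue_on_bounded:
  assumes "bounded S" "S \<in> sets lebesgue" shows "finite_measure (lebesgue_on S)"
  by (rule finite_measure_lebesgue_on) (rule bounded_set_imp_lmeasurable[OF assms])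

lemma continuous_measurable_lebesgue_on:
  fixes f :: "'a::euclidean_space \<Rightarrow> 'b::euclidean_space"
  assumes "continuous_on UNIV f"
  shows "f \<in> borel_measurable (lebesgue_on S)"
  by (intro measurable_restrict_space1 measurable_completion)
    (simp add: borel_measurable_continuous_onI[OF assms])

lemma square_integrable_continuous:
  fixes f :: "'a::euclidean_space \<Rightarrow> 'b::euclidean_space"
  assumes "continuous_on UNIV f" "bounded S" "S \<in> sets lebesgue"
  shows "square_integrable (lebesgue_on S) f"
proof -
  obtain B where "\<And>x. x \<in> S \<Longrightarrow> norm (f x) \<le> B"
    using continuous_bounded_on_bounded[OF assms(1,2)] by metis
  then show ?thesis
    by (intro square_integrable_bounded[of _ _ B] finite_measure_lebesgue_on_bounded assms continuous_measurable_lebesgue_on)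
      (auto simp: space_restrict_space)
qed

lemma integrable_mult_indicator_real:
  fixes f :: "'a \<Rightarrow> real"
  assumes "integrable M f" "(\<lambda>z. indicator S z :: real) \<in> borel_measurable M"
  shows "integrable M (\<lambda>z. f z * indicator S z)"
proof (rule Bochner_Integration.integrable_bound[OF assms(1)])
  show "(\<lambda>z. f z * indicator S z) \<in> borel_measurable M"
    using assms(2) borel_measurable_integrable[OF assms(1)] by measurable
qed (auto simp: indicator_def)

lemma square_integrable_indicator_integrable:
  assumes "square_integrable M f" "(\<lambda>z. indicator S z :: real) \<in> borel_measurable M"
  shows "integrable M (\<lambda>z. (norm (f z))\<^sup>2 * indicator S z)"
  using assms by (intro integrable_mult_indicator_real) (simp_all add: square_integrable_def)

lemma indicator_borel_lebesgue_on:
  assumes "S \<in> sets borel" shows "(\<lambda>z. indicator S z :: real) \<in> borel_measurable (lebesgue_on T)"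
proof -
  have "S \<in> sets lebesgue" using assms sets_completionI_sets by force
  then show ?thesis by (intro measurable_restrict_space1) simp
qed

section \<open>The trapezoid and its bilinear parametrizations\<close>

locale trapezoid =
  fixes h e1 e2 :: real
  assumes e1: "0 < e1" and e12: "e1 \<le> e2" and e2h: "e2 \<le> h"
begin

abbreviation k :: "real \<Rightarrow> real" where "k \<equiv> kappa h e1 e2"
abbreviation vs :: "pt list" where "vs \<equiv> quad h e1 e2"
abbreviation E :: "pt set" where "E \<equiv> polygon vs"
definition slope :: real where "slope = (e2 - e1) / h"

lemma h_pos: "0 < h" and e2_pos: "0 < e2" using e1 e12 e2h by auto

text \<open>\<open>slope\<close> is the rate at which the width shrinks with height. Its bound by 1,
  a consequence of \<open>e2 \<le> h\<close>, lets the part of the vertical derivative of the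
  lifting that comes from the changing width be absorbed by the horizontal derivative.\<close>

lemma slope_ge_0: "0 \<le> slope" and slope_le_1: "slope \<le> 1"
  using e1 e12 e2h by (auto simp: slope_def)

lemma k_eq: "k y = e2 - slope * y"
  using h_pos by (simp add: kappa_def slope_def field_simps)

lemma slope_h: "slope * h = e2 - e1"
  using h_pos by (simp add: slope_def)

lemma k_le: "0 \<le> y \<Longrightarrow> k y \<le> e2"
  using mult_nonneg_nonneg[OF slope_ge_0, of y] by (simp add: k_eq)

lemma k_ge: "y \<le> h \<Longrightarrow> e1 \<le> k y"
  using mult_left_mono[OF _ slope_ge_0, of y h] slope_h by (simp add: k_eq)

lemma k_pos: "y \<le> h \<Longrightarrow> 0 < k y"
  using k_ge e1 by fastforce

text \<open>\<open>kappa_slice\<close> settles the slices at heights in \<open>{0..h}\<close>; two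
  half-planes containing the vertices exclude all other heights.\<close>

lemma hull_eq: "convex hull (set vs) = {z. 0 \<le> fst z \<and> fst z \<le> k (snd z) \<and> 0 \<le> snd z \<and> snd z \<le> h}"
proof -
  have s: "{x. (x, y) \<in> convex hull (set vs)} = {0..k y}" if "0 \<le> y" "y \<le> h" for y
    using kappa_slice[OF e1 e12 h_pos, of y] that by simp
  have "convex hull (set vs) \<subseteq> {z. 0 \<le> (0, 1) \<bullet> z} \<inter> {z. (0, 1) \<bullet> z \<le> h}"
  proof (rule hull_minimal)
    show "set vs \<subseteq> {z. 0 \<le> (0, 1) \<bullet> z} \<inter> {z. (0, 1) \<bullet> z \<le> h}"
      using h_pos by (simp add: quad_def)
    show "convex ({z. 0 \<le> (0, 1) \<bullet> z} \<inter> {z::pt. (0, 1) \<bullet> z \<le> h})"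
      by (rule convex_Int[OF convex_halfspace_ge convex_halfspace_le])
  qed
  then have y: "0 \<le> y \<and> y \<le> h" if "(x, y) \<in> convex hull (set vs)" for x y
    using that by auto
  have "(x, y) \<in> convex hull (set vs) \<longleftrightarrow> 0 \<le> x \<and> x \<le> k y \<and> 0 \<le> y \<and> y \<le> h" for x y
  proof (cases "0 \<le> y \<and> y \<le> h")
    case True
    then have "x \<in> {x. (x, y) \<in> convex hull (set vs)} \<longleftrightarrow> x \<in> {0..k y}" using s by blast
    with True show ?thesis by (simp only: mem_Collect_eq atLeastAtMost_iff simp_thms)
  qed (use y in blast)
  note eq = this
  have "z \<in> convex hull (set vs) \<longleftrightarrow> 0 \<le> fst z \<and> fst z \<le> k (snd z) \<and> 0 \<le> snd z \<and> snd z \<le> h" for z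
    using eq[of "fst z" "snd z"] by (simp only: prod.collapse)
  then show ?thesis by blast
qed

text \<open>Once the hull is an intersection of four closed half-planes, the interior can be taken
  factor by factor; each normal is nonzero, so every inequality merely becomes strict.\<close>

lemma E_eq: "E = {z. 0 < fst z \<and> fst z < k (snd z) \<and> 0 < snd z \<and> snd z < h}"
proof -
  have "convex hull (set vs) = {z. (-1, 0) \<bullet> z \<le> 0} \<inter> {z. (1, slope) \<bullet> z \<le> e2}
      \<inter> ({z. (0, -1) \<bullet> z \<le> 0} \<inter> {z. (0, 1) \<bullet> z \<le> h})"
    unfolding hull_eq by (auto simp: k_eq)
  moreover have i: "interior {z. a \<bullet> z \<le> b} = {z. a \<bullet> z < b}" if "a \<noteq> 0" for a :: pt and b
    using that by (rule interior_halfspace_le)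
  have ne: "(-1, 0) \<noteq> (0::pt)" "(1, slope) \<noteq> (0::pt)" "(0, -1) \<noteq> (0::pt)" "(0, 1) \<noteq> (0::pt)"
    by (simp_all add: zero_prod_def)
  ultimately have eq: "interior (convex hull (set vs)) = {z. (-1, 0) \<bullet> z < 0} \<inter> {z. (1, slope) \<bullet> z < e2}
      \<inter> ({z. (0, -1) \<bullet> z < 0} \<inter> {z. (0, 1) \<bullet> z < h})"
    by (simp only: interior_Int i[OF ne(1)] i[OF ne(2)] i[OF ne(3)] i[OF ne(4)])
  show ?thesis unfolding polygon_def eq by (auto simp: k_eq)
qed

lemma open_E: "open E" unfolding polygon_def by simp

lemma E_borel: "E \<in> sets borel"
  using open_E by (rule borel_open)

lemma E_lebesgue: "E \<in> sets lebesgue"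
  using E_borel sets_completionI_sets by force

lemma bounded_E: "bounded E"
proof -
  have "E \<subseteq> convex hull (set vs)" unfolding polygon_def by (rule interior_subset)
  then show ?thesis
    by (meson bounded_subset bounded_convex_hull finite_imp_bounded finite_set)
qed

end

section \<open>Integrals over the unit square and its symmetries\<close>

definition unit_nn :: "(real \<Rightarrow> real \<Rightarrow> ennreal) \<Rightarrow> ennreal" where
  "unit_nn g = (\<integral>\<^sup>+t\<in>{0<..<1}. (\<integral>\<^sup>+s\<in>{0<..<1}. g s t \<partial>lborel) \<partial>lborel)"

lemma nn_reflect:
  assumes "g \<in> borel_measurable borel"
  shows "(\<integral>\<^sup>+s\<in>{0<..<1::real}. g (1 - s) \<partial>lborel) = (\<integral>\<^sup>+s\<in>{0<..<1}. g s \<partial>lborel)"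
proof -
  have "(\<integral>\<^sup>+s. g s * indicator {0<..<1} s \<partial>lborel)
      = ennreal \<bar>-1\<bar> * (\<integral>\<^sup>+s. g (1 + -1 * s) * indicator {0<..<1} (1 + -1 * s) \<partial>lborel)"
    by (rule nn_integral_real_affine) (use assms in auto)
  also have "(\<lambda>s. g (1 + -1 * s) * indicator {0<..<1} (1 + -1 * s)) = (\<lambda>s. g (1 - s) * indicator {0<..<1} s)"
    by (auto simp: indicator_def)
  finally show ?thesis by simp
qed

lemma unit_nn_reflect1:
  assumes [measurable]: "case_prod g \<in> borel_measurable borel"
  shows "unit_nn (\<lambda>s t. g (1 - s) t) = unit_nn g"
proof -
  have "(\<lambda>s. g s t) \<in> borel_measurable borel" for t
    using measurable_compose[of "\<lambda>s. (s, t)" borel borel "case_prod g"] by simp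
  then show ?thesis unfolding unit_nn_def by (subst nn_reflect) auto
qed

lemma unit_nn_swap:
  assumes "case_prod g \<in> borel_measurable borel"
  shows "unit_nn (\<lambda>s t. g t s) = unit_nn g"
proof -
  have [measurable]: "case_prod g \<in> borel_measurable (lborel \<Otimes>\<^sub>M lborel)"
    using assms by (simp add: borel_prod[symmetric] cong: measurable_cong_sets)
  have [measurable]: "(\<lambda>(s, t). g t s) \<in> borel_measurable (lborel \<Otimes>\<^sub>M lborel)"
    by measurable
  have "unit_nn (\<lambda>s t. g t s)
      = (\<integral>\<^sup>+t. (\<integral>\<^sup>+s. g t s * indicator {0<..<1} s * indicator {0<..<1} t \<partial>lborel) \<partial>lborel)"
    unfolding unit_nn_def by (intro nn_integral_cong nn_integral_multc[symmetric]) measurable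
  also have "\<dots> = (\<integral>\<^sup>+s. (\<integral>\<^sup>+t. g t s * indicator {0<..<1} s * indicator {0<..<1} t \<partial>lborel) \<partial>lborel)"
    by (rule lborel_pair.Fubini') measurable
  also have "\<dots> = (\<integral>\<^sup>+s. (\<integral>\<^sup>+t. g t s * indicator {0<..<1} t * indicator {0<..<1} s \<partial>lborel) \<partial>lborel)"
    by (simp add: ac_simps)
  also have "\<dots> = unit_nn g"
    unfolding unit_nn_def by (intro nn_integral_cong nn_integral_multc) measurable
  finally show ?thesis .
qed

text \<open>Reflecting the outer variable is the reflection of the inner one conjugated by
  \<open>unit_nn_swap\<close>.\<close>

lemma unit_nn_reflect2:
  assumes [measurable]: "case_prod g \<in> borel_measurable borel"
  shows "unit_nn (\<lambda>s t. g s (1 - t)) = unit_nn g"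
proof -
  have "(\<lambda>z. case_prod g (snd z, fst z)) \<in> borel_measurable borel"
    by (rule measurable_compose[OF _ assms]) (intro borel_measurable_continuous_onI continuous_intros)
  then have m: "case_prod (\<lambda>s t. g t s) \<in> borel_measurable borel" by (simp add: split_beta')
  have "(\<lambda>z. case_prod g (fst z, 1 - snd z)) \<in> borel_measurable borel"
    by (rule measurable_compose[OF _ assms]) (intro borel_measurable_continuous_onI continuous_intros)
  then have m2: "case_prod (\<lambda>s t. g s (1 - t)) \<in> borel_measurable borel" by (simp add: split_beta')
  have "unit_nn (\<lambda>s t. g s (1 - t)) = unit_nn (\<lambda>s t. g t (1 - s))"
    using unit_nn_swap[OF m2] by simp
  also have "\<dots> = unit_nn (\<lambda>s t. g t s)"
    by (rule unit_nn_reflect1[OF m])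
  also have "\<dots> = unit_nn g" by (rule unit_nn_swap[OF assms])
  finally show ?thesis .
qed

lemma unit_nn_mono:
  assumes "\<And>s t. 0 < s \<Longrightarrow> s < 1 \<Longrightarrow> 0 < t \<Longrightarrow> t < 1 \<Longrightarrow> f s t \<le> g s t"
  shows "unit_nn f \<le> unit_nn g"
  unfolding unit_nn_def using assms
  by (intro nn_integral_mono) (auto simp: indicator_def intro!: nn_integral_mono)

lemma unit_nn_cmult:
  assumes "case_prod g \<in> borel_measurable borel"
  shows "unit_nn (\<lambda>s t. c * g s t) = c * unit_nn g"
proof -
  have [measurable]: "case_prod g \<in> borel_measurable (lborel \<Otimes>\<^sub>M lborel)"
    using assms by (simp add: borel_prod[symmetric] cong: measurable_cong_sets)
  have "unit_nn (\<lambda>s t. c * g s t)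
     = (\<integral>\<^sup>+t. c * (\<integral>\<^sup>+s\<in>{0<..<1}. g s t \<partial>lborel) * indicator {0<..<1} t \<partial>lborel)"
    unfolding unit_nn_def
    by (intro nn_integral_cong arg_cong2[where f = "(*)"] refl)
      (simp only: mult.assoc, rule nn_integral_cmult, measurable)
  also have "\<dots> = c * unit_nn g"
    unfolding unit_nn_def mult.assoc by (rule nn_integral_cmult) measurable
  finally show ?thesis .
qed

text \<open>Corner order: the parameters \<open>(s, t)\<close> = (0, 0), (0, 1), (1, 1), (1, 0) go
  to \<open>a\<close>, \<open>b\<close>, \<open>c\<close>, \<open>d\<close>. For fixed
  \<open>t\<close> the map is affine in \<open>s\<close>, so functions can be integrated along
  segments that start on the edge from \<open>a\<close> to \<open>b\<close>.\<close>

definition bilin :: "pt \<Rightarrow> pt \<Rightarrow> pt \<Rightarrow> pt \<Rightarrow> real \<Rightarrow> real \<Rightarrow> pt" where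
  "bilin a b c d s t = linepath (linepath a b t) (linepath d c t) s"

lemma bilin_measurable: "case_prod (bilin a b c d) \<in> borel_measurable borel"
  unfolding bilin_def linepath_def split_beta'
  by (intro borel_measurable_continuous_onI continuous_intros)

context trapezoid
begin

text \<open>The substitution \<open>x = s * k y\<close>, \<open>y = t * h\<close> straightens the
  slanted edge and has Jacobian \<open>h * k y\<close>. Nonnegative integrals keep the exchange of
  integrations free of integrability conditions.\<close>

lemma nn_integral_E:
  assumes [measurable]: "f \<in> borel_measurable borel"
  shows "(\<integral>\<^sup>+z\<in>E. f z \<partial>lborel) = unit_nn (\<lambda>s t. ennreal (h * k (t * h)) * f (s * k (t * h), t * h))"
proof -
  have [measurable]: "E \<in> sets borel" by (rule E_borel)
  have [measurable]: "k \<in> borel_measurable borel" unfolding kappa_def[abs_def] by measurable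
  define H where "H y = (\<integral>\<^sup>+s\<in>{0<..<1}. ennreal (k y) * f (s * k y, y) \<partial>lborel)" for y
  have [measurable]: "H \<in> borel_measurable borel" unfolding H_def by measurable
  have "(\<integral>\<^sup>+z\<in>E. f z \<partial>lborel) = (\<integral>\<^sup>+z. f z * indicator E z \<partial>(lborel \<Otimes>\<^sub>M lborel))"
    by (simp add: lborel_prod)
  also have "\<dots> = (\<integral>\<^sup>+y. \<integral>\<^sup>+x. f (x, y) * indicator E (x, y) \<partial>lborel \<partial>lborel)"
    by (rule lborel_pair.nn_integral_snd[symmetric]) (simp add: lborel_prod)
  also have "\<dots> = (\<integral>\<^sup>+y\<in>{0<..<h}. H y \<partial>lborel)"
  proof (rule nn_integral_cong)
    fix y :: real
    show "(\<integral>\<^sup>+x. f (x, y) * indicator E (x, y) \<partial>lborel) = H y * indicator {0<..<h} y"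
    proof (cases "0 < y \<and> y < h")
      case True
      then have kp: "k y > 0" using k_pos by simp
      have "(\<integral>\<^sup>+x. f (x, y) * indicator E (x, y) \<partial>lborel)
          = ennreal \<bar>k y\<bar> * (\<integral>\<^sup>+s. f (0 + k y * s, y) * indicator E (0 + k y * s, y) \<partial>lborel)"
        by (rule nn_integral_real_affine) (use kp in auto)
      also have "(\<lambda>s. f (0 + k y * s, y) * indicator E (0 + k y * s, y))
          = (\<lambda>s. f (s * k y, y) * indicator {0<..<1} s)"
        using True kp by (auto simp: indicator_def E_eq mult.commute zero_less_mult_iff)
      also have "ennreal \<bar>k y\<bar> * (\<integral>\<^sup>+s. f (s * k y, y) * indicator {0<..<1} s \<partial>lborel) = H y"
        unfolding H_def mult.assoc using kp by (subst nn_integral_cmult) auto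
      finally show ?thesis using True by simp
    qed (auto simp: E_eq)
  qed
  also have "\<dots> = ennreal \<bar>h\<bar> * (\<integral>\<^sup>+t. H (0 + h * t) * indicator {0<..<h} (0 + h * t) \<partial>lborel)"
    by (rule nn_integral_real_affine) (use h_pos in auto)
  also have "(\<lambda>t. H (0 + h * t) * indicator {0<..<h} (0 + h * t)) = (\<lambda>t. H (t * h) * indicator {0<..<1} t)"
    using h_pos by (auto simp: indicator_def mult.commute zero_less_mult_iff)
  also have "ennreal \<bar>h\<bar> * (\<integral>\<^sup>+t. H (t * h) * indicator {0<..<1} t \<partial>lborel)
      = (\<integral>\<^sup>+t. (ennreal h * H (t * h)) * indicator {0<..<1} t \<partial>lborel)"
    unfolding mult.assoc using h_pos by (subst nn_integral_cmult) auto
  also have "\<dots> = unit_nn (\<lambda>s t. ennreal (h * k (t * h)) * f (s * k (t * h), t * h))"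
    unfolding unit_nn_def
  proof (rule nn_integral_cong)
    fix t
    have "ennreal h * H (t * h)
        = (\<integral>\<^sup>+s\<in>{0<..<1}. ennreal (h * k (t * h)) * f (s * k (t * h), t * h) \<partial>lborel)"
      unfolding H_def using h_pos
      by (subst nn_integral_cmult[symmetric]) (auto simp: ennreal_mult' mult.assoc)
    then show "ennreal h * H (t * h) * indicator {0<..<1} t
       = (\<integral>\<^sup>+s\<in>{0<..<1}. ennreal (h * k (t * h)) * f (s * k (t * h), t * h) \<partial>lborel) * indicator {0<..<1} t"
      by simp
  qed
  finally show ?thesis .
qed

text \<open>\<open>bilin a b c d\<close> maps the side \<open>s = 0\<close> of the unit square to the edge from \<open>a\<close> to \<open>b\<close>, and the part
  \<open>s < \<sigma>\<close> of the square to the intersection of the element with the strip \<open>S \<sigma>\<close> along this edge.\<close>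

definition edge_param :: "pt \<Rightarrow> pt \<Rightarrow> pt \<Rightarrow> pt \<Rightarrow> (real \<Rightarrow> pt set) \<Rightarrow> bool" where
  "edge_param a b c d S \<longleftrightarrow> (\<forall>\<sigma>. S \<sigma> \<in> sets borel) \<and> (\<forall>f\<in>borel_measurable borel. \<forall>\<sigma>\<in>{0<..1}.
     ennreal (h * e1) * unit_nn (\<lambda>s t. f (bilin a b c d s t) * indicator {..<\<sigma>} s)
       \<le> (\<integral>\<^sup>+z\<in>E. f z * indicator (S \<sigma>) z \<partial>lborel) \<and>
     (\<integral>\<^sup>+z\<in>E. f z * indicator (S \<sigma>) z \<partial>lborel)
       \<le> ennreal (h * e2) * unit_nn (\<lambda>s t. f (bilin a b c d s t) * indicator {..<\<sigma>} s))"

text \<open>For each edge, \<open>(r1, r2)\<close> is a symmetry of the unit square relating the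
  edge coordinates to those of \<open>nn_integral_E\<close>. Symmetries preserve
  \<open>unit_nn\<close>, so the two bounds come solely from the Jacobian, in which the width lies
  between \<open>e1\<close> and \<open>e2\<close>.\<close>

lemma edge_paramI:
  assumes S: "\<And>\<sigma>. S \<sigma> \<in> sets borel"
    and inv: "\<And>g. case_prod g \<in> borel_measurable borel \<Longrightarrow> unit_nn (\<lambda>s t. g (r1 s t) (r2 s t)) = unit_nn g"
    and r2: "\<And>s t. 0 < s \<Longrightarrow> s < 1 \<Longrightarrow> 0 < t \<Longrightarrow> t < 1 \<Longrightarrow> 0 \<le> r2 s t \<and> r2 s t \<le> 1"
    and Q: "\<And>s t. bilin a b c d s t = (r1 s t * k (r2 s t * h), r2 s t * h)"
    and QS: "\<And>s t \<sigma>. 0 < s \<Longrightarrow> s < 1 \<Longrightarrow> 0 < t \<Longrightarrow> t < 1 \<Longrightarrow> bilin a b c d s t \<in> S \<sigma> \<longleftrightarrow> s < \<sigma>"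
  shows "edge_param a b c d S"
  unfolding edge_param_def
proof (intro conjI ballI allI S)
  fix f :: "pt \<Rightarrow> ennreal" and \<sigma> :: real
  assume [measurable]: "f \<in> borel_measurable borel"
  have [measurable]: "S \<sigma> \<in> sets borel" by (rule S)
  define F where "F z = f z * indicator (S \<sigma>) z" for z
  have [measurable]: "F \<in> borel_measurable borel" unfolding F_def by measurable
  define g where "g s t = ennreal (h * k (t * h)) * F (s * k (t * h), t * h)" for s t
  have "(\<lambda>z::pt. (fst z * k (snd z * h), snd z * h)) \<in> borel_measurable borel"
    unfolding k_eq by (intro borel_measurable_continuous_onI continuous_intros)
  then have "(\<lambda>z. F (fst z * k (snd z * h), snd z * h)) \<in> borel_measurable borel"
    by (rule measurable_compose) measurable
  moreover have "(\<lambda>z::pt. h * k (snd z * h)) \<in> borel_measurable borel"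
    unfolding k_eq by (intro borel_measurable_continuous_onI continuous_intros)
  ultimately have gm: "case_prod g \<in> borel_measurable borel"
    unfolding g_def split_beta' by measurable
  have "(\<lambda>z. f (case_prod (bilin a b c d) z)) \<in> borel_measurable borel"
    by (rule measurable_compose[OF bilin_measurable]) measurable
  moreover have "(\<lambda>z::pt. indicator {..<\<sigma>} (fst z) :: ennreal) \<in> borel_measurable borel"
    by (rule measurable_compose[of fst _ borel]) (auto intro!: borel_measurable_continuous_onI continuous_intros)
  ultimately have qm: "case_prod (\<lambda>s t. f (bilin a b c d s t) * indicator {..<\<sigma>} s) \<in> borel_measurable borel"
    unfolding split_beta' by measurable
  have I: "(\<integral>\<^sup>+z\<in>E. f z * indicator (S \<sigma>) z \<partial>lborel) = unit_nn (\<lambda>s t. g (r1 s t) (r2 s t))"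
    unfolding inv[OF gm] unfolding g_def F_def[symmetric] by (rule nn_integral_E) measurable
  have g: "g (r1 s t) (r2 s t) = ennreal (h * k (r2 s t * h)) * (f (bilin a b c d s t) * indicator {..<\<sigma>} s)"
    if "0 < s" "s < 1" "0 < t" "t < 1" for s t
    using QS[OF that] by (simp add: g_def F_def Q[symmetric] indicator_def)
  have kb: "h * e1 \<le> h * k (r2 s t * h)" "h * k (r2 s t * h) \<le> h * e2"
    if "0 < s" "s < 1" "0 < t" "t < 1" for s t
    using r2[OF that] h_pos by (auto intro!: mult_left_mono k_ge k_le simp: mult_left_le_one_le)
  show "ennreal (h * e1) * unit_nn (\<lambda>s t. f (bilin a b c d s t) * indicator {..<\<sigma>} s)
       \<le> (\<integral>\<^sup>+z\<in>E. f z * indicator (S \<sigma>) z \<partial>lborel)"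
    unfolding I unit_nn_cmult[OF qm, symmetric]
    by (rule unit_nn_mono) (auto simp: g intro!: mult_right_mono ennreal_leI kb)
  show "(\<integral>\<^sup>+z\<in>E. f z * indicator (S \<sigma>) z \<partial>lborel)
       \<le> ennreal (h * e2) * unit_nn (\<lambda>s t. f (bilin a b c d s t) * indicator {..<\<sigma>} s)"
    unfolding I unit_nn_cmult[OF qm, symmetric]
    by (rule unit_nn_mono) (auto simp: g intro!: mult_right_mono ennreal_leI kb)
qed

end

section \<open>Trace and strip inequalities\<close>

lemma nn_integral_lebesgue_on:
  fixes g :: "'a::euclidean_space \<Rightarrow> real"
  assumes "T \<in> sets lebesgue" "integrable (lebesgue_on T) g" "\<And>x. 0 \<le> g x"
  shows "(\<integral>\<^sup>+x\<in>T. ennreal (g x) \<partial>lborel) = ennreal (\<integral>x. g x \<partial>lebesgue_on T)"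
proof -
  have "ennreal (\<integral>x. g x \<partial>lebesgue_on T) = (\<integral>\<^sup>+x. ennreal (g x) \<partial>lebesgue_on T)"
    using assms by (intro nn_integral_eq_integral[symmetric]) auto
  also have "\<dots> = (\<integral>\<^sup>+x\<in>T. ennreal (g x) \<partial>lebesgue)"
    using assms by (intro nn_integral_restrict_space) auto
  also have "\<dots> = (\<integral>\<^sup>+x\<in>T. ennreal (g x) \<partial>lborel)"
    by (rule nn_integral_completion)
  finally show ?thesis by simp
qed

lemma nn_integral_open_interval:
  "(\<integral>\<^sup>+x\<in>{a<..<b}. f x \<partial>lborel) = (\<integral>\<^sup>+x\<in>{a..b::real}. f x \<partial>lborel)"
proof (rule nn_integral_cong_AE)
  show "AE x in lborel. f x * indicator {a<..<b} x = f x * indicator {a..b} x"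
    using AE_lborel_singleton[of a] AE_lborel_singleton[of b]
    by eventually_elim (auto simp: indicator_def)
qed

text \<open>Fundamental theorem plus Cauchy-Schwarz against the constant 1. Enlarging the interval
  from \<open>s\<close> to \<sigma> makes the right-hand side independent of \<open>s\<close>, so
  that the estimate can itself be integrated over \<open>s\<close>.\<close>

lemma FTC_square_bound:
  assumes "\<And>x. (F has_real_derivative F' x) (at x)" "continuous_on UNIV F'" "0 \<le> s" "s \<le> \<sigma>"
  shows "ennreal ((F s - F 0)\<^sup>2) \<le> ennreal \<sigma> * (\<integral>\<^sup>+r\<in>{0<..<\<sigma>}. ennreal ((F' r)\<^sup>2) \<partial>lborel)"
proof -
  let ?M = "lebesgue_on {0..s}"
  have "square_integrable ?M F'" by (rule square_integrable_continuous[OF assms(2)]) auto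
  moreover have "square_integrable ?M (\<lambda>_. 1::real)" by (rule square_integrable_continuous) auto
  moreover have "F s - F 0 = (\<integral>r. F' r \<bullet> 1 \<partial>?M)"
  proof -
    have "(F' has_integral (F s - F 0)) {0..s}"
      using assms by (intro fundamental_theorem_of_calculus)
        (auto intro: has_field_derivative_at_within simp: has_real_derivative_iff_has_vector_derivative[symmetric])
    moreover have "F' absolutely_integrable_on {0..s}"
      by (rule absolutely_integrable_continuous_real) (rule continuous_on_subset[OF assms(2)], simp)
    ultimately have "F s - F 0 = (LINT r:{0..s}|lebesgue. F' r)"
      by (simp add: set_lebesgue_integral_eq_integral(2) integral_unique)
    then show ?thesis by (simp add: LINT_restrict)
  qed
  ultimately have "(F s - F 0)\<^sup>2 \<le> (\<integral>r. (norm (F' r))\<^sup>2 \<partial>?M) * (\<integral>r. (norm (1::real))\<^sup>2 \<partial>?M)"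
    using square_integrable_Cauchy_Schwarz_sq[of ?M F' "\<lambda>_. 1"] by simp
  also have "(\<integral>r. (norm (1::real))\<^sup>2 \<partial>?M) = s"
    using assms by (simp add: measure_restrict_space)
  finally have "(F s - F 0)\<^sup>2 \<le> s * (\<integral>r. (F' r)\<^sup>2 \<partial>?M)" by (simp add: mult.commute)
  then have "ennreal ((F s - F 0)\<^sup>2) \<le> ennreal s * ennreal (\<integral>r. (F' r)\<^sup>2 \<partial>?M)"
    using assms by (simp add: ennreal_mult[symmetric] ennreal_leI)
  also have "ennreal (\<integral>r. (F' r)\<^sup>2 \<partial>?M) = (\<integral>\<^sup>+r\<in>{0..s}. ennreal ((F' r)\<^sup>2) \<partial>lborel)"
    using \<open>square_integrable ?M F'\<close> by (intro nn_integral_lebesgue_on[symmetric]) (auto simp: square_integrable_def)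
  also have "\<dots> \<le> (\<integral>\<^sup>+r\<in>{0..\<sigma>}. ennreal ((F' r)\<^sup>2) \<partial>lborel)"
    using assms by (intro nn_integral_mono) (auto simp: indicator_def)
  also have "\<dots> = (\<integral>\<^sup>+r\<in>{0<..<\<sigma>}. ennreal ((F' r)\<^sup>2) \<partial>lborel)"
    by (rule nn_integral_open_interval[symmetric])
  finally show ?thesis
    using assms by (meson ennreal_leI mult_right_mono order_trans mult_left_mono zero_le)
qed

lemma norm_linepath_le: "0 \<le> t \<Longrightarrow> t \<le> 1 \<Longrightarrow> norm (linepath a b t) \<le> norm a + norm b"
  unfolding linepath_def
  by (rule order_trans[OF norm_triangle_ineq]) (auto intro!: add_mono mult_left_le_one_le)

lemma sq_le_two_sq: "x\<^sup>2 \<le> 2 * y\<^sup>2 + 2 * (x - y)\<^sup>2" for x y :: real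
proof -
  have "0 \<le> (x - 2 * y)\<^sup>2" by simp
  then show ?thesis by (simp add: power2_eq_square algebra_simps)
qed

text \<open>For fixed \<open>t\<close> the curve in \<open>s\<close> is a segment with direction
  \<open>D\<close>, and \<open>K\<close> is a crude bound of its length by the norms of the
  vertices; the rest is the chain rule and the fundamental theorem.\<close>

lemma bilin_slice:
  fixes a b c d :: pt
  defines "K \<equiv> norm a + norm b + norm c + norm d"
  assumes \<psi>: "smooth \<psi>" and t: "0 < t" "t < 1" and s: "0 \<le> s" "s \<le> \<sigma>"
  shows "ennreal ((\<psi> (bilin a b c d s t) - \<psi> (linepath a b t))\<^sup>2)
    \<le> ennreal (\<sigma> * K\<^sup>2) * (\<integral>\<^sup>+r\<in>{0<..<\<sigma>}. ennreal ((norm (grad \<psi> (bilin a b c d r t)))\<^sup>2) \<partial>lborel)"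
proof -
  define D where "D = linepath d c t - linepath a b t"
  have K: "norm D \<le> K"
    using norm_triangle_ineq4[of "linepath d c t" "linepath a b t"]
      norm_linepath_le[of t d c] norm_linepath_le[of t a b] t by (simp add: D_def K_def)
  define F where "F r = \<psi> (bilin a b c d r t)" for r
  define F' where "F' r = grad \<psi> (bilin a b c d r t) \<bullet> D" for r
  have b: "bilin a b c d r t = linepath a b t + r *\<^sub>R D" for r
    unfolding bilin_def D_def by (simp add: linepath_def[of "linepath a b t"] algebra_simps)
  have "((\<lambda>r. bilin a b c d r t) has_derivative (\<lambda>u. u *\<^sub>R D)) (at r)" for r
    unfolding b by (auto intro!: derivative_eq_intros)
  from has_derivative_compose[OF this smooth_has_derivative[OF \<psi>]]
  have d: "(F has_real_derivative F' r) (at r)" for r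
    by (simp add: has_field_derivative_def F_def[abs_def] F'_def mult_commute_abs)
  have c: "continuous_on UNIV F'"
    unfolding F'_def b
    by (intro continuous_intros continuous_on_compose2[OF smooth_grad_continuous[OF \<psi>, of UNIV]]) auto
  have 0: "F 0 = \<psi> (linepath a b t)" by (simp add: F_def b)
  have "ennreal ((F s - F 0)\<^sup>2) \<le> ennreal \<sigma> * (\<integral>\<^sup>+r\<in>{0<..<\<sigma>}. ennreal ((F' r)\<^sup>2) \<partial>lborel)"
    by (rule FTC_square_bound[OF d c s])
  also have "(\<integral>\<^sup>+r\<in>{0<..<\<sigma>}. ennreal ((F' r)\<^sup>2) \<partial>lborel)
      \<le> (\<integral>\<^sup>+r. ennreal (K\<^sup>2) * (ennreal ((norm (grad \<psi> (bilin a b c d r t)))\<^sup>2) * indicator {0<..<\<sigma>} r) \<partial>lborel)"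
  proof (intro nn_integral_mono)
    fix r
    have "\<bar>F' r\<bar> \<le> norm (grad \<psi> (bilin a b c d r t)) * norm D"
      unfolding F'_def by (rule Cauchy_Schwarz_ineq2)
    also have "\<dots> \<le> K * norm (grad \<psi> (bilin a b c d r t))"
      using mult_left_mono[OF K norm_ge_zero] by (simp add: mult.commute[of K])
    finally have "\<bar>F' r\<bar>\<^sup>2 \<le> (K * norm (grad \<psi> (bilin a b c d r t)))\<^sup>2"
      by (intro power_mono) auto
    then show "ennreal ((F' r)\<^sup>2) * indicator {0<..<\<sigma>} r
        \<le> ennreal (K\<^sup>2) * (ennreal ((norm (grad \<psi> (bilin a b c d r t)))\<^sup>2) * indicator {0<..<\<sigma>} r)"
      by (auto simp: indicator_def ennreal_mult[symmetric] power_mult_distrib intro!: ennreal_leI)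
  qed
  also have "\<dots> = ennreal (K\<^sup>2) * (\<integral>\<^sup>+r\<in>{0<..<\<sigma>}. ennreal ((norm (grad \<psi> (bilin a b c d r t)))\<^sup>2) \<partial>lborel)"
  proof (rule nn_integral_cmult)
    have "continuous_on UNIV (\<lambda>r. (norm (grad \<psi> (bilin a b c d r t)))\<^sup>2)"
      unfolding b by (intro continuous_intros continuous_on_compose2[OF smooth_grad_continuous[OF \<psi>, of UNIV]]) auto
    from borel_measurable_continuous_onI[OF this]
    show "(\<lambda>r. ennreal ((norm (grad \<psi> (bilin a b c d r t)))\<^sup>2) * indicator {0<..<\<sigma>} r) \<in> borel_measurable lborel"
      by measurable
  qed
  finally show ?thesis
    using s by (simp add: F_def 0[unfolded F_def] ennreal_mult mult.assoc mult_left_mono)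
qed

lemma nn_integral_below:
  assumes "\<sigma> \<le> 1"
  shows "(\<integral>\<^sup>+s\<in>{0<..<1}. f s * indicator {..<\<sigma>} s \<partial>lborel) = (\<integral>\<^sup>+s\<in>{0<..<\<sigma>::real}. f s \<partial>lborel)"
  by (intro nn_integral_cong) (use assms in \<open>auto simp: indicator_def\<close>)

lemma bilin_section_measurable:
  assumes [measurable]: "f \<in> borel_measurable borel"
  shows "(\<lambda>s. f (bilin a b c d s t)) \<in> borel_measurable borel"
    "case_prod (\<lambda>s t. f (bilin a b c d s t)) \<in> borel_measurable borel"
    "(\<lambda>t. f (linepath a b t)) \<in> borel_measurable borel"
proof -
  have 1: "case_prod (bilin a b c d) \<in> borel_measurable borel" by (rule bilin_measurable)
  have "(\<lambda>z. f (case_prod (bilin a b c d) z)) \<in> borel_measurable borel"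
    by (rule measurable_compose[OF 1]) measurable
  then show "case_prod (\<lambda>s t. f (bilin a b c d s t)) \<in> borel_measurable borel" by (simp add: split_beta')
  show "(\<lambda>s. f (bilin a b c d s t)) \<in> borel_measurable borel"
    by (rule measurable_compose[of _ _ borel]) (auto simp: bilin_def linepath_def intro!: borel_measurable_continuous_onI continuous_intros)
  show "(\<lambda>t. f (linepath a b t)) \<in> borel_measurable borel"
    by (rule measurable_compose[of _ _ borel]) (auto simp: linepath_def intro!: borel_measurable_continuous_onI continuous_intros)
qed

lemma unit_nn_below_measurable:
  fixes \<sigma> :: real
  assumes "case_prod g \<in> borel_measurable borel"
  shows "(\<lambda>t. \<integral>\<^sup>+s\<in>{0<..<\<sigma>}. g s t \<partial>lborel) \<in> borel_measurable lborel"
proof -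
  have [measurable]: "case_prod g \<in> borel_measurable (lborel \<Otimes>\<^sub>M lborel)"
    using assms by (simp add: borel_prod[symmetric] cong: measurable_cong_sets)
  show ?thesis by measurable
qed

section \<open>Integrals along an edge\<close>

definition edge_sq :: "pt \<Rightarrow> pt \<Rightarrow> (pt \<Rightarrow> real) \<Rightarrow> real" where
  "edge_sq a b g = (\<integral>t. (g (linepath a b t))\<^sup>2 \<partial>lebesgue_on {0..1})"

lemma edge_sq_nn:
  assumes "smooth \<psi>"
  shows "(\<integral>\<^sup>+t\<in>{0<..<1}. ennreal ((\<psi> (linepath a b t))\<^sup>2) \<partial>lborel) = ennreal (edge_sq a b \<psi>)"
proof -
  have "continuous_on UNIV (\<lambda>t. \<psi> (linepath a b t))"
    by (rule continuous_on_compose2[OF smooth_continuous[OF assms, of UNIV]])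
      (auto simp: linepath_def intro!: continuous_intros)
  then have "square_integrable (lebesgue_on {0..1}) (\<lambda>t. \<psi> (linepath a b t))" by (rule square_integrable_continuous) auto
  then show ?thesis unfolding nn_integral_open_interval edge_sq_def
    by (intro nn_integral_lebesgue_on) (auto simp: square_integrable_def)
qed

lemma edge_sq_ge_0: "0 \<le> edge_sq a b g" by (simp add: edge_sq_def)

definition edge_int :: "pt \<Rightarrow> pt \<Rightarrow> (pt \<Rightarrow> real) \<Rightarrow> real" where
  "edge_int a b f = (\<integral>t. f (linepath a b t) \<partial>lebesgue_on {0..1})"

lemma edge_int_integrable:
  assumes "continuous_on UNIV f"
  shows "integrable (lebesgue_on {0..1}) (\<lambda>t. f (linepath a b t :: pt) :: real)"
  by (rule square_integrable_integrable[OF finite_measure_lebesgue_on_bounded], simp, simp, rule square_integrable_continuous)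
    (auto simp: linepath_def intro!: continuous_intros continuous_on_compose2[OF assms])

lemma edge_int_affine: "edge_int a b (\<lambda>z. c + w \<bullet> z) = c + edge_int a b (\<lambda>z. w \<bullet> z)"
proof -
  have "edge_int a b (\<lambda>z. c + w \<bullet> z) = (\<integral>t. c \<partial>lebesgue_on {0..1::real}) + edge_int a b (\<lambda>z. w \<bullet> z)"
    unfolding edge_int_def
    by (rule Bochner_Integration.integral_add) (rule edge_int_integrable; intro continuous_intros)+
  then show ?thesis by (simp add: measure_restrict_space)
qed

lemma edge_int_abs_le:
  assumes i: "integrable (lebesgue_on {0..1}) (\<lambda>t. f (linepath a b t))"
    and b: "\<And>t. t \<in> {0..1} \<Longrightarrow> \<bar>f (linepath a b t)\<bar> \<le> K"
  shows "\<bar>edge_int a b f\<bar> \<le> K"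
proof -
  have "\<bar>edge_int a b f\<bar> \<le> (\<integral>t. \<bar>f (linepath a b t)\<bar> \<partial>lebesgue_on {0..1})"
    unfolding edge_int_def by (rule integral_abs_bound)
  also have "\<dots> \<le> (\<integral>t. K \<partial>lebesgue_on {0..1::real})"
  proof (rule integral_mono)
    show "integrable (lebesgue_on {0..1::real}) (\<lambda>t. K)"
      using edge_int_integrable[of "\<lambda>_. K"] by simp
  qed (use i b in \<open>auto simp: space_restrict_space\<close>)
  also have "\<dots> = K" by (simp add: measure_restrict_space)
  finally show ?thesis .
qed

context trapezoid
begin

lemma edge_measurable:
  "{z. fst z < \<sigma> * k (snd z)} \<in> sets borel" "{z. (1 - \<sigma>) * k (snd z) < fst z} \<in> sets borel"
  "{z::pt. snd z < \<sigma> * h} \<in> sets borel" "{z::pt. (1 - \<sigma>) * h < snd z} \<in> sets borel"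
  unfolding k_eq by (intro borel_open open_Collect_less continuous_intros)+

lemma k_scale: "k (x * h) = e2 - (e2 - e1) * x"
  unfolding slope_h[symmetric] by (simp add: k_eq)

text \<open>For this edge and the other three, the vertices are relabelled so that the edge becomes
  \<open>s = 0\<close> and is traversed as in \<open>edges\<close>. The direction of travel dictates
  which reflections occur; a horizontal edge also exchanges the two coordinates.\<close>

lemma edge_left: "edge_param (0, h) (0, 0) (e2, 0) (e1, h) (\<lambda>\<sigma>. {z. fst z < \<sigma> * k (snd z)})"
proof (rule edge_paramI[where ?r1.0 = "\<lambda>s t. s" and ?r2.0 = "\<lambda>s t. 1 - t"])
  show Q: "bilin (0, h) (0, 0) (e2, 0) (e1, h) s t = (s * k ((1 - t) * h), (1 - t) * h)" for s t
    unfolding bilin_def linepath_def k_scale by (simp add: algebra_simps)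
  show "bilin (0, h) (0, 0) (e2, 0) (e1, h) s t \<in> {z. fst z < \<sigma> * k (snd z)} \<longleftrightarrow> s < \<sigma>"
    if "0 < t" "t < 1" for s t \<sigma>
  proof -
    have "0 < k ((1 - t) * h)" using that h_pos by (intro k_pos) (simp add: mult_left_le_one_le)
    then show ?thesis by (simp add: Q)
  qed
qed (auto intro: edge_measurable unit_nn_reflect2)

lemma edge_right: "edge_param (e2, 0) (e1, h) (0, h) (0, 0) (\<lambda>\<sigma>. {z. (1 - \<sigma>) * k (snd z) < fst z})"
proof (rule edge_paramI[where ?r1.0 = "\<lambda>s t. 1 - s" and ?r2.0 = "\<lambda>s t. t"])
  show Q: "bilin (e2, 0) (e1, h) (0, h) (0, 0) s t = ((1 - s) * k (t * h), t * h)" for s t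
    unfolding bilin_def linepath_def k_scale by (simp add: algebra_simps)
  show "bilin (e2, 0) (e1, h) (0, h) (0, 0) s t \<in> {z. (1 - \<sigma>) * k (snd z) < fst z} \<longleftrightarrow> s < \<sigma>"
    if "0 < t" "t < 1" for s t \<sigma>
  proof -
    have "0 < k (t * h)" using that h_pos by (intro k_pos) (simp add: mult_left_le_one_le)
    then show ?thesis by (simp add: Q)
  qed
qed (auto intro: edge_measurable unit_nn_reflect1)

lemma edge_bottom: "edge_param (0, 0) (e2, 0) (e1, h) (0, h) (\<lambda>\<sigma>. {z. snd z < \<sigma> * h})"
proof (rule edge_paramI[where ?r1.0 = "\<lambda>s t. t" and ?r2.0 = "\<lambda>s t. s"])
  show Q: "bilin (0, 0) (e2, 0) (e1, h) (0, h) s t = (t * k (s * h), s * h)" for s t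
    unfolding bilin_def linepath_def k_scale by (simp add: algebra_simps)
  show "bilin (0, 0) (e2, 0) (e1, h) (0, h) s t \<in> {z. snd z < \<sigma> * h} \<longleftrightarrow> s < \<sigma>" for s t \<sigma>
    using h_pos by (simp add: Q)
qed (auto intro: edge_measurable unit_nn_swap)

lemma edge_top: "edge_param (e1, h) (0, h) (0, 0) (e2, 0) (\<lambda>\<sigma>. {z. (1 - \<sigma>) * h < snd z})"
proof (rule edge_paramI[where ?r1.0 = "\<lambda>s t. 1 - t" and ?r2.0 = "\<lambda>s t. 1 - s"])
  show Q: "bilin (e1, h) (0, h) (0, 0) (e2, 0) s t = ((1 - t) * k ((1 - s) * h), (1 - s) * h)" for s t
    unfolding bilin_def linepath_def k_scale by (simp add: algebra_simps)
  show "bilin (e1, h) (0, h) (0, 0) (e2, 0) s t \<in> {z. (1 - \<sigma>) * h < snd z} \<longleftrightarrow> s < \<sigma>" for s t \<sigma>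
    using h_pos by (simp add: Q)
  show "unit_nn (\<lambda>s t. g (1 - t) (1 - s)) = unit_nn g" if "case_prod g \<in> borel_measurable borel" for g
  proof -
    have "(\<lambda>z. case_prod g (1 - fst z, snd z)) \<in> borel_measurable borel"
      by (rule measurable_compose[OF _ that]) (intro borel_measurable_continuous_onI continuous_intros)
    then have m1: "case_prod (\<lambda>s t. g (1 - s) t) \<in> borel_measurable borel" by (simp add: split_beta')
    have "(\<lambda>z. case_prod g (1 - fst z, 1 - snd z)) \<in> borel_measurable borel"
      by (rule measurable_compose[OF _ that]) (intro borel_measurable_continuous_onI continuous_intros)
    then have "case_prod (\<lambda>s t. g (1 - s) (1 - t)) \<in> borel_measurable borel" by (simp add: split_beta')
    from unit_nn_swap[OF this] unit_nn_reflect2[OF m1] unit_nn_reflect1[OF that]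
    show ?thesis by simp
  qed
qed (auto intro: edge_measurable)

lemma nn_integral_E_strip:
  fixes f :: "pt \<Rightarrow> 'b::euclidean_space"
  assumes "continuous_on UNIV f" "S \<in> sets borel"
  shows "(\<integral>\<^sup>+z\<in>E. ennreal ((norm (f z))\<^sup>2) * indicator S z \<partial>lborel)
    = ennreal (\<integral>z. (norm (f z))\<^sup>2 * indicator S z \<partial>lebesgue_on E)"
proof -
  have "integrable (lebesgue_on E) (\<lambda>z. (norm (f z))\<^sup>2)"
    using square_integrable_continuous[OF assms(1) bounded_E E_lebesgue] by (simp add: square_integrable_def)
  moreover have "S \<in> sets lebesgue" using assms(2) sets_completionI_sets by force
  then have "(\<lambda>z. indicator S z :: real) \<in> borel_measurable (lebesgue_on E)"
    by (intro measurable_restrict_space1) simp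
  ultimately have "integrable (lebesgue_on E) (\<lambda>z. (norm (f z))\<^sup>2 * indicator S z)"
    by (rule integrable_mult_indicator_real)
  from nn_integral_lebesgue_on[OF E_lebesgue this]
  have "(\<integral>\<^sup>+z\<in>E. ennreal ((norm (f z))\<^sup>2 * indicator S z) \<partial>lborel)
    = ennreal (\<integral>z. (norm (f z))\<^sup>2 * indicator S z \<partial>lebesgue_on E)" by simp
  then show ?thesis by (simp add: ennreal_mult' ennreal_indicator)
qed

text \<open>The constants of the next two estimates may depend on the shape of the element: both estimates
  only enter through limits.\<close>

lemma strip_ineq:
  assumes ep: "edge_param a b c d S"
  obtains C where "0 \<le> C" "\<And>\<psi> \<sigma>. smooth \<psi> \<Longrightarrow> 0 < \<sigma> \<Longrightarrow> \<sigma> \<le> 1 \<Longrightarrow>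
    (\<integral>z. (\<psi> z)\<^sup>2 * indicator (S \<sigma>) z \<partial>lebesgue_on E)
      \<le> C * \<sigma> * edge_sq a b \<psi> + C * \<sigma>\<^sup>2 * (\<integral>z. (norm (grad \<psi> z))\<^sup>2 * indicator (S \<sigma>) z \<partial>lebesgue_on E)"
proof -
  define K where "K = norm a + norm b + norm c + norm d"
  define C where "C = h * e2 * 2 + h * e2 * (2 * K\<^sup>2) * (1 / (h * e1))"
  have C0: "0 \<le> C" using h_pos e1 e2_pos by (simp add: C_def)
  show ?thesis
  proof (rule that[OF C0])
    fix \<psi> \<sigma> assume \<psi>: "smooth \<psi>" and \<sigma>: "0 < \<sigma>" "\<sigma> \<le> (1::real)"
    define F where "F z = ennreal ((\<psi> z)\<^sup>2)" for z
    define G where "G z = ennreal ((norm (grad \<psi> z))\<^sup>2)" for z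
    have cg: "continuous_on UNIV (grad \<psi>)" and c\<psi>: "continuous_on UNIV \<psi>"
      by (rule smooth_grad_continuous[OF \<psi>] smooth_continuous[OF \<psi>])+
    have Fm[measurable]: "F \<in> borel_measurable borel"
      using borel_measurable_continuous_onI[OF c\<psi>] unfolding F_def by measurable
    have Gm[measurable]: "G \<in> borel_measurable borel"
      using borel_measurable_continuous_onI[OF cg] unfolding G_def by measurable
    define B where "B = (\<integral>\<^sup>+t\<in>{0<..<1}. F (linepath a b t) \<partial>lborel)"
    define U where "U = unit_nn (\<lambda>s t. G (bilin a b c d s t) * indicator {..<\<sigma>} s)"
    define J where "J t = (\<integral>\<^sup>+r\<in>{0<..<\<sigma>}. G (bilin a b c d r t) \<partial>lborel)" for t
    have Jm[measurable]: "J \<in> borel_measurable lborel"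
      unfolding J_def by (rule unit_nn_below_measurable[OF bilin_section_measurable(2)[OF Gm]])
    have Bm[measurable]: "(\<lambda>t. F (linepath a b t)) \<in> borel_measurable borel"
      by (rule bilin_section_measurable[OF Fm])
    have U: "U = (\<integral>\<^sup>+t\<in>{0<..<1}. J t \<partial>lborel)"
      unfolding U_def unit_nn_def J_def nn_integral_below[OF \<sigma>(2)] ..
    have pt: "F (bilin a b c d s t) \<le> 2 * F (linepath a b t) + ennreal (2 * (\<sigma> * K\<^sup>2)) * J t"
      if "0 < t" "t < 1" "0 < s" "s < \<sigma>" for s t
    proof -
      have "F (bilin a b c d s t)
          \<le> 2 * F (linepath a b t) + 2 * ennreal ((\<psi> (bilin a b c d s t) - \<psi> (linepath a b t))\<^sup>2)"
        unfolding F_def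
        by (simp add: ennreal_mult''[symmetric] ennreal_plus[symmetric] ennreal_leI sq_le_two_sq
            ennreal_numeral[symmetric] del: ennreal_plus ennreal_numeral)
      also have "\<dots> \<le> 2 * F (linepath a b t) + 2 * (ennreal (\<sigma> * K\<^sup>2) * J t)"
        unfolding J_def G_def K_def
        by (intro add_left_mono mult_left_mono bilin_slice \<psi>) (use that in auto)
      also have "2 * (ennreal (\<sigma> * K\<^sup>2) * J t) = ennreal (2 * (\<sigma> * K\<^sup>2)) * J t"
        using \<sigma> by (simp add: ennreal_mult mult.assoc)
      finally show ?thesis .
    qed
    have "unit_nn (\<lambda>s t. F (bilin a b c d s t) * indicator {..<\<sigma>} s)
        = (\<integral>\<^sup>+t\<in>{0<..<1}. (\<integral>\<^sup>+s\<in>{0<..<\<sigma>}. F (bilin a b c d s t) \<partial>lborel) \<partial>lborel)"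
      unfolding unit_nn_def nn_integral_below[OF \<sigma>(2)] ..
    also have "\<dots> \<le> (\<integral>\<^sup>+t\<in>{0<..<1}. ennreal \<sigma> * (2 * F (linepath a b t) + ennreal (2 * (\<sigma> * K\<^sup>2)) * J t) \<partial>lborel)"
    proof (rule nn_integral_mono)
      fix t
      have "(\<integral>\<^sup>+s\<in>{0<..<\<sigma>}. F (bilin a b c d s t) \<partial>lborel)
          \<le> ennreal \<sigma> * (2 * F (linepath a b t) + ennreal (2 * (\<sigma> * K\<^sup>2)) * J t)" if t: "0 < t" "t < 1"
      proof -
        have "(\<integral>\<^sup>+s\<in>{0<..<\<sigma>}. F (bilin a b c d s t) \<partial>lborel)
          \<le> (\<integral>\<^sup>+s. (2 * F (linepath a b t) + ennreal (2 * (\<sigma> * K\<^sup>2)) * J t) * indicator {0<..<\<sigma>} s \<partial>lborel)"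
          by (rule nn_integral_mono) (use pt[OF t] in \<open>auto simp: indicator_def\<close>)
        \<comment> \<open>The bound is constant in \<open>s\<close>, so integrating over
          \<open>s < \<sigma>\<close> gains one factor \<sigma>; the gradient term already carries
          another.\<close>
        also have "\<dots> = ennreal \<sigma> * (2 * F (linepath a b t) + ennreal (2 * (\<sigma> * K\<^sup>2)) * J t)"
          using \<sigma> by (subst nn_integral_cmult_indicator) (auto simp: mult.commute)
        finally show ?thesis .
      qed
      then show "(\<integral>\<^sup>+s\<in>{0<..<\<sigma>}. F (bilin a b c d s t) \<partial>lborel) * indicator {0<..<1} t
        \<le> ennreal \<sigma> * (2 * F (linepath a b t) + ennreal (2 * (\<sigma> * K\<^sup>2)) * J t) * indicator {0<..<1} t"
        by (auto simp: indicator_def)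
    qed
    also have "\<dots> = (\<integral>\<^sup>+t. ennreal \<sigma> * (2 * (F (linepath a b t) * indicator {0<..<1} t)
        + ennreal (2 * (\<sigma> * K\<^sup>2)) * (J t * indicator {0<..<1} t)) \<partial>lborel)"
      by (intro nn_integral_cong) (auto simp: indicator_def)
    also have "\<dots> = ennreal \<sigma> * (2 * B + ennreal (2 * (\<sigma> * K\<^sup>2)) * U)"
      unfolding B_def U by (simp add: nn_integral_cmult nn_integral_add)
    finally have V: "unit_nn (\<lambda>s t. F (bilin a b c d s t) * indicator {..<\<sigma>} s)
       \<le> ennreal \<sigma> * (2 * B + ennreal (2 * (\<sigma> * K\<^sup>2)) * U)" .
    define X Y where "X = (\<integral>z. (\<psi> z)\<^sup>2 * indicator (S \<sigma>) z \<partial>lebesgue_on E)"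
      and "Y = (\<integral>z. (norm (grad \<psi> z))\<^sup>2 * indicator (S \<sigma>) z \<partial>lebesgue_on E)"
    have Sm: "S \<sigma> \<in> sets borel" using ep by (simp add: edge_param_def)
    have XY: "0 \<le> X" "0 \<le> Y" "0 \<le> edge_sq a b \<psi>" by (simp_all add: X_def Y_def edge_sq_def)
    have X: "(\<integral>\<^sup>+z\<in>E. F z * indicator (S \<sigma>) z \<partial>lborel) = ennreal X"
      using nn_integral_E_strip[OF c\<psi> Sm] by (simp add: F_def X_def)
    have Y: "(\<integral>\<^sup>+z\<in>E. G z * indicator (S \<sigma>) z \<partial>lborel) = ennreal Y"
      using nn_integral_E_strip[OF cg Sm] by (simp add: G_def Y_def)
    have B: "B = ennreal (edge_sq a b \<psi>)"
      unfolding B_def F_def by (rule edge_sq_nn[OF \<psi>])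
    \<comment> \<open>The lower Jacobian bound returns the gradient term from the square to
      \<open>E\<close>; the upper one is reserved for the function itself. Their quotient is the
      shape dependence of \<open>C\<close>.\<close>
    have "ennreal (h * e1) * U \<le> ennreal Y"
      using ep \<sigma> Gm unfolding edge_param_def U_def Y[symmetric] by auto
    then have "ennreal (1 / (h * e1)) * (ennreal (h * e1) * U) \<le> ennreal (1 / (h * e1)) * ennreal Y"
      by (rule mult_left_mono) simp
    then have UY: "U \<le> ennreal (1 / (h * e1) * Y)"
      using h_pos e1 XY by (simp add: mult.assoc[symmetric] ennreal_mult[symmetric])
    define R where "R = 1 / (h * e1) * Y"
    have R0: "0 \<le> R" using XY h_pos e1 by (simp add: R_def)
    have "ennreal X \<le> ennreal (h * e2) * unit_nn (\<lambda>s t. F (bilin a b c d s t) * indicator {..<\<sigma>} s)"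
      using ep \<sigma> Fm unfolding edge_param_def X[symmetric] by auto
    also have "\<dots> \<le> ennreal (h * e2) * (ennreal \<sigma> * (2 * ennreal (edge_sq a b \<psi>)
        + ennreal (2 * (\<sigma> * K\<^sup>2)) * ennreal R))"
      using V UY[folded R_def] unfolding B by (meson add_left_mono mult_left_mono order_trans zero_le)
    also have "\<dots> = ennreal (h * e2 * (\<sigma> * (2 * edge_sq a b \<psi> + 2 * (\<sigma> * K\<^sup>2) * R)))"
      using h_pos e1 e2_pos XY \<sigma> R0
      by (simp add: ennreal_mult ennreal_plus)
    finally have "X \<le> h * e2 * (\<sigma> * (2 * edge_sq a b \<psi> + 2 * (\<sigma> * K\<^sup>2) * R))"
      using h_pos e1 e2_pos XY \<sigma> R0 by (simp add: ennreal_le_iff)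
    also have "\<dots> = (h * e2 * 2) * (\<sigma> * edge_sq a b \<psi>) + (h * e2 * (2 * K\<^sup>2) * (1 / (h * e1))) * (\<sigma>\<^sup>2 * Y)"
      by (simp add: R_def algebra_simps power2_eq_square)
    also have "\<dots> \<le> C * (\<sigma> * edge_sq a b \<psi>) + C * (\<sigma>\<^sup>2 * Y)"
      using h_pos e1 e2_pos XY \<sigma> by (intro add_mono mult_right_mono) (auto simp: C_def)
    finally show "(\<integral>z. (\<psi> z)\<^sup>2 * indicator (S \<sigma>) z \<partial>lebesgue_on E) \<le> C * \<sigma> * edge_sq a b \<psi>
        + C * \<sigma>\<^sup>2 * (\<integral>z. (norm (grad \<psi> z))\<^sup>2 * indicator (S \<sigma>) z \<partial>lebesgue_on E)"
      by (simp add: X_def Y_def mult.assoc)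
  qed
qed

lemma trace_ineq:
  assumes ep: "edge_param a b c d S"
  obtains C where "0 \<le> C" "\<And>\<psi>. smooth \<psi> \<Longrightarrow>
    edge_sq a b \<psi> \<le> C * ((\<integral>z. (\<psi> z)\<^sup>2 \<partial>lebesgue_on E) + (\<integral>z. (norm (grad \<psi> z))\<^sup>2 \<partial>lebesgue_on E))"
proof -
  define K where "K = norm a + norm b + norm c + norm d"
  define C where "C = (2 + 2 * K\<^sup>2) / (h * e1)"
  have C0: "0 \<le> C" using h_pos e1 by (simp add: C_def)
  show ?thesis
  proof (rule that[OF C0])
    fix \<psi> assume \<psi>: "smooth \<psi>"
    define F where "F z = ennreal ((\<psi> z)\<^sup>2)" for z
    define G where "G z = ennreal ((norm (grad \<psi> z))\<^sup>2)" for z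
    have cg: "continuous_on UNIV (grad \<psi>)" and c\<psi>: "continuous_on UNIV \<psi>"
      by (rule smooth_grad_continuous[OF \<psi>] smooth_continuous[OF \<psi>])+
    have Fm[measurable]: "F \<in> borel_measurable borel"
      using borel_measurable_continuous_onI[OF c\<psi>] unfolding F_def by measurable
    have Gm[measurable]: "G \<in> borel_measurable borel"
      using borel_measurable_continuous_onI[OF cg] unfolding G_def by measurable
    define I where "I f t = (\<integral>\<^sup>+r\<in>{0<..<1}. f (bilin a b c d r t) \<partial>lborel)" for f :: "pt \<Rightarrow> ennreal" and t
    have [measurable]: "I F \<in> borel_measurable lborel" "I G \<in> borel_measurable lborel"
      unfolding I_def by (rule unit_nn_below_measurable[OF bilin_section_measurable(2)]; fact)+
    have U: "unit_nn (\<lambda>s t. f (bilin a b c d s t) * indicator {..<1} s)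
        = (\<integral>\<^sup>+t\<in>{0<..<1}. I f t \<partial>lborel)" for f
      unfolding unit_nn_def I_def nn_integral_below[OF order_refl] ..
    have pt: "F (linepath a b t) \<le> 2 * I F t + ennreal (2 * K\<^sup>2) * I G t" if t: "0 < t" "t < 1" for t
    proof -
      have [measurable]: "(\<lambda>s. F (bilin a b c d s t)) \<in> borel_measurable borel"
        by (rule bilin_section_measurable[OF Fm])
      have "F (linepath a b t) \<le> 2 * F (bilin a b c d s t) + ennreal (2 * K\<^sup>2) * I G t"
        if s: "0 < s" "s < 1" for s
      proof -
        have "(\<psi> (linepath a b t))\<^sup>2 \<le> 2 * (\<psi> (bilin a b c d s t))\<^sup>2
            + 2 * (\<psi> (bilin a b c d s t) - \<psi> (linepath a b t))\<^sup>2"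
          using sq_le_two_sq[of "\<psi> (linepath a b t)" "\<psi> (bilin a b c d s t)"]
          by (simp add: power2_commute)
        then have "F (linepath a b t) \<le> 2 * F (bilin a b c d s t)
            + 2 * ennreal ((\<psi> (bilin a b c d s t) - \<psi> (linepath a b t))\<^sup>2)"
          unfolding F_def
          by (simp add: ennreal_mult''[symmetric] ennreal_plus[symmetric] ennreal_leI
              ennreal_numeral[symmetric] del: ennreal_plus ennreal_numeral)
        also have "\<dots> \<le> 2 * F (bilin a b c d s t) + 2 * (ennreal (1 * K\<^sup>2) * I G t)"
          unfolding I_def G_def K_def
          by (intro add_left_mono mult_left_mono bilin_slice \<psi>) (use t s in auto)
        also have "2 * (ennreal (1 * K\<^sup>2) * I G t) = ennreal (2 * K\<^sup>2) * I G t"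
          by (simp add: ennreal_mult mult.assoc)
        finally show ?thesis .
      qed
      \<comment> \<open>The left-hand side does not depend on \<open>s\<close>: averaging over the
        unit interval replaces the value at an interior point of the slice by integrals over the
        whole slice.\<close>
      then have "(\<integral>\<^sup>+s. F (linepath a b t) * indicator {0<..<1::real} s \<partial>lborel)
          \<le> (\<integral>\<^sup>+s. 2 * (F (bilin a b c d s t) * indicator {0<..<1} s)
              + ennreal (2 * K\<^sup>2) * I G t * indicator {0<..<1} s \<partial>lborel)"
        by (intro nn_integral_mono) (auto simp: indicator_def)
      also have "\<dots> = 2 * I F t + ennreal (2 * K\<^sup>2) * I G t"
        unfolding I_def by (simp add: nn_integral_cmult nn_integral_add nn_integral_cmult_indicator)
      finally show ?thesis by (simp add: nn_integral_cmult_indicator)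
    qed
    define X Y where "X = (\<integral>z. (\<psi> z)\<^sup>2 \<partial>lebesgue_on E)"
      and "Y = (\<integral>z. (norm (grad \<psi> z))\<^sup>2 \<partial>lebesgue_on E)"
    have XY: "0 \<le> X" "0 \<le> Y" "0 \<le> edge_sq a b \<psi>" by (simp_all add: X_def Y_def edge_sq_def)
    have X: "(\<integral>\<^sup>+z\<in>E. F z \<partial>lborel) = ennreal X"
      using nn_integral_E_strip[OF c\<psi>, of UNIV] by (simp add: F_def X_def)
    have Y: "(\<integral>\<^sup>+z\<in>E. G z \<partial>lborel) = ennreal Y"
      using nn_integral_E_strip[OF cg, of UNIV] by (simp add: G_def Y_def)
    have le: "(\<integral>\<^sup>+t\<in>{0<..<1}. I f t \<partial>lborel) \<le> ennreal (1 / (h * e1)) * (\<integral>\<^sup>+z\<in>E. f z \<partial>lborel)"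
      if f: "f \<in> borel_measurable borel" for f
    proof -
      have "ennreal (h * e1) * (\<integral>\<^sup>+t\<in>{0<..<1}. I f t \<partial>lborel) \<le> (\<integral>\<^sup>+z\<in>E. f z * indicator (S 1) z \<partial>lborel)"
        using ep f unfolding edge_param_def U[symmetric] by auto
      also have "\<dots> \<le> (\<integral>\<^sup>+z\<in>E. f z \<partial>lborel)"
        by (rule nn_integral_mono) (auto simp: indicator_def)
      finally have "ennreal (1 / (h * e1)) * (ennreal (h * e1) * (\<integral>\<^sup>+t\<in>{0<..<1}. I f t \<partial>lborel))
          \<le> ennreal (1 / (h * e1)) * (\<integral>\<^sup>+z\<in>E. f z \<partial>lborel)"
        by (rule mult_left_mono) simp
      then show ?thesis using h_pos e1 by (simp add: mult.assoc[symmetric] ennreal_mult[symmetric])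
    qed
    have "ennreal (edge_sq a b \<psi>) = (\<integral>\<^sup>+t\<in>{0<..<1}. F (linepath a b t) \<partial>lborel)"
      unfolding F_def by (rule edge_sq_nn[OF \<psi>, symmetric])
    also have "\<dots> \<le> (\<integral>\<^sup>+t. 2 * (I F t * indicator {0<..<1} t)
        + ennreal (2 * K\<^sup>2) * (I G t * indicator {0<..<1} t) \<partial>lborel)"
      by (rule nn_integral_mono) (use pt in \<open>auto simp: indicator_def\<close>)
    also have "\<dots> = 2 * (\<integral>\<^sup>+t\<in>{0<..<1}. I F t \<partial>lborel) + ennreal (2 * K\<^sup>2) * (\<integral>\<^sup>+t\<in>{0<..<1}. I G t \<partial>lborel)"
      by (simp add: nn_integral_cmult nn_integral_add)
    also have "\<dots> \<le> 2 * (ennreal (1 / (h * e1)) * ennreal X) + ennreal (2 * K\<^sup>2) * (ennreal (1 / (h * e1)) * ennreal Y)"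
      using le[OF Fm] le[OF Gm] unfolding X Y by (intro add_mono mult_left_mono) auto
    also have "\<dots> = ennreal (2 * (1 / (h * e1) * X) + 2 * K\<^sup>2 * (1 / (h * e1) * Y))"
      using h_pos e1 XY by (simp add: ennreal_mult ennreal_plus del: times_divide_eq_left)
    finally have "edge_sq a b \<psi> \<le> 2 * (1 / (h * e1) * X) + 2 * K\<^sup>2 * (1 / (h * e1) * Y)"
      by (rule ennreal_le_iff[THEN iffD1, rotated]) (use h_pos e1 XY in simp)
    also have "\<dots> \<le> C * (X + Y)"
    proof -
      have "1 / (h * e1) * (2 * X + 2 * K\<^sup>2 * Y) \<le> 1 / (h * e1) * ((2 + 2 * K\<^sup>2) * (X + Y))"
        using h_pos e1 XY by (intro mult_left_mono) (auto simp: algebra_simps)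
      then show ?thesis by (simp add: C_def algebra_simps add_divide_distrib)
    qed
    finally show "edge_sq a b \<psi> \<le> C * ((\<integral>z. (\<psi> z)\<^sup>2 \<partial>lebesgue_on E) + (\<integral>z. (norm (grad \<psi> z))\<^sup>2 \<partial>lebesgue_on E))"
      by (simp add: X_def Y_def)
  qed
qed

end

section \<open>Approximation by test functions\<close>

definition cutoff_fun :: "real \<Rightarrow> (pt \<Rightarrow> real) \<Rightarrow> bool" where
  "cutoff_fun D f \<longleftrightarrow> smooth f \<and> (\<forall>z. 0 \<le> f z \<and> f z \<le> 1 \<and> norm (grad f z) \<le> D)"

lemma cutoff_funD:
  assumes "cutoff_fun D f"
  shows "smooth f" "0 \<le> f z" "f z \<le> 1" "norm (grad f z) \<le> D"
  using assms unfolding cutoff_fun_def by blast+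

lemma cutoff_fun_mult:
  assumes "cutoff_fun D f" "cutoff_fun D' g"
  shows "cutoff_fun (D + D') (\<lambda>z. f z * g z)"
proof -
  note f = cutoff_funD[OF assms(1)] and g = cutoff_funD[OF assms(2)]
  note s = f(1) g(1)
  have "norm (grad (\<lambda>z. f z * g z) z) \<le> D + D'" for z
  proof -
    have "norm (grad (\<lambda>z. f z * g z) z) \<le> \<bar>f z\<bar> * norm (grad g z) + \<bar>g z\<bar> * norm (grad f z)"
      unfolding grad_mult[OF s] by (rule order_trans[OF norm_triangle_ineq]) simp
    also have "\<dots> \<le> 1 * D' + 1 * D"
      using f(2-)[of z] g(2-)[of z] by (intro add_mono mult_mono) auto
    finally show ?thesis by simp
  qed
  with smooth_mult[OF s] show ?thesis
    unfolding cutoff_fun_def using f(2,3) g(2,3) by (blast intro: mult_le_one mult_nonneg_nonneg)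
qed

text \<open>A rescaled \<open>step\<close> of the affine form rises between the levels \<delta> and
  2\<delta>, so its gradient is of order \<open>1 / \<delta>\<close> with a constant common to all
  half-planes. The allowance \<open>norm a \<le> 2\<close> covers the slanted edge, whose normal is
  left unnormalized.\<close>

lemma half_space_cutoff:
  obtains B where "0 \<le> B" "\<And>c a \<delta>. 0 < \<delta> \<Longrightarrow> norm a \<le> 2 \<Longrightarrow> \<exists>f. cutoff_fun (B / \<delta>) f \<and>
    (\<forall>z. (c + a \<bullet> z \<le> \<delta> \<longrightarrow> f z = 0) \<and> (2 * \<delta> < c + a \<bullet> z \<longrightarrow> f z = 1 \<and> grad f z = 0))"
proof -
  obtain step' B where d: "\<And>x. (step has_real_derivative step' x) (at x)" and B: "\<And>x. \<bar>step' x\<bar> \<le> B"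
    and z: "\<And>x. 1 < x \<Longrightarrow> step' x = 0"
    using step_deriv_bounded by blast
  have B0: "0 \<le> B" using B[of 0] by linarith
  show ?thesis
  proof (rule that[of "2 * B"])
    fix c \<delta> :: real and a :: pt
    assume \<delta>: "0 < \<delta>" and a: "norm a \<le> 2"
    \<comment> \<open>The shift by 1 makes the function vanish up to the level \<delta>, not only up
      to 0; this is what will yield compact support.\<close>
    define f where "f z = step ((c / \<delta> - 1) + (a /\<^sub>R \<delta>) \<bullet> z)" for z
    have arg: "(c / \<delta> - 1) + (a /\<^sub>R \<delta>) \<bullet> z = (c + a \<bullet> z) / \<delta> - 1" for z
      using \<delta> by (simp add: field_simps)
    have g: "grad f z = step' ((c + a \<bullet> z) / \<delta> - 1) *\<^sub>R (a /\<^sub>R \<delta>)" for z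
      unfolding f_def[abs_def] arg[symmetric] by (rule grad_comp_affine[OF d])
    have "norm (grad f z) \<le> 2 * B / \<delta>" for z
    proof -
      have "norm (grad f z) = \<bar>step' ((c + a \<bullet> z) / \<delta> - 1)\<bar> * (norm a / \<delta>)"
        using \<delta> unfolding g by (simp add: abs_mult divide_inverse mult.commute mult.left_commute)
      also have "\<dots> \<le> B * (2 / \<delta>)"
        using B B0 \<delta> a by (intro mult_mono divide_right_mono) auto
      finally show ?thesis by (simp add: mult.commute)
    qed
    moreover have "smooth f" unfolding f_def[abs_def] by (rule smooth_comp_affine[OF Ck1_step])
    ultimately have "cutoff_fun (2 * B / \<delta>) f"
      unfolding cutoff_fun_def by (auto simp: f_def step_ge_0 step_le_1)
    moreover have "f z = 0" if "c + a \<bullet> z \<le> \<delta>" for z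
      unfolding f_def arg by (rule step_0) (use that \<delta> in \<open>simp add: field_simps\<close>)
    moreover have "f z = 1" if "2 * \<delta> < c + a \<bullet> z" for z
      unfolding f_def arg by (rule step_1) (use that \<delta> in \<open>simp add: field_simps\<close>)
    moreover have "grad f z = 0" if "2 * \<delta> < c + a \<bullet> z" for z
      unfolding g by (subst z) (use that \<delta> in \<open>simp_all add: field_simps\<close>)
    ultimately show "\<exists>f. cutoff_fun (2 * B / \<delta>) f \<and>
      (\<forall>z. (c + a \<bullet> z \<le> \<delta> \<longrightarrow> f z = 0) \<and> (2 * \<delta> < c + a \<bullet> z \<longrightarrow> f z = 1 \<and> grad f z = 0))"
      by blast
  qed (use B0 in simp)
qed

section \<open>Cutting off near the boundary of the trapezoid\<close>

context trapezoid
begin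

text \<open>The widths are relative: at each height the lateral strips take the fraction \<sigma> of
  the width there, which is what the bilinear parametrizations see as
  \<open>s < \<sigma>\<close>.\<close>

definition strips :: "real \<Rightarrow> pt set" where
  "strips \<sigma> = {z. fst z < \<sigma> * k (snd z)} \<union> {z. (1 - \<sigma>) * k (snd z) < fst z}
     \<union> {z. snd z < \<sigma> * h} \<union> {z. (1 - \<sigma>) * h < snd z}"

lemma strips_borel: "strips \<sigma> \<in> sets borel"
  unfolding strips_def by (intro sets.Un edge_measurable)

text \<open>Each point of the open set \<open>E\<close> lies outside the strips once they are thin
  enough, so dominated convergence applies with the modulus of \<open>f\<close> as majorant.\<close>

lemma strips_integral_tendsto:
  fixes f :: "pt \<Rightarrow> real"
  assumes "integrable (lebesgue_on E) f"
  shows "(\<lambda>j. \<integral>z. f z * indicator (strips (inverse (real (Suc j)))) z \<partial>lebesgue_on E) \<longlonglongrightarrow> 0"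
proof -
  have "(\<lambda>j. \<integral>z. f z * indicator (strips (inverse (real (Suc j)))) z \<partial>lebesgue_on E)
      \<longlonglongrightarrow> (\<integral>z. 0 \<partial>lebesgue_on E)"
  proof (rule integral_dominated_convergence[where w = "\<lambda>z. \<bar>f z\<bar>"])
    show "AE z in lebesgue_on E. (\<lambda>j. f z * indicator (strips (inverse (real (Suc j)))) z) \<longlonglongrightarrow> 0"
    proof (rule AE_I2)
      fix z assume "z \<in> space (lebesgue_on E)"
      then have z: "0 < fst z" "fst z < k (snd z)" "0 < snd z" "snd z < h"
        by (auto simp: space_restrict_space E_eq)
      have l: "((\<lambda>j. inverse (real (Suc j))) \<longlonglongrightarrow> 0)" by (rule LIMSEQ_inverse_real_of_nat)
      have t: "(\<lambda>j. inverse (real (Suc j)) * k (snd z)) \<longlonglongrightarrow> 0 * k (snd z)"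
        "(\<lambda>j. (1 - inverse (real (Suc j))) * k (snd z)) \<longlonglongrightarrow> (1 - 0) * k (snd z)"
        "(\<lambda>j. inverse (real (Suc j)) * h) \<longlonglongrightarrow> 0 * h"
        "(\<lambda>j. (1 - inverse (real (Suc j))) * h) \<longlonglongrightarrow> (1 - 0) * h"
        by (intro tendsto_intros l)+
      have "\<forall>\<^sub>F j in sequentially. inverse (real (Suc j)) * k (snd z) < fst z"
        "\<forall>\<^sub>F j in sequentially. fst z < (1 - inverse (real (Suc j))) * k (snd z)"
        "\<forall>\<^sub>F j in sequentially. inverse (real (Suc j)) * h < snd z"
        "\<forall>\<^sub>F j in sequentially. snd z < (1 - inverse (real (Suc j))) * h"
        by (rule order_tendstoD[OF t(1)] order_tendstoD[OF t(2)] order_tendstoD[OF t(3)]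
            order_tendstoD[OF t(4)], use z in simp)+
      then have "\<forall>\<^sub>F j in sequentially. f z * indicator (strips (inverse (real (Suc j)))) z = 0"
        by eventually_elim (simp add: strips_def)
      then show "(\<lambda>j. f z * indicator (strips (inverse (real (Suc j)))) z) \<longlonglongrightarrow> 0"
        by (rule tendsto_eventually)
    qed
    show "(\<lambda>z. f z * indicator (strips (inverse (real (Suc j)))) z) \<in> borel_measurable (lebesgue_on E)" for j
      using borel_measurable_integrable[OF assms] indicator_borel_lebesgue_on[OF strips_borel] by measurable
  qed (use assms in \<open>auto simp: indicator_def\<close>)
  then show ?thesis by simp
qed

text \<open>The product of four half-plane cutoffs, one per edge, is supported where all four edge
  forms are at least \<delta>, a compact subset of \<open>E\<close>. The gradient bounds of the
  factors add up, hence \<open>4 * B\<close>.\<close>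

lemma boundary_cutoff:
  obtains B where "0 \<le> B" "\<And>\<delta>. 0 < \<delta> \<Longrightarrow> \<exists>\<eta>. cutoff_fun (B / \<delta>) \<eta> \<and> test_fun E \<eta> \<and>
    (\<forall>z\<in>E - strips (3 * \<delta> / e1). \<eta> z = 1 \<and> grad \<eta> z = 0)"
proof -
  obtain B where B0: "0 \<le> B" and B: "\<And>c a \<delta>. 0 < \<delta> \<Longrightarrow> norm a \<le> 2 \<Longrightarrow> \<exists>f. cutoff_fun (B / \<delta>) f \<and>
    (\<forall>z. (c + a \<bullet> z \<le> \<delta> \<longrightarrow> f z = 0) \<and> (2 * \<delta> < c + a \<bullet> z \<longrightarrow> f z = 1 \<and> grad f z = 0))"
    using half_space_cutoff by blast
  show ?thesis
  proof (rule that[of "4 * B"])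
    fix \<delta> :: real assume \<delta>: "0 < \<delta>"
    have n: "norm (1::real, 0::real) \<le> 2" "norm (-1::real, - slope) \<le> 2"
      "norm (0::real, 1::real) \<le> 2" "norm (0::real, -1::real) \<le> 2"
      using norm_Pair_le[of "-1::real" "- slope"] slope_ge_0 slope_le_1 by auto
    have ip: "(p, q) \<bullet> z = p * fst z + q * snd z" for p q :: real and z :: pt
      by (cases z) simp
    have d_eq: "fst z = 0 + (1 * fst z + 0 * snd z)"
      "k (snd z) - fst z = e2 + (-1 * fst z + - slope * snd z)"
      "snd z = 0 + (0 * fst z + 1 * snd z)" "h - snd z = h + (0 * fst z + -1 * snd z)" for z :: pt
      by (simp_all add: k_eq)
    have "\<exists>f. cutoff_fun (B / \<delta>) f \<and> (\<forall>z. (g z \<le> \<delta> \<longrightarrow> f z = 0) \<and> (2 * \<delta> < g z \<longrightarrow> f z = 1 \<and> grad f z = 0))"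
      if "norm (p, q) \<le> 2" "\<And>z. g z = c + (p * fst z + q * snd z)" for p q c and g :: "pt \<Rightarrow> real"
      unfolding that(2) ip[symmetric] by (rule B[OF \<delta> that(1)])
    note cut = this
    obtain f1 where f1: "cutoff_fun (B / \<delta>) f1"
      "\<And>z. fst z \<le> \<delta> \<Longrightarrow> f1 z = 0" "\<And>z. 2 * \<delta> < fst z \<Longrightarrow> f1 z = 1 \<and> grad f1 z = 0"
      using cut[OF n(1) d_eq(1)] by blast
    obtain f2 where f2: "cutoff_fun (B / \<delta>) f2"
      "\<And>z. k (snd z) - fst z \<le> \<delta> \<Longrightarrow> f2 z = 0"
      "\<And>z. 2 * \<delta> < k (snd z) - fst z \<Longrightarrow> f2 z = 1 \<and> grad f2 z = 0"
      using cut[OF n(2) d_eq(2)] by blast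
    obtain f3 where f3: "cutoff_fun (B / \<delta>) f3"
      "\<And>z. snd z \<le> \<delta> \<Longrightarrow> f3 z = 0" "\<And>z. 2 * \<delta> < snd z \<Longrightarrow> f3 z = 1 \<and> grad f3 z = 0"
      using cut[OF n(3) d_eq(3)] by blast
    obtain f4 where f4: "cutoff_fun (B / \<delta>) f4"
      "\<And>z. h - snd z \<le> \<delta> \<Longrightarrow> f4 z = 0" "\<And>z. 2 * \<delta> < h - snd z \<Longrightarrow> f4 z = 1 \<and> grad f4 z = 0"
      using cut[OF n(4) d_eq(4)] by blast
    define \<eta> where "\<eta> z = (f1 z * f2 z) * (f3 z * f4 z)" for z
    have c12: "cutoff_fun (B / \<delta> + B / \<delta>) (\<lambda>z. f1 z * f2 z)" and c34: "cutoff_fun (B / \<delta> + B / \<delta>) (\<lambda>z. f3 z * f4 z)"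
      by (rule cutoff_fun_mult[OF f1(1) f2(1)] cutoff_fun_mult[OF f3(1) f4(1)])+
    have c: "cutoff_fun (4 * B / \<delta>) \<eta>"
      using cutoff_fun_mult[OF c12 c34] by (simp add: \<eta>_def[abs_def])
    define Kc where "Kc = {z. \<delta> \<le> fst z} \<inter> {z. fst z \<le> k (snd z) - \<delta>} \<inter> {z. \<delta> \<le> snd z} \<inter> {z. snd z \<le> h - \<delta>}"
    have KE: "Kc \<subseteq> E" using \<delta> by (auto simp: Kc_def E_eq)
    have "closed Kc" unfolding Kc_def k_eq by (intro closed_Int closed_Collect_le continuous_intros)
    then have "compact Kc" using bounded_subset[OF bounded_E KE] by (simp add: compact_eq_bounded_closed)
    moreover have "z \<in> Kc" if "\<eta> z \<noteq> 0" for z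
    proof -
      have "\<not> fst z \<le> \<delta>" "\<not> k (snd z) - fst z \<le> \<delta>" "\<not> snd z \<le> \<delta>" "\<not> h - snd z \<le> \<delta>"
        using that f1(2)[of z] f2(2)[of z] f3(2)[of z] f4(2)[of z] by (auto simp: \<eta>_def)
      then show ?thesis by (simp add: Kc_def)
    qed
    ultimately have t: "test_fun E \<eta>"
      using test_funI[OF cutoff_funD(1)[OF c] _ _ KE] by blast
    have "\<eta> z = 1 \<and> grad \<eta> z = 0" if z: "z \<in> E - strips (3 * \<delta> / e1)" for z
    proof -
      have zE: "fst z < k (snd z)" "0 < snd z" "snd z < h" using z by (auto simp: E_eq)
      \<comment> \<open>Both \<open>k\<close> and \<open>h\<close> are at least \<open>e1\<close>,
        so outside strips of relative width \<open>3 * \<delta> / e1\<close> every edge form is at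
        least 3\<delta>; the 3 in place of 2 makes the required inequalities strict.\<close>
      have "3 * \<delta> / e1 * e1 \<le> 3 * \<delta> / e1 * k (snd z)" "3 * \<delta> / e1 * e1 \<le> 3 * \<delta> / e1 * h"
        by (rule mult_left_mono; use zE \<delta> e1 e12 e2h k_ge in simp)+
      then have d: "2 * \<delta> < fst z" "2 * \<delta> < k (snd z) - fst z" "2 * \<delta> < snd z" "2 * \<delta> < h - snd z"
        using z \<delta> e1 unfolding strips_def by (auto simp: left_diff_distrib not_less)
      have 1: "f1 z = 1" "f2 z = 1" "f3 z = 1" "f4 z = 1"
        and g: "grad f1 z = 0" "grad f2 z = 0" "grad f3 z = 0" "grad f4 z = 0"
        using f1(3)[OF d(1)] f2(3)[OF d(2)] f3(3)[OF d(3)] f4(3)[OF d(4)] by auto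
      have s: "smooth f1" "smooth f2" "smooth f3" "smooth f4" "smooth (\<lambda>z. f1 z * f2 z)" "smooth (\<lambda>z. f3 z * f4 z)"
        using f1(1) f2(1) f3(1) f4(1) c12 c34 by (simp_all add: cutoff_fun_def)
      show ?thesis
        unfolding \<eta>_def[abs_def] grad_mult[OF s(5,6)] grad_mult[OF s(1,2)] grad_mult[OF s(3,4)]
        by (simp add: 1 g)
    qed
    with c t show "\<exists>\<eta>. cutoff_fun (4 * B / \<delta>) \<eta> \<and> test_fun E \<eta> \<and>
      (\<forall>z\<in>E - strips (3 * \<delta> / e1). \<eta> z = 1 \<and> grad \<eta> z = 0)" by blast
  qed (use B0 in simp)
qed

definition boundary_sq :: "(pt \<Rightarrow> real) \<Rightarrow> real" where
  "boundary_sq g = edge_sq (0, h) (0, 0) g + edge_sq (e2, 0) (e1, h) g + edge_sq (0, 0) (e2, 0) g + edge_sq (e1, h) (0, h) g"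

text \<open>The four strip inequalities are added. The strips overlap near the corners, but for an
  upper bound it is enough that the sum of the indicators dominates the indicator of the union. Each
  gradient integral is enlarged to all strips so that a single one remains.\<close>

lemma strips_ineq:
  obtains C where "0 \<le> C" "\<And>\<psi> \<sigma>. smooth \<psi> \<Longrightarrow> 0 < \<sigma> \<Longrightarrow> \<sigma> \<le> 1 \<Longrightarrow>
    (\<integral>z. (\<psi> z)\<^sup>2 * indicator (strips \<sigma>) z \<partial>lebesgue_on E)
      \<le> C * \<sigma> * boundary_sq \<psi> + C * \<sigma>\<^sup>2 * (\<integral>z. (norm (grad \<psi> z))\<^sup>2 * indicator (strips \<sigma>) z \<partial>lebesgue_on E)"
proof -
  let ?S1 = "\<lambda>\<sigma>. {z. fst z < \<sigma> * k (snd z)}" and ?S2 = "\<lambda>\<sigma>. {z. (1 - \<sigma>) * k (snd z) < fst z}"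
  let ?S3 = "\<lambda>\<sigma>. {z::pt. snd z < \<sigma> * h}" and ?S4 = "\<lambda>\<sigma>. {z::pt. (1 - \<sigma>) * h < snd z}"
  let ?I = "\<lambda>\<psi> S. \<integral>z. (norm (\<psi> z))\<^sup>2 * indicator S z \<partial>lebesgue_on E"
  define P where "P C a b S \<longleftrightarrow> 0 \<le> C \<and> (\<forall>\<psi> \<sigma>. smooth \<psi> \<longrightarrow> 0 < \<sigma> \<longrightarrow> \<sigma> \<le> 1 \<longrightarrow>
    ?I \<psi> (S \<sigma>) \<le> C * \<sigma> * edge_sq a b \<psi> + C * \<sigma>\<^sup>2 * ?I (grad \<psi>) (S \<sigma>))" for C a b S
  have ex: "\<exists>C. P C a b S" if "edge_param a b c d S" for a b c d S
    by (rule strip_ineq[OF that]) (unfold P_def real_norm_def power2_abs, blast)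
  obtain C1 C2 C3 C4 where P: "P C1 (0, h) (0, 0) ?S1" "P C2 (e2, 0) (e1, h) ?S2"
    "P C3 (0, 0) (e2, 0) ?S3" "P C4 (e1, h) (0, h) ?S4"
    using ex[OF edge_left] ex[OF edge_right] ex[OF edge_bottom] ex[OF edge_top] by blast
  then have C0: "0 \<le> C1" "0 \<le> C2" "0 \<le> C3" "0 \<le> C4" by (simp_all add: P_def)
  show ?thesis
  proof (rule that[of "C1 + C2 + C3 + C4"])
    fix \<psi> \<sigma> assume \<psi>: "smooth \<psi>" and \<sigma>: "0 < \<sigma>" "\<sigma> \<le> (1::real)"
    have ig: "integrable (lebesgue_on E) (\<lambda>z. (norm (grad \<psi> z))\<^sup>2)" "integrable (lebesgue_on E) (\<lambda>z. (norm (\<psi> z))\<^sup>2)"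
      using square_integrable_continuous[OF smooth_grad_continuous[OF \<psi>] bounded_E E_lebesgue]
        square_integrable_continuous[OF smooth_continuous[OF \<psi>] bounded_E E_lebesgue]
      by (simp_all add: square_integrable_def)
    have int: "integrable (lebesgue_on E) (\<lambda>z. (norm (\<psi> z))\<^sup>2 * indicator S z)"
      "integrable (lebesgue_on E) (\<lambda>z. (norm (grad \<psi> z))\<^sup>2 * indicator S z)" if "S \<in> sets borel" for S
      using ig that by (auto intro!: integrable_mult_indicator_real indicator_borel_lebesgue_on)
    define Y where "Y = ?I (grad \<psi>) (strips \<sigma>)"
    have Y0: "0 \<le> Y" by (simp add: Y_def)
    have mono: "?I (grad \<psi>) S \<le> Y" if "S \<in> sets borel" "S \<subseteq> strips \<sigma>" for S
      unfolding Y_def using that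
      by (intro integral_mono int strips_borel) (auto simp: indicator_def)
    have bnd: "?I \<psi> (S \<sigma>) \<le> (C1 + C2 + C3 + C4) * (\<sigma> * edge_sq a b \<psi>) + C * (\<sigma>\<^sup>2 * Y)"
      if "P C a b S" "S \<sigma> \<in> sets borel" "S \<sigma> \<subseteq> strips \<sigma>" "C \<le> C1 + C2 + C3 + C4" for C a b S
    proof -
      have "?I \<psi> (S \<sigma>) \<le> C * \<sigma> * edge_sq a b \<psi> + C * \<sigma>\<^sup>2 * ?I (grad \<psi>) (S \<sigma>)"
        using that \<psi> \<sigma> unfolding P_def by blast
      also have "\<dots> \<le> (C1 + C2 + C3 + C4) * (\<sigma> * edge_sq a b \<psi>) + C * (\<sigma>\<^sup>2 * Y)"
        unfolding mult.assoc using that \<sigma> mono[OF that(2,3)]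
        by (intro add_mono mult_right_mono mult_left_mono) (auto simp: P_def edge_sq_ge_0)
      finally show ?thesis .
    qed
    have sub: "?S1 \<sigma> \<subseteq> strips \<sigma>" "?S2 \<sigma> \<subseteq> strips \<sigma>" "?S3 \<sigma> \<subseteq> strips \<sigma>" "?S4 \<sigma> \<subseteq> strips \<sigma>"
      by (auto simp: strips_def)
    have "?I \<psi> (strips \<sigma>) \<le> (\<integral>z. (norm (\<psi> z))\<^sup>2 * indicator (?S1 \<sigma>) z + (norm (\<psi> z))\<^sup>2 * indicator (?S2 \<sigma>) z
        + (norm (\<psi> z))\<^sup>2 * indicator (?S3 \<sigma>) z + (norm (\<psi> z))\<^sup>2 * indicator (?S4 \<sigma>) z \<partial>lebesgue_on E)"
      by (intro integral_mono Bochner_Integration.integrable_add int edge_measurable strips_borel)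
        (auto simp: indicator_def strips_def)
    also have "\<dots> = ?I \<psi> (?S1 \<sigma>) + ?I \<psi> (?S2 \<sigma>) + ?I \<psi> (?S3 \<sigma>) + ?I \<psi> (?S4 \<sigma>)"
      by (subst Bochner_Integration.integral_add; (intro Bochner_Integration.integrable_add int edge_measurable)?)+ simp
    also have "\<dots> \<le> (C1 + C2 + C3 + C4) * (\<sigma> * boundary_sq \<psi>) + (C1 + C2 + C3 + C4) * (\<sigma>\<^sup>2 * Y)"
      using bnd[OF P(1) edge_measurable(1) sub(1)] bnd[OF P(2) edge_measurable(2) sub(2)]
        bnd[OF P(3) edge_measurable(3) sub(3)] bnd[OF P(4) edge_measurable(4) sub(4)] C0
      by (simp add: boundary_sq_def distrib_left distrib_right)
    finally show "(\<integral>z. (\<psi> z)\<^sup>2 * indicator (strips \<sigma>) z \<partial>lebesgue_on E) \<le> (C1 + C2 + C3 + C4) * \<sigma> * boundary_sq \<psi>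
        + (C1 + C2 + C3 + C4) * \<sigma>\<^sup>2 * (\<integral>z. (norm (grad \<psi> z))\<^sup>2 * indicator (strips \<sigma>) z \<partial>lebesgue_on E)"
      by (simp add: Y_def mult.assoc)
  qed (use C0 in simp)
qed

lemma square_integrable_smooth: "smooth \<psi> \<Longrightarrow> square_integrable (lebesgue_on E) \<psi>"
  by (rule square_integrable_continuous[OF smooth_continuous bounded_E E_lebesgue])

lemma square_integrable_grad: "smooth \<psi> \<Longrightarrow> square_integrable (lebesgue_on E) (grad \<psi>)"
  by (rule square_integrable_continuous[OF smooth_grad_continuous bounded_E E_lebesgue])

text \<open>For the product \<theta> of a cutoff \<eta> with \<psi>, the gradient error splits into
  \<eta> times the error of \<psi>, the part of \<open>GU\<close> on the strips, and \<psi> times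
  \<open>grad \<eta>\<close>. Squaring the last gives \<open>1 / \<sigma>\<^sup>2\<close>, which
  meets the gains \<sigma> and \<open>\<sigma>\<^sup>2\<close> of \<open>strips_ineq\<close>: the
  gradient part stays bounded and only the boundary part keeps \<open>1 / \<sigma>\<close>.\<close>

lemma cutoff_error:
  fixes U :: "pt \<Rightarrow> real" and GU :: "pt \<Rightarrow> pt"
  assumes U: "square_integrable (lebesgue_on E) U" and GU: "square_integrable (lebesgue_on E) GU"
  obtains A where "0 \<le> A" "\<And>\<psi> \<sigma>. smooth \<psi> \<Longrightarrow> 0 < \<sigma> \<Longrightarrow> \<sigma> \<le> 1 \<Longrightarrow> \<exists>\<theta>. test_fun E \<theta> \<and>
    (\<integral>z. (\<theta> z - U z)\<^sup>2 \<partial>lebesgue_on E) \<le> 2 * (\<integral>z. (\<psi> z - U z)\<^sup>2 \<partial>lebesgue_on E)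
       + 2 * (\<integral>z. (norm (U z))\<^sup>2 * indicator (strips \<sigma>) z \<partial>lebesgue_on E) \<and>
    (\<integral>z. (norm (grad \<theta> z - GU z))\<^sup>2 \<partial>lebesgue_on E) \<le> A * (\<integral>z. (norm (grad \<psi> z - GU z))\<^sup>2 \<partial>lebesgue_on E)
       + A * (\<integral>z. (norm (GU z))\<^sup>2 * indicator (strips \<sigma>) z \<partial>lebesgue_on E) + A / \<sigma> * boundary_sq \<psi>"
proof -
  let ?M = "lebesgue_on E"
  obtain C where C0: "0 \<le> C" and C: "\<And>\<psi> \<sigma>. smooth \<psi> \<Longrightarrow> 0 < \<sigma> \<Longrightarrow> \<sigma> \<le> 1 \<Longrightarrow>
    (\<integral>z. (\<psi> z)\<^sup>2 * indicator (strips \<sigma>) z \<partial>?M)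
      \<le> C * \<sigma> * boundary_sq \<psi> + C * \<sigma>\<^sup>2 * (\<integral>z. (norm (grad \<psi> z))\<^sup>2 * indicator (strips \<sigma>) z \<partial>?M)"
    by (rule strips_ineq) blast
  obtain B where B0: "0 \<le> B" and B: "\<And>\<delta>. 0 < \<delta> \<Longrightarrow> \<exists>\<eta>. cutoff_fun (B / \<delta>) \<eta> \<and> test_fun E \<eta> \<and>
    (\<forall>z\<in>E - strips (3 * \<delta> / e1). \<eta> z = 1 \<and> grad \<eta> z = 0)"
    by (rule boundary_cutoff) blast
  define D where "D = 3 * B / e1"
  define A where "A = 4 + 8 * (D\<^sup>2 * C)"
  have D0: "0 \<le> D" using B0 e1 by (simp add: D_def)
  have A0: "0 \<le> A" using C0 by (simp add: A_def)
  show ?thesis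
  proof (rule that[OF A0])
    fix \<psi> \<sigma> assume \<psi>: "smooth \<psi>" and \<sigma>: "0 < \<sigma>" "\<sigma> \<le> (1::real)"
    \<comment> \<open>This choice of width turns the strips of \<open>boundary_cutoff\<close> into
      \<open>strips \<sigma>\<close> and its gradient bound into
      \<open>D / \<sigma>\<close>.\<close>
    have "0 < \<sigma> * e1 / 3" using \<sigma> e1 by simp
    from B[OF this] obtain \<eta> where "cutoff_fun (B / (\<sigma> * e1 / 3)) \<eta>" and t: "test_fun E \<eta>"
      and 1: "\<And>z. z \<in> E - strips (3 * (\<sigma> * e1 / 3) / e1) \<Longrightarrow> \<eta> z = 1 \<and> grad \<eta> z = 0" by blast
    moreover have "B / (\<sigma> * e1 / 3) = D / \<sigma>" "3 * (\<sigma> * e1 / 3) / e1 = \<sigma>"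
      using e1 \<sigma> by (simp_all add: D_def field_simps)
    ultimately have c: "cutoff_fun (D / \<sigma>) \<eta>" and 1: "\<And>z. z \<in> E \<Longrightarrow> z \<notin> strips \<sigma> \<Longrightarrow> \<eta> z = 1 \<and> grad \<eta> z = 0"
      by simp_all
    note \<eta> = cutoff_funD[OF c]
    define \<theta> where "\<theta> z = \<eta> z * \<psi> z" for z
    have t\<theta>: "test_fun E \<theta>" unfolding \<theta>_def[abs_def] by (rule test_fun_mult[OF t \<psi>])
    then have s\<theta>: "smooth \<theta>" by (simp add: test_fun_def)
    let ?i = "\<lambda>z. indicator (strips \<sigma>) z :: real"
    have im: "?i \<in> borel_measurable ?M" by (rule indicator_borel_lebesgue_on[OF strips_borel])
    note sqs = square_integrable_diff[OF square_integrable_smooth[OF \<psi>] U] square_integrable_diff[OF square_integrable_grad[OF \<psi>] GU]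
      square_integrable_diff[OF square_integrable_smooth[OF s\<theta>] U] square_integrable_diff[OF square_integrable_grad[OF s\<theta>] GU]
    note ints = sqs[unfolded square_integrable_def, THEN conjunct2]
    note inti = square_integrable_indicator_integrable[OF U im] square_integrable_indicator_integrable[OF GU im]
      square_integrable_indicator_integrable[OF square_integrable_smooth[OF \<psi>] im] square_integrable_indicator_integrable[OF square_integrable_grad[OF \<psi>] im]
      square_integrable_indicator_integrable[OF sqs(2) im]
    have "(\<integral>z. (norm (\<theta> z - U z))\<^sup>2 \<partial>?M) \<le> (\<integral>z. 2 * (norm (\<psi> z - U z))\<^sup>2 + 2 * ((norm (U z))\<^sup>2 * ?i z) \<partial>?M)"
    proof (rule integral_mono)
      fix z assume "z \<in> space ?M"
      then have z: "z \<in> E" by (simp add: space_restrict_space)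
      have "\<bar>1 - \<eta> z\<bar> \<le> ?i z"
        using \<eta>(2,3)[of z] 1[OF z] by (auto simp: indicator_def)
      then have "(norm ((\<eta> z - 1) * U z))\<^sup>2 \<le> (?i z * norm (U z))\<^sup>2"
        by (intro power_mono) (auto simp: abs_mult abs_minus_commute intro!: mult_right_mono)
      also have "\<dots> = (norm (U z))\<^sup>2 * ?i z" by (auto simp: indicator_def)
      finally have "(norm ((\<eta> z - 1) * U z))\<^sup>2 \<le> (norm (U z))\<^sup>2 * ?i z" .
      moreover have "(norm (\<eta> z * (\<psi> z - U z)))\<^sup>2 \<le> (norm (\<psi> z - U z))\<^sup>2"
        using \<eta>(2,3)[of z] by (intro power_mono) (auto simp: abs_mult intro!: mult_left_le_one_le)
      moreover have eq: "\<theta> z - U z = \<eta> z * (\<psi> z - U z) + (\<eta> z - 1) * U z"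
        by (simp add: \<theta>_def algebra_simps)
      ultimately show "(norm (\<theta> z - U z))\<^sup>2 \<le> 2 * (norm (\<psi> z - U z))\<^sup>2 + 2 * ((norm (U z))\<^sup>2 * ?i z)"
        unfolding eq using norm_add_sq[of "\<eta> z * (\<psi> z - U z)" "(\<eta> z - 1) * U z"] by linarith
    qed (use ints inti in auto)
    also have "\<dots> = 2 * (\<integral>z. (norm (\<psi> z - U z))\<^sup>2 \<partial>?M) + 2 * (\<integral>z. (norm (U z))\<^sup>2 * ?i z \<partial>?M)"
      using ints(1) inti(1) by simp
    finally have r1: "(\<integral>z. (\<theta> z - U z)\<^sup>2 \<partial>?M) \<le> 2 * (\<integral>z. (\<psi> z - U z)\<^sup>2 \<partial>?M) + 2 * (\<integral>z. (norm (U z))\<^sup>2 * ?i z \<partial>?M)"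
      by simp
    define g v w Y where "g = (\<integral>z. (norm (grad \<psi> z - GU z))\<^sup>2 \<partial>?M)" and "v = (\<integral>z. (norm (GU z))\<^sup>2 * ?i z \<partial>?M)"
      and "w = (\<integral>z. (norm (\<psi> z))\<^sup>2 * ?i z \<partial>?M)" and "Y = (\<integral>z. (norm (grad \<psi> z))\<^sup>2 * ?i z \<partial>?M)"
    have pos: "0 \<le> g" "0 \<le> v" "0 \<le> w" "0 \<le> Y" "0 \<le> boundary_sq \<psi>"
      by (simp_all add: g_def v_def w_def Y_def boundary_sq_def edge_sq_ge_0)
    have "Y \<le> (\<integral>z. 2 * ((norm (grad \<psi> z - GU z))\<^sup>2) + 2 * ((norm (GU z))\<^sup>2 * ?i z) \<partial>?M)"
      unfolding Y_def
    proof (rule integral_mono)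
      fix z show "(norm (grad \<psi> z))\<^sup>2 * ?i z \<le> 2 * ((norm (grad \<psi> z - GU z))\<^sup>2) + 2 * ((norm (GU z))\<^sup>2 * ?i z)"
        using norm_add_sq[of "grad \<psi> z - GU z" "GU z"] by (auto simp: indicator_def)
    qed (use ints inti in auto)
    also have "\<dots> = 2 * g + 2 * v" using ints inti by (simp add: g_def v_def)
    finally have Yle: "Y \<le> 2 * g + 2 * v" .
    have wle: "w \<le> C * \<sigma> * boundary_sq \<psi> + C * \<sigma>\<^sup>2 * Y"
      using C[OF \<psi> \<sigma>] by (simp add: w_def Y_def)
    have "(\<integral>z. (norm (grad \<theta> z - GU z))\<^sup>2 \<partial>?M)
      \<le> (\<integral>z. 2 * (norm (grad \<psi> z - GU z))\<^sup>2 + 4 * ((norm (GU z))\<^sup>2 * ?i z)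
          + 4 * (D / \<sigma>)\<^sup>2 * ((norm (\<psi> z))\<^sup>2 * ?i z) \<partial>?M)"
    proof (rule integral_mono)
      fix z assume "z \<in> space ?M"
      then have z: "z \<in> E" by (simp add: space_restrict_space)
      have "\<bar>1 - \<eta> z\<bar> \<le> ?i z"
        using \<eta>(2,3)[of z] 1[OF z] by (auto simp: indicator_def)
      then have "(norm ((\<eta> z - 1) *\<^sub>R GU z))\<^sup>2 \<le> (?i z * norm (GU z))\<^sup>2"
        by (intro power_mono) (auto simp: abs_minus_commute intro!: mult_right_mono)
      also have "\<dots> = (norm (GU z))\<^sup>2 * ?i z" by (auto simp: indicator_def)
      finally have b1: "(norm ((\<eta> z - 1) *\<^sub>R GU z))\<^sup>2 \<le> (norm (GU z))\<^sup>2 * ?i z" .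
      have "norm (grad \<eta> z) \<le> D / \<sigma> * ?i z"
        using \<eta>(4)[of z] 1[OF z] by (auto simp: indicator_def)
      then have "(norm (\<psi> z *\<^sub>R grad \<eta> z))\<^sup>2 \<le> (norm (\<psi> z) * (D / \<sigma> * ?i z))\<^sup>2"
        unfolding norm_scaleR real_norm_def by (intro power_mono mult_left_mono) simp_all
      also have "\<dots> = (D / \<sigma>)\<^sup>2 * ((norm (\<psi> z))\<^sup>2 * ?i z)"
        by (simp add: power_mult_distrib power_divide indicator_def)
      finally have b2: "(norm (\<psi> z *\<^sub>R grad \<eta> z))\<^sup>2 \<le> (D / \<sigma>)\<^sup>2 * ((norm (\<psi> z))\<^sup>2 * ?i z)" .
      have b3: "(norm (\<eta> z *\<^sub>R (grad \<psi> z - GU z)))\<^sup>2 \<le> (norm (grad \<psi> z - GU z))\<^sup>2"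
        using \<eta>(2,3)[of z] by (intro power_mono) (auto intro!: mult_left_le_one_le)
      have eq: "grad \<theta> z - GU z = \<eta> z *\<^sub>R (grad \<psi> z - GU z) + ((\<eta> z - 1) *\<^sub>R GU z + \<psi> z *\<^sub>R grad \<eta> z)"
        unfolding \<theta>_def[abs_def] grad_mult[OF \<eta>(1) \<psi>] by (simp add: algebra_simps)
      show "(norm (grad \<theta> z - GU z))\<^sup>2 \<le> 2 * (norm (grad \<psi> z - GU z))\<^sup>2 + 4 * ((norm (GU z))\<^sup>2 * ?i z)
          + 4 * (D / \<sigma>)\<^sup>2 * ((norm (\<psi> z))\<^sup>2 * ?i z)"
        unfolding eq using b1 b2 b3 norm_add_sq[of "\<eta> z *\<^sub>R (grad \<psi> z - GU z)" "(\<eta> z - 1) *\<^sub>R GU z + \<psi> z *\<^sub>R grad \<eta> z"]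
          norm_add_sq[of "(\<eta> z - 1) *\<^sub>R GU z" "\<psi> z *\<^sub>R grad \<eta> z"] by linarith
    qed (use ints inti in auto)
    also have "\<dots> = 2 * g + 4 * v + 4 * (D / \<sigma>)\<^sup>2 * w"
      unfolding g_def v_def w_def using ints(2) inti(2,3) by simp
    also have "\<dots> \<le> 2 * g + 4 * v + 4 * (D / \<sigma>)\<^sup>2 * (C * \<sigma> * boundary_sq \<psi> + C * \<sigma>\<^sup>2 * (2 * g + 2 * v))"
    proof -
      have "C * \<sigma>\<^sup>2 * Y \<le> C * \<sigma>\<^sup>2 * (2 * g + 2 * v)" using Yle C0 by (intro mult_left_mono) auto
      with wle have "w \<le> C * \<sigma> * boundary_sq \<psi> + C * \<sigma>\<^sup>2 * (2 * g + 2 * v)" by linarith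
      then show ?thesis by (intro add_left_mono mult_left_mono) auto
    qed
    also have "\<dots> = 2 * g + 4 * v + 4 * (D\<^sup>2 * C) / \<sigma> * boundary_sq \<psi> + 8 * (D\<^sup>2 * C) * (g + v)"
      using \<sigma> by (simp add: field_simps power2_eq_square)
    also have "\<dots> \<le> A * g + A * v + A / \<sigma> * boundary_sq \<psi>"
    proof -
      have "4 * (D\<^sup>2 * C) \<le> A" using C0 by (simp add: A_def)
      then have "4 * (D\<^sup>2 * C) / \<sigma> * boundary_sq \<psi> \<le> A / \<sigma> * boundary_sq \<psi>"
        using \<sigma> pos by (intro mult_right_mono divide_right_mono) auto
      then show ?thesis using pos by (simp add: A_def distrib_right distrib_left)
    qed
    finally have r2: "(\<integral>z. (norm (grad \<theta> z - GU z))\<^sup>2 \<partial>?M) \<le> A * g + A * v + A / \<sigma> * boundary_sq \<psi>" .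
    show "\<exists>\<theta>. test_fun E \<theta> \<and>
      (\<integral>z. (\<theta> z - U z)\<^sup>2 \<partial>?M) \<le> 2 * (\<integral>z. (\<psi> z - U z)\<^sup>2 \<partial>?M) + 2 * (\<integral>z. (norm (U z))\<^sup>2 * ?i z \<partial>?M) \<and>
      (\<integral>z. (norm (grad \<theta> z - GU z))\<^sup>2 \<partial>?M) \<le> A * (\<integral>z. (norm (grad \<psi> z - GU z))\<^sup>2 \<partial>?M)
       + A * (\<integral>z. (norm (GU z))\<^sup>2 * ?i z \<partial>?M) + A / \<sigma> * boundary_sq \<psi>"
      using t\<theta> r1 r2 unfolding g_def v_def by blast
  qed
qed

text \<open>The gradient of the cutoff is of order \<open>1 / \<sigma>\<close> on the strips. For fixed \<open>\<sigma>\<close> the resulting boundary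
  term vanishes as \<open>n \<rightarrow> \<infinity>\<close>, and what remains are integrals over the strips, which vanish as \<open>\<sigma> \<rightarrow> 0\<close>.\<close>

lemma test_fun_approx:
  fixes U :: "pt \<Rightarrow> real" and GU :: "pt \<Rightarrow> pt"
  assumes \<psi>: "\<And>n. smooth (\<psi> n)" and U: "square_integrable (lebesgue_on E) U" and GU: "square_integrable (lebesgue_on E) GU"
    and a: "(\<lambda>n. \<integral>z. (\<psi> n z - U z)\<^sup>2 \<partial>lebesgue_on E) \<longlonglongrightarrow> 0"
    and g: "(\<lambda>n. \<integral>z. (norm (grad (\<psi> n) z - GU z))\<^sup>2 \<partial>lebesgue_on E) \<longlonglongrightarrow> 0"
    and b: "(\<lambda>n. boundary_sq (\<psi> n)) \<longlonglongrightarrow> 0"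
  obtains \<theta> where "\<And>m. test_fun E (\<theta> m)" "(\<lambda>m. \<integral>z. (\<theta> m z - U z)\<^sup>2 \<partial>lebesgue_on E) \<longlonglongrightarrow> 0"
    "(\<lambda>m. \<integral>z. (norm (grad (\<theta> m) z - GU z))\<^sup>2 \<partial>lebesgue_on E) \<longlonglongrightarrow> 0"
proof -
  let ?M = "lebesgue_on E"
  define w v where "w \<sigma> = (\<integral>z. (norm (U z))\<^sup>2 * indicator (strips \<sigma>) z \<partial>?M)"
    and "v \<sigma> = (\<integral>z. (norm (GU z))\<^sup>2 * indicator (strips \<sigma>) z \<partial>?M)" for \<sigma>
  define an gn where "an n = (\<integral>z. (\<psi> n z - U z)\<^sup>2 \<partial>?M)" and "gn n = (\<integral>z. (norm (grad (\<psi> n) z - GU z))\<^sup>2 \<partial>?M)" for n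
  obtain A where A0: "0 \<le> A" and A: "\<And>\<psi> \<sigma>. smooth \<psi> \<Longrightarrow> 0 < \<sigma> \<Longrightarrow> \<sigma> \<le> 1 \<Longrightarrow> \<exists>\<theta>. test_fun E \<theta> \<and>
    (\<integral>z. (\<theta> z - U z)\<^sup>2 \<partial>?M) \<le> 2 * (\<integral>z. (\<psi> z - U z)\<^sup>2 \<partial>?M) + 2 * w \<sigma> \<and>
    (\<integral>z. (norm (grad \<theta> z - GU z))\<^sup>2 \<partial>?M) \<le> A * (\<integral>z. (norm (grad \<psi> z - GU z))\<^sup>2 \<partial>?M)
       + A * v \<sigma> + A / \<sigma> * boundary_sq \<psi>"
    unfolding w_def v_def by (rule cutoff_error[OF U GU]) blast
  have ex: "\<exists>\<theta>. test_fun E \<theta> \<and> (\<integral>z. (\<theta> z - U z)\<^sup>2 \<partial>?M) < \<tau> \<and> (\<integral>z. (norm (grad \<theta> z - GU z))\<^sup>2 \<partial>?M) < \<tau>"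
    if \<tau>: "0 < \<tau>" for \<tau>
  proof -
    have iU: "integrable ?M (\<lambda>z. (norm (U z))\<^sup>2)" and iG: "integrable ?M (\<lambda>z. (norm (GU z))\<^sup>2)"
      using U GU by (simp_all add: square_integrable_def)
    have "(\<lambda>j. 2 * w (inverse (real (Suc j)))) \<longlonglongrightarrow> 2 * 0" "(\<lambda>j. A * v (inverse (real (Suc j)))) \<longlonglongrightarrow> A * 0"
      unfolding w_def v_def by (intro tendsto_intros strips_integral_tendsto iU iG)+
    from order_tendstoD(2)[OF this(1), of "\<tau> / 2"] order_tendstoD(2)[OF this(2), of "\<tau> / 2"]
    have "\<forall>\<^sub>F j in sequentially. 2 * w (inverse (real (Suc j))) < \<tau> / 2 \<and> A * v (inverse (real (Suc j))) < \<tau> / 2"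
      using \<tau> by (intro eventually_conj) simp_all
    then obtain j where j: "2 * w (inverse (real (Suc j))) < \<tau> / 2" "A * v (inverse (real (Suc j))) < \<tau> / 2"
      using eventually_happens'[OF sequentially_bot] by blast
    define \<sigma> where "\<sigma> = inverse (real (Suc j))"
    have \<sigma>: "0 < \<sigma>" "\<sigma> \<le> 1" by (simp_all add: \<sigma>_def field_simps)
    have "(\<lambda>n. 2 * an n) \<longlonglongrightarrow> 2 * 0" "(\<lambda>n. A * gn n + A / \<sigma> * boundary_sq (\<psi> n)) \<longlonglongrightarrow> A * 0 + A / \<sigma> * 0"
      unfolding an_def gn_def by (intro tendsto_intros a g b)+
    from order_tendstoD(2)[OF this(1), of "\<tau> / 2"] order_tendstoD(2)[OF this(2), of "\<tau> / 2"]
    have "\<forall>\<^sub>F n in sequentially. 2 * an n < \<tau> / 2 \<and> A * gn n + A / \<sigma> * boundary_sq (\<psi> n) < \<tau> / 2"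
      using \<tau> by (intro eventually_conj) simp_all
    then obtain n where n: "2 * an n < \<tau> / 2" "A * gn n + A / \<sigma> * boundary_sq (\<psi> n) < \<tau> / 2"
      using eventually_happens'[OF sequentially_bot] by blast
    from A[OF \<psi>[of n] \<sigma>] obtain \<theta> where \<theta>: "test_fun E \<theta>"
      "(\<integral>z. (\<theta> z - U z)\<^sup>2 \<partial>?M) \<le> 2 * an n + 2 * w \<sigma>"
      "(\<integral>z. (norm (grad \<theta> z - GU z))\<^sup>2 \<partial>?M) \<le> A * gn n + A * v \<sigma> + A / \<sigma> * boundary_sq (\<psi> n)"
      unfolding an_def gn_def by blast
    have "(\<integral>z. (\<theta> z - U z)\<^sup>2 \<partial>?M) < \<tau>" using \<theta>(2) n(1) j(1)[folded \<sigma>_def] by linarith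
    moreover have "(\<integral>z. (norm (grad \<theta> z - GU z))\<^sup>2 \<partial>?M) < \<tau>"
      using \<theta>(3) n(2) j(2)[folded \<sigma>_def] by linarith
    ultimately show ?thesis using \<theta>(1) by blast
  qed
  define \<theta> where "\<theta> m = (SOME \<theta>. test_fun E \<theta> \<and> (\<integral>z. (\<theta> z - U z)\<^sup>2 \<partial>?M) < inverse (real (Suc m))
     \<and> (\<integral>z. (norm (grad \<theta> z - GU z))\<^sup>2 \<partial>?M) < inverse (real (Suc m)))" for m
  have "test_fun E (\<theta> m) \<and> (\<integral>z. (\<theta> m z - U z)\<^sup>2 \<partial>?M) < inverse (real (Suc m))
     \<and> (\<integral>z. (norm (grad (\<theta> m) z - GU z))\<^sup>2 \<partial>?M) < inverse (real (Suc m))" for m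
    unfolding \<theta>_def by (rule someI_ex[OF ex]) simp
  then have \<theta>: "test_fun E (\<theta> m)" "(\<integral>z. (\<theta> m z - U z)\<^sup>2 \<partial>?M) < inverse (real (Suc m))"
     "(\<integral>z. (norm (grad (\<theta> m) z - GU z))\<^sup>2 \<partial>?M) < inverse (real (Suc m))" for m
    by blast+
  show ?thesis
  proof (rule that[of \<theta>])
    show "test_fun E (\<theta> m)" for m by (rule \<theta>(1))
    show "(\<lambda>m. \<integral>z. (\<theta> m z - U z)\<^sup>2 \<partial>?M) \<longlonglongrightarrow> 0"
      by (rule tendsto_sandwich[OF _ _ tendsto_const LIMSEQ_inverse_real_of_nat])
        (auto intro!: always_eventually less_imp_le[OF \<theta>(2)] simp del: of_nat_Suc)
    show "(\<lambda>m. \<integral>z. (norm (grad (\<theta> m) z - GU z))\<^sup>2 \<partial>?M) \<longlonglongrightarrow> 0"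
      by (rule tendsto_sandwich[OF _ _ tendsto_const LIMSEQ_inverse_real_of_nat])
        (auto intro!: always_eventually less_imp_le[OF \<theta>(3)] simp del: of_nat_Suc)
  qed
qed

end

section \<open>Weak derivatives\<close>

text \<open>A passage between two integrals: the Bochner integral over \<open>S\<close>, where
  integrability is known, and the gauge integral over a box \<open>T\<close>, where iterated
  integration and the fundamental theorem are at hand.\<close>

lemma set_lebesgue_integral_negligible_support:
  fixes f :: "'a::euclidean_space \<Rightarrow> real"
  assumes "integrable (lebesgue_on S) f" "S \<in> sets lebesgue" "\<And>x. x \<notin> S \<Longrightarrow> f x = 0" "\<And>x. x \<notin> T \<Longrightarrow> f x = 0"
  shows "(\<integral>x. f x \<partial>lebesgue_on S) = integral T f"
proof -
  have "set_integrable lebesgue S f"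
    using assms(1,2) by (simp add: integrable_restrict_space set_integrable_def)
  then have "(LINT x:S|lebesgue. f x) = integral S f"
    by (rule set_lebesgue_integral_eq_integral)
  moreover have "(\<lambda>x. if x \<in> S then f x else 0) = f" "(\<lambda>x. if x \<in> T then f x else 0) = f"
    using assms(3,4) by auto
  then have "integral S f = integral T f"
    using integral_restrict_UNIV[of S f] integral_restrict_UNIV[of T f] by simp
  ultimately show ?thesis using LINT_restrict[OF assms(2), of f] by simp
qed

lemma smooth_partial_derivative:
  assumes "smooth \<theta>"
  shows "((\<lambda>x. \<theta> (x, y)) has_real_derivative Defs.pderiv (1, 0) \<theta> (x, y)) (at x)"
    "((\<lambda>y. \<theta> (x, y)) has_real_derivative Defs.pderiv (0, 1) \<theta> (x, y)) (at y)"
proof -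
  have p: "Defs.pderiv i \<theta> z = grad \<theta> z \<bullet> i" for i z
    by (rule pderiv_eq[OF smooth_has_derivative[OF assms]])
  have "((\<lambda>x. (x, y)) has_derivative (\<lambda>u. (u, 0))) (at x)" "((\<lambda>y. (x, y)) has_derivative (\<lambda>u. (0, u))) (at y)"
    by (auto intro!: derivative_eq_intros)
  from this[THEN has_derivative_compose, OF smooth_has_derivative[OF assms]]
  have "((\<lambda>x. \<theta> (x, y)) has_derivative (\<lambda>u. grad \<theta> (x, y) \<bullet> (u, 0))) (at x)"
    "((\<lambda>y. \<theta> (x, y)) has_derivative (\<lambda>u. grad \<theta> (x, y) \<bullet> (0, u))) (at y)" .
  moreover have "(\<lambda>u. grad \<theta> (x, y) \<bullet> (u, 0)) = (*) (grad \<theta> (x, y) \<bullet> (1, 0))"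
    "(\<lambda>u. grad \<theta> (x, y) \<bullet> (0, u)) = (*) (grad \<theta> (x, y) \<bullet> (0, 1))"
    by (cases "grad \<theta> (x, y)"; simp add: fun_eq_iff)+
  ultimately show "((\<lambda>x. \<theta> (x, y)) has_real_derivative Defs.pderiv (1, 0) \<theta> (x, y)) (at x)"
    "((\<lambda>y. \<theta> (x, y)) has_real_derivative Defs.pderiv (0, 1) \<theta> (x, y)) (at y)"
    by (simp_all add: has_field_derivative_def p)
qed

text \<open>The function \<theta> vanishes outside \<open>S\<close>, hence near the faces of a large
  box, where iterated integration and the fundamental theorem in direction \<open>i\<close> leave
  only face values. The lemma serves to compare the mean gradients of \<open>v\<close> and of its
  lifting.\<close>

lemma test_fun_pderiv_integral_0:
  assumes t: "test_fun S \<theta>" and S: "bounded S" "S \<in> sets lebesgue" and i: "i \<in> Basis"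
  shows "(\<integral>z. Defs.pderiv i \<theta> z \<partial>lebesgue_on S) = 0"
proof -
  obtain R0 where R0: "\<And>z. z \<in> S \<Longrightarrow> norm z \<le> R0" using S(1) by (auto simp: bounded_iff)
  \<comment> \<open>The added 1 puts the faces of the box strictly outside \<open>S\<close>.\<close>
  define R where "R = max R0 0 + 1"
  have R: "\<bar>x\<bar> < R" "\<bar>y\<bar> < R" if "(x, y) \<in> S" for x y
    using R0[OF that] norm_fst_le[of x y] norm_snd_le[of y x] by (auto simp: R_def)
  have s: "smooth \<theta>" using t by (simp add: test_fun_def)
  note ti = test_fun_pderiv[OF t i]
  have c: "continuous_on A (Defs.pderiv i \<theta>)" for A
    by (rule smooth_continuous[OF smooth_pderiv[OF s i]])
  have S0: "Defs.pderiv i \<theta> z = 0" if "z \<notin> S" for z using test_fun_outside[OF ti that] .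
  have \<theta>0: "\<theta> z = 0" if "z \<notin> S" for z using test_fun_outside[OF t that] .
  have B0: "Defs.pderiv i \<theta> z = 0" if "z \<notin> cbox (-R, -R) (R, R)" for z
    using that S0[of z] R[of "fst z" "snd z"] by (cases z) (force simp: abs_less_iff)
  have "integrable (lebesgue_on S) (Defs.pderiv i \<theta>)"
    by (rule square_integrable_integrable[OF finite_measure_lebesgue_on_bounded[OF S] square_integrable_continuous[OF c S]])
  then have "(\<integral>z. Defs.pderiv i \<theta> z \<partial>lebesgue_on S) = integral (cbox (-R, -R) (R, R)) (Defs.pderiv i \<theta>)"
    by (rule set_lebesgue_integral_negligible_support[OF _ S(2) S0 B0])
  also have "\<dots> = integral (cbox (-R) R) (\<lambda>x. integral (cbox (-R) R) (\<lambda>y. Defs.pderiv i \<theta> (x, y)))"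
    by (rule integral_prod_continuous[OF c])
  also have "\<dots> = 0"
  proof -
    have end0: "\<theta> (x, R) = 0" "\<theta> (x, -R) = 0" "\<theta> (R, x) = 0" "\<theta> (-R, x) = 0" for x
      using R[of x R] R[of x "-R"] R[of R x] R[of "-R" x] by (auto intro!: \<theta>0)
    have RR: "-R \<le> R" by (simp add: R_def)
    consider "i = (1, 0)" | "i = (0, 1)" using i by (auto simp: Basis_pt)
    then show ?thesis
    proof cases
      case 1
      have "((\<lambda>x. Defs.pderiv i \<theta> (x, y)) has_integral \<theta> (R, y) - \<theta> (-R, y)) {-R..R}" for y
        using smooth_partial_derivative(1)[OF s] RR
        by (intro fundamental_theorem_of_calculus)
          (auto simp: 1 has_real_derivative_iff_has_vector_derivative[symmetric] intro: has_field_derivative_at_within)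
      then have "integral (cbox (-R) R) (\<lambda>x. Defs.pderiv i \<theta> (x, y)) = 0" for y
        by (simp add: end0 integral_unique)
      moreover have "integral (cbox (-R) R) (\<lambda>x. integral (cbox (-R) R) (\<lambda>y. Defs.pderiv i \<theta> (x, y)))
         = integral (cbox (-R) R) (\<lambda>y. integral (cbox (-R) R) (\<lambda>x. Defs.pderiv i \<theta> (x, y)))"
        by (rule integral_swap_continuous) (simp add: c)
      ultimately show ?thesis by simp
    next
      case 2
      have "((\<lambda>y. Defs.pderiv i \<theta> (x, y)) has_integral \<theta> (x, R) - \<theta> (x, -R)) {-R..R}" for x
        using smooth_partial_derivative(2)[OF s] RR
        by (intro fundamental_theorem_of_calculus)
          (auto simp: 2 has_real_derivative_iff_has_vector_derivative[symmetric] intro: has_field_derivative_at_within)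
      then have "integral (cbox (-R) R) (\<lambda>y. Defs.pderiv i \<theta> (x, y)) = 0" for x
        by (simp add: end0 integral_unique)
      then show ?thesis by simp
    qed
  qed
  finally show ?thesis .
qed

lemma is_weak_grad_wgrad: "v \<in> H1 S \<Longrightarrow> is_weak_grad S v (wgrad S v)"
  using someI_ex[of "is_weak_grad S v"] by (auto simp: H1_def wgrad_def)

text \<open>\<open>laplacian_is\<close> puts both derivatives on the test function; the weak
  gradient, tested with the partial derivatives of \<theta>, takes one of them back. The resulting
  identity involves only \<theta> and its gradient and so survives limits in
  \<open>H1\<close>.\<close>

lemma weak_laplace:
  assumes v: "v \<in> H1 S" and p: "laplacian_is S v p" and t: "test_fun S \<theta>"
    and S: "bounded S" "S \<in> sets lebesgue"
  shows "(\<integral>z. wgrad S v z \<bullet> grad \<theta> z \<partial>lebesgue_on S) = - (\<integral>z. p z * \<theta> z \<partial>lebesgue_on S)"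
proof -
  let ?M = "lebesgue_on S"
  define G where "G = wgrad S v"
  have G: "is_weak_grad S v G" unfolding G_def by (rule is_weak_grad_wgrad[OF v])
  have sG: "square_integrable ?M G" using G S by (simp add: is_weak_grad_def L2_iff_square_integrable)
  have sv: "square_integrable ?M v" using v S by (simp add: H1_def L2_iff_square_integrable)
  have s: "smooth \<theta>" using t by (simp add: test_fun_def)
  have sp: "square_integrable ?M (Defs.pderiv i (Defs.pderiv i \<theta>))" "square_integrable ?M (Defs.pderiv i \<theta>)" if "i \<in> Basis" for i
    using smooth_pderiv[OF smooth_pderiv[OF s that] that] smooth_pderiv[OF s that]
    by (auto intro: square_integrable_continuous[OF smooth_continuous S])
  have sGi: "square_integrable ?M (\<lambda>z. G z \<bullet> i)" for i
  proof -
    have b: "integrable ?M (\<lambda>z. (norm i)\<^sup>2 * (norm (G z))\<^sup>2)" using sG by (simp add: square_integrable_def)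
    have m: "(\<lambda>z. G z \<bullet> i) \<in> borel_measurable ?M" using square_integrable_measurable[OF sG] by measurable
    have le: "(norm (G z \<bullet> i))\<^sup>2 \<le> (norm i)\<^sup>2 * (norm (G z))\<^sup>2" for z
      using power_mono[OF Cauchy_Schwarz_ineq2[of "G z" i], of 2] by (simp add: power_mult_distrib mult.commute)
    have "integrable ?M (\<lambda>z. (norm (G z \<bullet> i))\<^sup>2)"
    proof (rule Bochner_Integration.integrable_bound[OF b])
      show "(\<lambda>z. (norm (G z \<bullet> i))\<^sup>2) \<in> borel_measurable ?M" using m by measurable
      show "AE z in ?M. norm ((norm (G z \<bullet> i))\<^sup>2) \<le> norm ((norm i)\<^sup>2 * (norm (G z))\<^sup>2)"
        using le by (intro AE_I2) simp
    qed
    with m show ?thesis by (simp add: square_integrable_def)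
  qed
  have w: "(\<integral>z. v z * Defs.pderiv i (Defs.pderiv i \<theta>) z \<partial>?M) = - (\<integral>z. (G z \<bullet> i) * Defs.pderiv i \<theta> z \<partial>?M)"
    if "i \<in> Basis" for i
    using G test_fun_pderiv[OF t that] that S unfolding is_weak_grad_def by (simp add: LINT_restrict)
  have "(\<integral>z. G z \<bullet> grad \<theta> z \<partial>?M) = (\<integral>z. (\<Sum>i\<in>Basis. (G z \<bullet> i) * Defs.pderiv i \<theta> z) \<partial>?M)"
    unfolding grad_def by (simp add: inner_sum_right mult.commute)
  also have "\<dots> = (\<Sum>i\<in>Basis. \<integral>z. (G z \<bullet> i) * Defs.pderiv i \<theta> z \<partial>?M)"
    by (intro Bochner_Integration.integral_sum square_integrable_mult sGi sp)
  also have "\<dots> = - (\<Sum>i\<in>Basis. \<integral>z. v z * Defs.pderiv i (Defs.pderiv i \<theta>) z \<partial>?M)"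
    using w by (simp add: sum_negf)
  also have "(\<Sum>i\<in>Basis. \<integral>z. v z * Defs.pderiv i (Defs.pderiv i \<theta>) z \<partial>?M)
      = (\<integral>z. (\<Sum>i\<in>Basis. v z * Defs.pderiv i (Defs.pderiv i \<theta>) z) \<partial>?M)"
    by (intro Bochner_Integration.integral_sum[symmetric] square_integrable_mult sv sp)
  also have "\<dots> = (\<integral>z. v z * laplace \<theta> z \<partial>?M)"
    by (simp add: laplace_def sum_distrib_left)
  also have "\<dots> = (\<integral>z. p z * \<theta> z \<partial>?M)"
    using p t S unfolding laplacian_is_def by (simp add: LINT_restrict)
  finally show ?thesis by (simp add: G_def)
qed

lemma negligible_affine_image:
  fixes N :: "real set"
  assumes "negligible N" shows "negligible ((\<lambda>t. a + c * t) ` N)"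
proof -
  have "(\<lambda>t. a + c * t) differentiable_on N"
    unfolding differentiable_on_def
    by (intro ballI differentiableI[OF has_derivative_add[OF has_derivative_const
          has_derivative_mult_right[OF has_derivative_ident]]])
  then show ?thesis by (intro negligible_differentiable_image_negligible assms) auto
qed

lemma AE_lebesgue_onE:
  assumes "AE t in lebesgue_on S. P t" "S \<in> sets lebesgue"
  obtains N where "negligible N" "\<And>t. t \<in> S \<Longrightarrow> t \<notin> N \<Longrightarrow> P t"
proof -
  have "AE t in lebesgue. t \<in> S \<longrightarrow> P t" using assms by (simp add: AE_restrict_space_iff)
  then obtain N where "N \<in> null_sets lebesgue" "{t \<in> space lebesgue. \<not> (t \<in> S \<longrightarrow> P t)} \<subseteq> N"
    by (auto simp: eventually_ae_filter)
  then show ?thesis using that[of N] by (auto simp: negligible_iff_null_sets)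
qed

section \<open>Traces\<close>

context trapezoid
begin

lemma edges_quad: "edges vs = {((0, h), (0, 0)), ((0, 0), (e2, 0)), ((e2, 0), (e1, h)), ((e1, h), (0, h))}"
  by (simp add: edges_def quad_def)

lemma bdry_integral_quad: "bdry_integral vs f = h * edge_int (0, h) (0, 0) f + e2 * edge_int (0, 0) (e2, 0) f
    + dist (e2, 0) (e1, h) * edge_int (e2, 0) (e1, h) f + e1 * edge_int (e1, h) (0, h) f"
proof -
  have ne: "h \<noteq> 0" "e1 \<noteq> 0" "e2 \<noteq> 0" "0 \<noteq> h" "0 \<noteq> e1" "0 \<noteq> e2" using h_pos e1 e2_pos by auto
  have "(LINT t:{0..1}|lebesgue. f (linepath a b t)) = edge_int a b f" for a b
    unfolding edge_int_def by (rule LINT_restrict) simp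
  moreover have "dist (0::real, h) (0, 0) = h" "dist (0, 0) (e2, 0::real) = e2" "dist (e1, h) (0, h) = e1"
    using h_pos e1 e2_pos by (simp_all add: dist_Pair_Pair dist_real_def)
  ultimately show ?thesis
    unfolding bdry_integral_def edges_quad using ne by simp
qed

lemma dist_slanted_pos: "0 < dist (e2, 0::real) (e1, h)"
  using h_pos by simp

text \<open>\<open>edge_sq\<close> is taken over the parameter interval and lacks the edge lengths
  contained in \<open>bdry_integral\<close>, so their reciprocals make up \<open>C\<close>.\<close>

lemma boundary_sq_le_bdry_integral:
  obtains C where "0 \<le> C" "\<And>f. boundary_sq f \<le> C * bdry_integral vs (\<lambda>z. (f z)\<^sup>2)"
proof -
  let ?d = "dist (e2, 0::real) (e1, h)"
  define C where "C = 1 / h + 1 / e2 + 1 / ?d + 1 / e1"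
  have pos: "0 < 1 / h" "0 < 1 / e2" "0 < 1 / ?d" "0 < 1 / e1"
    using h_pos e1 e2_pos dist_slanted_pos by simp_all
  show ?thesis
  proof (rule that[of "C"])
    show "0 \<le> C" using pos by (simp add: C_def)
    fix f :: "pt \<Rightarrow> real"
    define B where "B = bdry_integral vs (\<lambda>z. (f z)\<^sup>2)"
    have eq: "edge_int a b (\<lambda>z. (f z)\<^sup>2) = edge_sq a b f" for a b by (simp add: edge_int_def edge_sq_def)
    have "0 \<le> h * edge_sq (0, h) (0, 0) f" "0 \<le> e2 * edge_sq (0, 0) (e2, 0) f"
      "0 \<le> ?d * edge_sq (e2, 0) (e1, h) f" "0 \<le> e1 * edge_sq (e1, h) (0, h) f"
      using h_pos e1 e2_pos edge_sq_ge_0 by simp_all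
    then have "h * edge_sq (0, h) (0, 0) f \<le> B" "e2 * edge_sq (0, 0) (e2, 0) f \<le> B"
      "?d * edge_sq (e2, 0) (e1, h) f \<le> B" "e1 * edge_sq (e1, h) (0, h) f \<le> B"
      unfolding B_def bdry_integral_quad eq by linarith+
    then have "edge_sq (0, h) (0, 0) f \<le> 1 / h * B" "edge_sq (0, 0) (e2, 0) f \<le> 1 / e2 * B"
      "edge_sq (e2, 0) (e1, h) f \<le> 1 / ?d * B" "edge_sq (e1, h) (0, h) f \<le> 1 / e1 * B"
      using h_pos e1 e2_pos dist_slanted_pos by (simp_all add: pos_le_divide_eq mult.commute)
    then show "boundary_sq f \<le> C * bdry_integral vs (\<lambda>z. (f z)\<^sup>2)"
      unfolding boundary_sq_def C_def B_def[symmetric] distrib_right by linarith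
  qed
qed

lemma is_traceE:
  assumes "is_trace vs v g"
  obtains \<phi> where "\<And>n. smooth (\<phi> n)"
    "(\<lambda>n. \<integral>z. (\<phi> n z - v z)\<^sup>2 \<partial>lebesgue_on E) \<longlonglongrightarrow> 0"
    "(\<lambda>n. \<integral>z. (norm (grad (\<phi> n) z - wgrad E v z))\<^sup>2 \<partial>lebesgue_on E) \<longlonglongrightarrow> 0"
    "(\<lambda>n. boundary_sq (\<lambda>z. \<phi> n z - g z)) \<longlonglongrightarrow> 0"
proof -
  from assms obtain \<phi> where s: "\<And>n. smooth (\<phi> n)"
    and a: "(\<lambda>n. LINT z:E|lebesgue. (\<phi> n z - v z)\<^sup>2) \<longlonglongrightarrow> 0"
    and b: "(\<lambda>n. LINT z:E|lebesgue. (norm (grad (\<phi> n) z - wgrad E v z))\<^sup>2) \<longlonglongrightarrow> 0"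
    and c: "(\<lambda>n. bdry_integral vs (\<lambda>z. (\<phi> n z - g z)\<^sup>2)) \<longlonglongrightarrow> 0"
    unfolding is_trace_def by blast
  obtain C where C: "0 \<le> C" "\<And>f. boundary_sq f \<le> C * bdry_integral vs (\<lambda>z. (f z)\<^sup>2)"
    by (rule boundary_sq_le_bdry_integral) blast
  have "(\<lambda>n. C * bdry_integral vs (\<lambda>z. (\<phi> n z - g z)\<^sup>2)) \<longlonglongrightarrow> C * 0"
    by (intro tendsto_intros c)
  then have up: "(\<lambda>n. C * bdry_integral vs (\<lambda>z. (\<phi> n z - g z)\<^sup>2)) \<longlonglongrightarrow> 0" by simp
  have lo: "0 \<le> boundary_sq f" for f by (simp add: boundary_sq_def edge_sq_ge_0)
  have "(\<lambda>n. boundary_sq (\<lambda>z. \<phi> n z - g z)) \<longlonglongrightarrow> 0"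
    by (rule tendsto_sandwich[OF _ _ tendsto_const up]) (intro always_eventually allI lo C(2))+
  then show ?thesis using that[OF s] a b E_lebesgue by (simp add: LINT_restrict)
qed

lemma is_trace_square_integrable:
  assumes "is_trace vs v g" "(a, b) \<in> edges vs"
  shows "square_integrable (lebesgue_on {0..1}) (\<lambda>t. g (linepath a b t))"
proof -
  have "L2 {0..1} (\<lambda>t. g (linepath a b t))" using assms unfolding is_trace_def by blast
  then show ?thesis by (simp add: L2_iff_square_integrable)
qed

lemma edge_trace_ineq:
  assumes "(a, b) \<in> edges vs"
  obtains C where "0 \<le> C" "\<And>\<psi>. smooth \<psi> \<Longrightarrow>
    edge_sq a b \<psi> \<le> C * ((\<integral>z. (\<psi> z)\<^sup>2 \<partial>lebesgue_on E) + (\<integral>z. (norm (grad \<psi> z))\<^sup>2 \<partial>lebesgue_on E))"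
proof -
  consider "(a, b) = ((0, h), (0, 0))" | "(a, b) = ((0, 0), (e2, 0))" | "(a, b) = ((e2, 0), (e1, h))"
    | "(a, b) = ((e1, h), (0, h))"
    using assms unfolding edges_quad by blast
  then obtain c d S where "edge_param a b c d S"
    by cases (use edge_left edge_bottom edge_right edge_top in auto)
  then show ?thesis by (rule trace_ineq) (rule that)
qed

lemma edge_sq_le_boundary_sq: "(a, b) \<in> edges vs \<Longrightarrow> edge_sq a b f \<le> boundary_sq f"
  unfolding edges_quad boundary_sq_def
  using edge_sq_ge_0[of "(0, h)" "(0, 0)" f] edge_sq_ge_0[of "(0, 0)" "(e2, 0)" f]
    edge_sq_ge_0[of "(e2, 0)" "(e1, h)" f] edge_sq_ge_0[of "(e1, h)" "(0, h)" f]
  by auto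

text \<open>The difference is split as (g - \<phi>) + (\<phi>' - g') + (\<phi> - \<phi>'), and the
  trace inequality controls the last part by convergence inside \<open>E\<close>. Since
  \<open>tr\<close> is an arbitrary choice among traces, this is what ties it to the piecewise
  affine boundary function of \<open>v\<close>.\<close>

lemma is_trace_unique:
  assumes v: "v \<in> H1 E" and g: "is_trace vs v g" and g': "is_trace vs v g'" and ab: "(a, b) \<in> edges vs"
  shows "AE t in lebesgue_on {0..1}. g (linepath a b t) = g' (linepath a b t)"
proof -
  let ?M = "lebesgue_on E" and ?N = "lebesgue_on {0..1::real}"
  define G where "G = wgrad E v"
  obtain \<phi> where \<phi>: "\<And>n. smooth (\<phi> n)" "(\<lambda>n. \<integral>z. (\<phi> n z - v z)\<^sup>2 \<partial>?M) \<longlonglongrightarrow> 0"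
    "(\<lambda>n. \<integral>z. (norm (grad (\<phi> n) z - G z))\<^sup>2 \<partial>?M) \<longlonglongrightarrow> 0" "(\<lambda>n. boundary_sq (\<lambda>z. \<phi> n z - g z)) \<longlonglongrightarrow> 0"
    unfolding G_def by (rule is_traceE[OF g]) blast
  obtain \<phi>' where \<phi>': "\<And>n. smooth (\<phi>' n)" "(\<lambda>n. \<integral>z. (\<phi>' n z - v z)\<^sup>2 \<partial>?M) \<longlonglongrightarrow> 0"
    "(\<lambda>n. \<integral>z. (norm (grad (\<phi>' n) z - G z))\<^sup>2 \<partial>?M) \<longlonglongrightarrow> 0" "(\<lambda>n. boundary_sq (\<lambda>z. \<phi>' n z - g' z)) \<longlonglongrightarrow> 0"
    unfolding G_def by (rule is_traceE[OF g']) blast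
  have sv: "square_integrable ?M v" using v E_lebesgue by (simp add: H1_def L2_iff_square_integrable)
  have sG: "square_integrable ?M G" using is_weak_grad_wgrad[OF v] E_lebesgue by (simp add: G_def is_weak_grad_def L2_iff_square_integrable)
  obtain C where C: "0 \<le> C" "\<And>\<psi>. smooth \<psi> \<Longrightarrow>
    edge_sq a b \<psi> \<le> C * ((\<integral>z. (\<psi> z)\<^sup>2 \<partial>?M) + (\<integral>z. (norm (grad \<psi> z))\<^sup>2 \<partial>?M))"
    by (rule edge_trace_ineq[OF ab]) blast
  have slope: "square_integrable ?N (\<lambda>t. \<psi> (linepath a b t))" if "smooth \<psi>" for \<psi>
    by (rule square_integrable_continuous) (auto simp: linepath_def intro!: continuous_intros continuous_on_compose2[OF smooth_continuous[OF that, of UNIV]])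
  have sg: "square_integrable ?N (\<lambda>t. g (linepath a b t))" "square_integrable ?N (\<lambda>t. g' (linepath a b t))"
    by (rule is_trace_square_integrable[OF g ab] is_trace_square_integrable[OF g' ab])+
  \<comment> \<open>The factors 2 and 4 come from applying the two-term square inequality
    twice.\<close>
  define X where "X n = 2 * boundary_sq (\<lambda>z. \<phi> n z - g z) + 4 * boundary_sq (\<lambda>z. \<phi>' n z - g' z)
    + 4 * (C * (2 * (\<integral>z. (\<phi> n z - v z)\<^sup>2 \<partial>?M) + 2 * (\<integral>z. (\<phi>' n z - v z)\<^sup>2 \<partial>?M)
      + (2 * (\<integral>z. (norm (grad (\<phi> n) z - G z))\<^sup>2 \<partial>?M) + 2 * (\<integral>z. (norm (grad (\<phi>' n) z - G z))\<^sup>2 \<partial>?M))))" for n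
  have "edge_sq a b (\<lambda>z. g z - g' z) \<le> X n" for n
  proof -
    have two: "edge_sq a b (\<lambda>z. p z + q z) \<le> 2 * edge_sq a b p + 2 * edge_sq a b q"
      if "square_integrable ?N (\<lambda>t. p (linepath a b t))" "square_integrable ?N (\<lambda>t. q (linepath a b t))" for p q
      using square_integrable_norm_add_le[OF that] by (simp add: edge_sq_def)
    have neg: "edge_sq a b (\<lambda>z. p z - q z) = edge_sq a b (\<lambda>z. q z - p z)" for p q
      by (simp add: edge_sq_def power2_commute)
    have "edge_sq a b (\<lambda>z. (g z - \<phi> n z) + ((\<phi>' n z - g' z) + (\<phi> n z - \<phi>' n z)))
        \<le> 2 * edge_sq a b (\<lambda>z. g z - \<phi> n z) + 2 * edge_sq a b (\<lambda>z. (\<phi>' n z - g' z) + (\<phi> n z - \<phi>' n z))"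
      by (intro two square_integrable_diff square_integrable_add sg slope \<phi> \<phi>')
    also have "edge_sq a b (\<lambda>z. (\<phi>' n z - g' z) + (\<phi> n z - \<phi>' n z))
        \<le> 2 * edge_sq a b (\<lambda>z. \<phi>' n z - g' z) + 2 * edge_sq a b (\<lambda>z. \<phi> n z - \<phi>' n z)"
      by (intro two square_integrable_diff square_integrable_add sg slope \<phi> \<phi>')
    also have "edge_sq a b (\<lambda>z. \<phi>' n z - g' z) \<le> boundary_sq (\<lambda>z. \<phi>' n z - g' z)"
      by (rule edge_sq_le_boundary_sq[OF ab])
    also have "edge_sq a b (\<lambda>z. g z - \<phi> n z) \<le> boundary_sq (\<lambda>z. \<phi> n z - g z)"
      unfolding neg[of g] by (rule edge_sq_le_boundary_sq[OF ab])
    also have "edge_sq a b (\<lambda>z. \<phi> n z - \<phi>' n z) \<le> C * ((\<integral>z. (\<phi> n z - \<phi>' n z)\<^sup>2 \<partial>?M)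
        + (\<integral>z. (norm (grad (\<phi> n) z - grad (\<phi>' n) z))\<^sup>2 \<partial>?M))"
      using C(2)[OF smooth_diff[OF \<phi>(1) \<phi>'(1)], of n n] by (simp add: grad_diff[OF \<phi>(1) \<phi>'(1)])
    also have "(\<integral>z. (\<phi> n z - \<phi>' n z)\<^sup>2 \<partial>?M) \<le> 2 * (\<integral>z. (\<phi> n z - v z)\<^sup>2 \<partial>?M) + 2 * (\<integral>z. (\<phi>' n z - v z)\<^sup>2 \<partial>?M)"
      using square_integrable_norm_add_le[OF square_integrable_diff[OF square_integrable_smooth[OF \<phi>(1)] sv] square_integrable_diff[OF sv square_integrable_smooth[OF \<phi>'(1)]], of n n]
      by (simp add: power2_commute)
    also have "(\<integral>z. (norm (grad (\<phi> n) z - grad (\<phi>' n) z))\<^sup>2 \<partial>?M)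
        \<le> 2 * (\<integral>z. (norm (grad (\<phi> n) z - G z))\<^sup>2 \<partial>?M) + 2 * (\<integral>z. (norm (grad (\<phi>' n) z - G z))\<^sup>2 \<partial>?M)"
      using square_integrable_norm_add_le[OF square_integrable_diff[OF square_integrable_grad[OF \<phi>(1)] sG] square_integrable_diff[OF sG square_integrable_grad[OF \<phi>'(1)]], of n n]
      by (simp add: norm_minus_commute)
    finally show ?thesis using C(1) by (simp add: X_def mult_left_mono add_mono)
  qed
  moreover have "X \<longlonglongrightarrow> 2 * 0 + 4 * 0 + 4 * (C * (2 * 0 + 2 * 0 + (2 * 0 + 2 * 0)))"
    unfolding X_def[abs_def] by (intro tendsto_intros \<phi> \<phi>')
  ultimately have "edge_sq a b (\<lambda>z. g z - g' z) \<le> 0"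
    using LIMSEQ_le_const[of X 0 "edge_sq a b (\<lambda>z. g z - g' z)"] by auto
  then have "edge_sq a b (\<lambda>z. g z - g' z) = 0"
    by (rule antisym[OF _ edge_sq_ge_0])
  then have "(\<integral>t. (g (linepath a b t) - g' (linepath a b t))\<^sup>2 \<partial>?N) = 0"
    by (simp only: edge_sq_def)
  moreover have "integrable ?N (\<lambda>t. (g (linepath a b t) - g' (linepath a b t))\<^sup>2)"
    using square_integrable_diff[OF sg] by (simp add: square_integrable_def)
  ultimately have "AE t in ?N. (g (linepath a b t) - g' (linepath a b t))\<^sup>2 = 0"
    by (subst (asm) integral_nonneg_eq_0_iff_AE) auto
  then show ?thesis by simp
qed

lemma is_trace_tr: "is_trace vs v g \<Longrightarrow> is_trace vs v (tr vs v)"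
  using someI[of "is_trace vs v" g] by (simp add: tr_def)

end

section \<open>The lifting of the boundary values\<close>

lemma lebesgue_on_FTC:
  fixes F f :: "real \<Rightarrow> real"
  assumes "a \<le> b" "\<And>x. (F has_real_derivative f x) (at x)" "continuous_on UNIV f"
  shows "(\<integral>x. f x \<partial>lebesgue_on {a..b}) = F b - F a"
proof -
  have "(f has_integral (F b - F a)) {a..b}"
    using assms by (intro fundamental_theorem_of_calculus)
      (auto intro: has_field_derivative_at_within simp: has_real_derivative_iff_has_vector_derivative[symmetric])
  moreover have "f absolutely_integrable_on {a..b}"
    by (rule absolutely_integrable_continuous_real) (rule continuous_on_subset[OF assms(3)], simp)
  ultimately have "F b - F a = (LINT x:{a..b}|lebesgue. f x)"
    by (simp add: set_lebesgue_integral_eq_integral(2) integral_unique)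
  then show ?thesis by (simp add: LINT_restrict)
qed

context trapezoid
begin

text \<open>A positive smooth function on the line that agrees with the width \<open>\<kappa>\<close> up to height \<open>h\<close>;
  \<open>\<kappa>\<close> itself vanishes at the apex above the trapezoid.\<close>

definition kappa_ext :: "real \<Rightarrow> real" where
  "kappa_ext y = e1 + (slope * h + (- slope) * y) * step ((1 + 2 * h / e1) + (- 2 / e1) * y)"

lemma kappa_ext_eq: "y \<le> h \<Longrightarrow> kappa_ext y = k y"
proof -
  assume "y \<le> h"
  then have "1 \<le> (1 + 2 * h / e1) + (- 2 / e1) * y" using e1 by (simp add: field_simps)
  then have "kappa_ext y = e1 + (slope * h + (- slope) * y)" unfolding kappa_ext_def by (simp only: step_1 mult_1_right)
  then show "kappa_ext y = k y" by (simp add: k_eq slope_h)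
qed

text \<open>The argument of \<open>step\<close> is 1 at height \<open>h\<close> and 0 at
  \<open>h + e1 / 2\<close>. In between, the correction to \<open>e1\<close> is at most
  \<open>e1 / 2\<close> in size because \<open>slope \<le> 1\<close>; above, it is zero.\<close>

lemma kappa_ext_pos: "0 < kappa_ext y"
proof (cases "y \<le> h")
  case True then show ?thesis by (simp add: kappa_ext_eq k_pos)
next
  case False
  let ?s = "step ((1 + 2 * h / e1) + (- 2 / e1) * y)"
  show ?thesis
  proof (cases "y \<le> h + e1 / 2")
    case True
    have "slope * (y - h) * ?s \<le> 1 * (e1 / 2) * 1"
      using False True slope_ge_0 slope_le_1 step_ge_0 step_le_1 e1 by (intro mult_mono) auto
    then show ?thesis using e1 by (simp add: kappa_ext_def algebra_simps)
  next
    case False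
    then have "2 / e1 * (h + e1 / 2) \<le> 2 / e1 * y" using e1 by (intro mult_left_mono) auto
    then have "(1 + 2 * h / e1) + (- 2 / e1) * y \<le> 0" using e1 by (simp add: distrib_left)
    then have "kappa_ext y = e1" unfolding kappa_ext_def by (simp only: step_0 mult_zero_right add_0_right)
    then show ?thesis using e1 by simp
  qed
qed

lemma Ck1_kappa_ext: "Ck1 n kappa_ext"
  unfolding kappa_ext_def[abs_def] by (intro Ck1_add Ck1_mult Ck1_const Ck1_affine Ck1_comp_affine[OF Ck1_step])

lemma kappa_ext_continuous: "continuous_on A kappa_ext"
  using Ck1_continuous[OF Ck1_kappa_ext] continuous_on_subset by blast

text \<open>A slice at height \<open>y\<close> has length \<open>k y\<close>, which cancels the
  denominator. Applied to \<open>(left_values \<alpha> \<beta> y)\<^sup>2 / kappa_ext y\<close>, it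
  turns the squared horizontal derivative of the lifting into the integral that defines
  \<open>s_E\<close>. With \<open>kappa_ext\<close> the integrand is continuous on the whole
  plane.\<close>

lemma E_integral_slice:
  assumes c: "continuous_on UNIV f" and nn: "\<And>y. 0 \<le> f y"
  shows "(\<integral>z. f (snd z) / kappa_ext (snd z) \<partial>lebesgue_on E) = (\<integral>y. f y \<partial>lebesgue_on {0..h})"
proof -
  have fm[measurable]: "f \<in> borel_measurable borel" by (rule borel_measurable_continuous_onI[OF c])
  have qc: "continuous_on UNIV (\<lambda>z::pt. f (snd z) / kappa_ext (snd z))"
    using kappa_ext_pos by (intro continuous_intros continuous_on_compose2[OF c] continuous_on_compose2[OF kappa_ext_continuous])
      (auto simp: less_imp_neq[symmetric])
  have qm: "(\<lambda>z::pt. ennreal (f (snd z) / kappa_ext (snd z))) \<in> borel_measurable borel"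
    using borel_measurable_continuous_onI[OF qc] by measurable
  have "ennreal (\<integral>z. f (snd z) / kappa_ext (snd z) \<partial>lebesgue_on E) = (\<integral>\<^sup>+z\<in>E. ennreal (f (snd z) / kappa_ext (snd z)) \<partial>lborel)"
    using nn kappa_ext_pos[THEN less_imp_le] E_lebesgue
    by (intro nn_integral_lebesgue_on[symmetric] square_integrable_integrable[OF finite_measure_lebesgue_on_bounded[OF bounded_E]]
        square_integrable_continuous[OF qc bounded_E]) auto
  also have "\<dots> = unit_nn (\<lambda>s t. ennreal (h * k (t * h)) * ennreal (f (t * h) / kappa_ext (t * h)))"
    using nn_integral_E[OF qm] by simp
  also have "\<dots> = (\<integral>\<^sup>+t\<in>{0<..<1}. ennreal (h * f (t * h)) \<partial>lborel)"
    unfolding unit_nn_def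
  proof (rule nn_integral_cong)
    fix t :: real
    show "(\<integral>\<^sup>+s\<in>{0<..<1::real}. ennreal (h * k (t * h)) * ennreal (f (t * h) / kappa_ext (t * h)) \<partial>lborel) * indicator {0<..<1} t
       = ennreal (h * f (t * h)) * indicator {0<..<1} t"
    proof (cases "0 < t \<and> t < 1")
      case True
      then have "t * h \<le> h" using h_pos by (simp add: mult_left_le_one_le)
      then have "h * k (t * h) * (f (t * h) / kappa_ext (t * h)) = h * f (t * h)"
        using kappa_ext_pos[of "t * h"] by (simp add: kappa_ext_eq)
      moreover have "0 \<le> h * k (t * h)" using k_pos[OF \<open>t * h \<le> h\<close>] h_pos by simp
      ultimately have "ennreal (h * k (t * h)) * ennreal (f (t * h) / kappa_ext (t * h)) = ennreal (h * f (t * h))"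
        by (metis ennreal_mult')
      then show ?thesis by (simp add: nn_integral_cmult_indicator)
    qed auto
  qed
  also have "\<dots> = ennreal \<bar>h\<bar> * (\<integral>\<^sup>+t. ennreal (f (0 + h * t)) * indicator {0<..<h} (0 + h * t) \<partial>lborel)"
    using h_pos by (subst nn_integral_cmult[symmetric], measurable)
      (intro nn_integral_cong, auto simp: indicator_def ennreal_mult' mult.commute zero_less_mult_iff)
  also have "\<dots> = (\<integral>\<^sup>+y\<in>{0<..<h}. ennreal (f y) \<partial>lborel)"
    by (rule nn_integral_real_affine[symmetric]) (use h_pos in auto)
  also have "\<dots> = ennreal (\<integral>y. f y \<partial>lebesgue_on {0..h})"
    unfolding nn_integral_open_interval
    using nn by (intro nn_integral_lebesgue_on square_integrable_integrable[OF finite_measure_lebesgue_on_bounded] square_integrable_continuous[OF c]) auto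
  finally show ?thesis
    using nn kappa_ext_pos[THEN less_imp_le] by (subst (asm) ennreal_inj) (auto intro!: Bochner_Integration.integral_nonneg divide_nonneg_nonneg)
qed

lemma area_E: "(\<integral>z. 1 \<partial>lebesgue_on E) = (e1 + e2) * h / 2"
proof -
  \<comment> \<open>Writing 1 as a quotient of widths brings the area into slice form.\<close>
  have "(\<integral>z. (1::real) \<partial>lebesgue_on E) = (\<integral>z. kappa_ext (snd z) / kappa_ext (snd z) \<partial>lebesgue_on E)"
    using kappa_ext_pos by (simp add: less_imp_neq[symmetric])
  also have "\<dots> = (\<integral>y. kappa_ext y \<partial>lebesgue_on {0..h})"
    by (rule E_integral_slice[OF kappa_ext_continuous less_imp_le[OF kappa_ext_pos]])
  also have "\<dots> = (\<integral>y. e2 - slope * y \<partial>lebesgue_on {0..h})"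
    by (rule Bochner_Integration.integral_cong) (auto simp: kappa_ext_eq k_eq space_restrict_space)
  also have "\<dots> = (e2 * h - slope * h\<^sup>2 / 2) - (e2 * 0 - slope * 0\<^sup>2 / 2)"
    using h_pos by (intro lebesgue_on_FTC) (auto intro!: derivative_eq_intros continuous_intros)
  also have "\<dots> = (e1 + e2) * h / 2"
  proof -
    have "slope * h\<^sup>2 = (e2 - e1) * h" unfolding slope_h[symmetric] by (simp add: power2_eq_square)
    then show ?thesis by (simp add: algebra_simps)
  qed
  finally show ?thesis .
qed

text \<open>Here \<alpha> belongs to the vertex at height \<open>h\<close> and \<beta> to the
  origin.\<close>

definition left_values :: "real \<Rightarrow> real \<Rightarrow> real \<Rightarrow> real" where
  "left_values \<alpha> \<beta> y = \<beta> + (\<alpha> - \<beta>) / h * y"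

text \<open>On \<open>E\<close> the second factor is 1 on the left edge, 0 on the slanted edge and
  affine on the horizontal ones, as the boundary values require. Using \<open>kappa_ext\<close>
  makes the function smooth on the whole plane, so that it can be subtracted from a smooth
  approximating sequence.\<close>

definition lift :: "real \<Rightarrow> real \<Rightarrow> pt \<Rightarrow> real" where
  "lift \<alpha> \<beta> z = left_values \<alpha> \<beta> (snd z) * (1 - fst z * inverse (kappa_ext (snd z)))"

definition stab :: "real \<Rightarrow> real \<Rightarrow> real" where
  "stab \<alpha> \<beta> = (\<integral>y. (left_values \<alpha> \<beta> y)\<^sup>2 / kappa_ext y \<partial>lebesgue_on {0..h})"

lemma left_values_le: "0 \<le> y \<Longrightarrow> y \<le> h \<Longrightarrow> \<bar>left_values \<alpha> \<beta> y\<bar> \<le> max \<bar>\<alpha>\<bar> \<bar>\<beta>\<bar>"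
proof -
  assume y: "0 \<le> y" "y \<le> h"
  define t where "t = y / h"
  have t: "0 \<le> t" "t \<le> 1" using y h_pos by (auto simp: t_def)
  have "left_values \<alpha> \<beta> y = (1 - t) * \<beta> + t * \<alpha>" using h_pos by (simp add: left_values_def t_def field_simps)
  also have "\<bar>\<dots>\<bar> \<le> (1 - t) * \<bar>\<beta>\<bar> + t * \<bar>\<alpha>\<bar>"
    using t abs_triangle_ineq[of "(1 - t) * \<beta>" "t * \<alpha>"] by (simp add: abs_mult)
  also have "\<dots> \<le> (1 - t) * max \<bar>\<alpha>\<bar> \<bar>\<beta>\<bar> + t * max \<bar>\<alpha>\<bar> \<bar>\<beta>\<bar>"
    using t by (intro add_mono mult_left_mono) auto
  finally show ?thesis by (simp add: algebra_simps)
qed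

lemma smooth_lift: "smooth (lift \<alpha> \<beta>)"
proof -
  have "smooth (\<lambda>z. (\<beta> + (\<alpha> - \<beta>) / h * (0 + (0, 1) \<bullet> z)) * (1 - (0 + 1 * (0 + (1, 0) \<bullet> z)) * inverse (kappa_ext (0 + (0, 1) \<bullet> z))))"
    by (intro smooth_mult smooth_diff smooth_const smooth_comp_affine[of "\<lambda>y. \<beta> + (\<alpha> - \<beta>) / h * y"]
        smooth_comp_affine[of "\<lambda>y. 0 + 1 * y"] smooth_comp_affine[of "\<lambda>y. inverse (kappa_ext y)"]
        Ck1_affine Ck1_inverse Ck1_kappa_ext less_imp_neq[OF kappa_ext_pos, symmetric])
  then show ?thesis by (simp add: lift_def[abs_def] left_values_def inner_prod_def)
qed

lemma lift_eq: "snd z \<le> h \<Longrightarrow> lift \<alpha> \<beta> z = left_values \<alpha> \<beta> (snd z) * (1 - fst z / k (snd z))"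
  by (simp add: lift_def kappa_ext_eq divide_inverse)

text \<open>Below height \<open>h\<close> the extension coincides with the affine width, so this is
  the quotient rule; the second vertical term stems from the shrinking width.\<close>

lemma grad_lift:
  assumes z: "snd z < h"
  shows "grad (lift \<alpha> \<beta>) z = (- left_values \<alpha> \<beta> (snd z) / k (snd z),
    (\<alpha> - \<beta>) / h * (1 - fst z / k (snd z)) - left_values \<alpha> \<beta> (snd z) * slope * fst z / (k (snd z))\<^sup>2)"
    (is "_ = (?gx, ?gy)")
proof (rule grad_eq)
  have kp: "e2 - slope * snd z \<noteq> 0" using k_pos[of "snd z"] z by (simp add: k_eq)
  define K c where "K = e2 - slope * snd z" and "c = (\<alpha> - \<beta>) / h"
  have "((\<lambda>z. (\<beta> + c * snd z) * (1 - fst z / (e2 - slope * snd z))) has_derivative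
      (\<lambda>w. (\<beta> + c * snd z) * - ((fst w * K - fst z * - (slope * snd w)) / (K * K)) + c * snd w * (1 - fst z / K))) (at z)"
    using kp unfolding K_def by (auto intro!: derivative_eq_intros)
  also have "(\<lambda>w. (\<beta> + c * snd z) * - ((fst w * K - fst z * - (slope * snd w)) / (K * K)) + c * snd w * (1 - fst z / K))
      = (\<lambda>w. (- (\<beta> + c * snd z) / K, c * (1 - fst z / K) - (\<beta> + c * snd z) * slope * fst z / K\<^sup>2) \<bullet> w)"
    using kp[folded K_def]
    by (intro ext) (simp add: inner_prod_def diff_divide_distrib add_divide_distrib distrib_right
        left_diff_distrib right_diff_distrib distrib_left power2_eq_square ac_simps)
  finally have "((\<lambda>z. left_values \<alpha> \<beta> (snd z) * (1 - fst z / k (snd z))) has_derivative (\<lambda>w. (?gx, ?gy) \<bullet> w)) (at z)"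
    unfolding left_values_def k_eq K_def c_def .
  moreover have "open {z::pt. snd z < h}" by (intro open_Collect_less continuous_intros)
  ultimately show "(lift \<alpha> \<beta> has_derivative (\<lambda>w. (?gx, ?gy) \<bullet> w)) (at z)"
    by (rule has_derivative_transform_within_open) (use z in \<open>simp_all add: lift_eq\<close>)
qed

text \<open>With \<open>r = x / k y\<close> in the unit interval, everything reduces to the bound
  \<open>M\<close> for the left values. The shrinking width is estimated in two ways:
  \<open>slope \<le> 1\<close> suffices for the energy, while \<open>slope \<le> e2 / h\<close>
  keeps the small factor needed for the mean of the vertical derivative. The constants are 3 = 1 + 2
  and 8 = 2 * 4.\<close>

lemma lift_bounds:
  fixes \<alpha> \<beta>
  defines "M \<equiv> max \<bar>\<alpha>\<bar> \<bar>\<beta>\<bar>"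
  assumes z: "z \<in> E"
  shows "\<bar>lift \<alpha> \<beta> z\<bar> \<le> M"
    "(norm (grad (lift \<alpha> \<beta>) z))\<^sup>2 \<le> 3 * (((left_values \<alpha> \<beta> (snd z))\<^sup>2 / kappa_ext (snd z)) / kappa_ext (snd z)) + 8 * M\<^sup>2 / h\<^sup>2"
    "\<bar>grad (lift \<alpha> \<beta>) z \<bullet> (1, 0)\<bar> \<le> M / kappa_ext (snd z)"
    "\<bar>grad (lift \<alpha> \<beta>) z \<bullet> (0, 1)\<bar> \<le> 2 * M / h + M * (e2 / h) / kappa_ext (snd z)"
proof -
  define x y where "x = fst z" and "y = snd z"
  have zE: "0 < x" "x < k y" "0 < y" "y < h" using z by (auto simp: E_eq x_def y_def)
  define K l r where "K = k y" and "l = left_values \<alpha> \<beta> y" and "r = x / K"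
  have K: "0 < K" "kappa_ext y = K" using zE k_pos kappa_ext_eq by (auto simp: K_def)
  have r: "0 \<le> r" "r \<le> 1" using zE K by (auto simp: r_def K_def)
  have l: "\<bar>l\<bar> \<le> M" unfolding l_def M_def using zE by (intro left_values_le) auto
  have M0: "0 \<le> 2 * M / h" using h_pos by (simp add: M_def)
  have "\<bar>\<alpha> - \<beta>\<bar> \<le> 2 * M" by (auto simp: M_def)
  then have d: "\<bar>(\<alpha> - \<beta>) / h\<bar> \<le> 2 * M / h" using h_pos by (simp add: divide_right_mono)
  have "\<bar>lift \<alpha> \<beta> z\<bar> = \<bar>l\<bar> * (1 - r)" using zE r by (simp add: lift_eq y_def x_def l_def r_def K_def abs_mult)
  also have "\<dots> \<le> M * 1" using l r by (intro mult_mono) auto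
  finally show "\<bar>lift \<alpha> \<beta> z\<bar> \<le> M" by simp
  have g: "grad (lift \<alpha> \<beta>) z = (- l / K, (\<alpha> - \<beta>) / h * (1 - r) - l * slope * r / K)"
    using grad_lift[of z \<alpha> \<beta>] zE by (simp add: y_def x_def l_def r_def K_def power2_eq_square)
  have "\<bar>l / K\<bar> \<le> M / K" using l K by (simp add: divide_right_mono)
  then show "\<bar>grad (lift \<alpha> \<beta>) z \<bullet> (1, 0)\<bar> \<le> M / kappa_ext (snd z)"
    using K by (simp add: g y_def[symmetric])
  have gy: "\<bar>(\<alpha> - \<beta>) / h * (1 - r) - l * slope * r / K\<bar> \<le> 2 * M / h + \<bar>l\<bar> * slope / K"
  proof -
    have "\<bar>(\<alpha> - \<beta>) / h * (1 - r)\<bar> \<le> 2 * M / h * 1"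
      unfolding abs_mult by (intro mult_mono d M0) (use r in auto)
    moreover have "\<bar>l * slope * r / K\<bar> \<le> \<bar>l\<bar> * slope * 1 / K"
      using r slope_ge_0 K by (auto simp: abs_mult intro!: divide_right_mono mult_left_le)
    ultimately show ?thesis by linarith
  qed
  have slh: "slope \<le> e2 / h" using e1 h_pos by (simp add: slope_def divide_right_mono)
  have "\<bar>l\<bar> * slope / K \<le> M * (e2 / h) / K"
    using l slh slope_ge_0 K by (intro divide_right_mono mult_mono) auto
  then show "\<bar>grad (lift \<alpha> \<beta>) z \<bullet> (0, 1)\<bar> \<le> 2 * M / h + M * (e2 / h) / kappa_ext (snd z)"
    using gy K by (simp add: g y_def[symmetric])
  have "\<bar>l\<bar> * slope / K \<le> \<bar>l\<bar> / K"
    using slope_ge_0 slope_le_1 K by (intro divide_right_mono) (auto simp: mult_left_le)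
  with gy have "\<bar>(\<alpha> - \<beta>) / h * (1 - r) - l * slope * r / K\<bar> \<le> 2 * M / h + \<bar>l\<bar> / K" by linarith
  then have "((\<alpha> - \<beta>) / h * (1 - r) - l * slope * r / K)\<^sup>2 \<le> (2 * M / h + \<bar>l\<bar> / K)\<^sup>2"
    by (metis abs_ge_zero power2_abs power_mono)
  also have "\<dots> \<le> 2 * (2 * M / h)\<^sup>2 + 2 * (\<bar>l\<bar> / K)\<^sup>2"
    using norm_add_sq[of "2 * M / h" "\<bar>l\<bar> / K"] by (simp only: real_norm_def power2_abs)
  finally have "(- l / K)\<^sup>2 + ((\<alpha> - \<beta>) / h * (1 - r) - l * slope * r / K)\<^sup>2 \<le> 3 * (l\<^sup>2 / K / K) + 8 * M\<^sup>2 / h\<^sup>2"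
    by (simp add: power_divide power_mult_distrib power2_eq_square)
  then show "(norm (grad (lift \<alpha> \<beta>) z))\<^sup>2 \<le> 3 * (((left_values \<alpha> \<beta> (snd z))\<^sup>2 / kappa_ext (snd z)) / kappa_ext (snd z)) + 8 * M\<^sup>2 / h\<^sup>2"
    unfolding g y_def[symmetric] l_def[symmetric] K(2)
    by (simp only: norm_Pair real_sqrt_pow2 sum_power2_ge_zero real_norm_def power2_abs)
qed

lemma left_values_continuous: "continuous_on A (left_values \<alpha> \<beta>)"
  unfolding left_values_def[abs_def] by (intro continuous_intros)

lemma stab_integrand_continuous: "continuous_on UNIV (\<lambda>y. (left_values \<alpha> \<beta> y)\<^sup>2 / kappa_ext y)"
  using kappa_ext_pos by (intro continuous_intros left_values_continuous kappa_ext_continuous) (auto simp: less_imp_neq[symmetric])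

text \<open>The square of the affine left values integrates to \<open>h * (\<alpha>\<^sup>2 +
  \<alpha> * \<beta> + \<beta>\<^sup>2) / 3\<close>, at least one sixth of \<open>h\<close> times
  the larger square, and the width is at most \<open>e2\<close>. This is how nodal values are
  converted into the stabilization.\<close>

lemma stab_lower: "h * (max \<bar>\<alpha>\<bar> \<bar>\<beta>\<bar>)\<^sup>2 \<le> 6 * e2 * stab \<alpha> \<beta>"
proof -
  define c where "c = (\<alpha> - \<beta>) / h"
  have ch: "c * h = \<alpha> - \<beta>" using h_pos by (simp add: c_def)
  have "(\<integral>y. (left_values \<alpha> \<beta> y)\<^sup>2 \<partial>lebesgue_on {0..h})
      = (\<beta>\<^sup>2 * h + \<beta> * c * h\<^sup>2 + c\<^sup>2 * h ^ 3 / 3) - (\<beta>\<^sup>2 * 0 + \<beta> * c * 0\<^sup>2 + c\<^sup>2 * 0 ^ 3 / 3)"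
    using h_pos unfolding left_values_def c_def[symmetric]
    by (intro lebesgue_on_FTC) (auto intro!: derivative_eq_intros continuous_intros simp: power2_eq_square algebra_simps)
  also have "\<dots> = h * (\<beta>\<^sup>2 + \<beta> * (c * h) + (c * h)\<^sup>2 / 3)"
    by (simp add: power2_eq_square power3_eq_cube algebra_simps)
  also have "\<dots> = h * (\<alpha>\<^sup>2 + \<alpha> * \<beta> + \<beta>\<^sup>2) / 3"
    unfolding ch by (simp add: power2_eq_square field_simps)
  finally have I: "(\<integral>y. (left_values \<alpha> \<beta> y)\<^sup>2 \<partial>lebesgue_on {0..h}) = h * (\<alpha>\<^sup>2 + \<alpha> * \<beta> + \<beta>\<^sup>2) / 3" .
  have "(max \<bar>\<alpha>\<bar> \<bar>\<beta>\<bar>)\<^sup>2 \<le> 2 * (\<alpha>\<^sup>2 + \<alpha> * \<beta> + \<beta>\<^sup>2)"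
  proof -
    have "0 \<le> (\<alpha> + \<beta>)\<^sup>2" by simp
    then have "\<alpha>\<^sup>2 + \<beta>\<^sup>2 \<le> 2 * (\<alpha>\<^sup>2 + \<alpha> * \<beta> + \<beta>\<^sup>2)" by (simp add: power2_eq_square algebra_simps)
    moreover have "(max \<bar>\<alpha>\<bar> \<bar>\<beta>\<bar>)\<^sup>2 \<le> \<alpha>\<^sup>2 + \<beta>\<^sup>2" by (auto simp: max_def)
    ultimately show ?thesis by linarith
  qed
  then have "h * (max \<bar>\<alpha>\<bar> \<bar>\<beta>\<bar>)\<^sup>2 \<le> h * (2 * (\<alpha>\<^sup>2 + \<alpha> * \<beta> + \<beta>\<^sup>2))"
    using h_pos by (intro mult_left_mono) auto
  also have "\<dots> = 6 * (\<integral>y. (left_values \<alpha> \<beta> y)\<^sup>2 \<partial>lebesgue_on {0..h})" unfolding I by simp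
  also have "(\<integral>y. (left_values \<alpha> \<beta> y)\<^sup>2 \<partial>lebesgue_on {0..h}) \<le> (\<integral>y. e2 * ((left_values \<alpha> \<beta> y)\<^sup>2 / kappa_ext y) \<partial>lebesgue_on {0..h})"
  proof (rule integral_mono)
    have fin: "finite_measure (lebesgue_on {0..h})" by (rule finite_measure_lebesgue_on_bounded) auto
    show "integrable (lebesgue_on {0..h}) (\<lambda>y. (left_values \<alpha> \<beta> y)\<^sup>2)"
      by (intro square_integrable_integrable[OF fin] square_integrable_continuous continuous_intros left_values_continuous) auto
    show "integrable (lebesgue_on {0..h}) (\<lambda>y. e2 * ((left_values \<alpha> \<beta> y)\<^sup>2 / kappa_ext y))"
      by (intro square_integrable_integrable[OF fin] square_integrable_continuous continuous_on_mult continuous_on_const stab_integrand_continuous) auto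
    fix y assume "y \<in> space (lebesgue_on {0..h})"
    then have y: "0 \<le> y" "y \<le> h" by (auto simp: space_restrict_space)
    have "kappa_ext y \<le> e2" using y by (simp add: kappa_ext_eq k_le)
    then have "kappa_ext y * (left_values \<alpha> \<beta> y)\<^sup>2 \<le> e2 * (left_values \<alpha> \<beta> y)\<^sup>2" by (intro mult_right_mono) auto
    then show "(left_values \<alpha> \<beta> y)\<^sup>2 \<le> e2 * ((left_values \<alpha> \<beta> y)\<^sup>2 / kappa_ext y)"
      using kappa_ext_pos[of y] by (simp add: field_simps)
  qed
  also have "\<dots> = e2 * stab \<alpha> \<beta>" unfolding stab_def integral_mult_right_zero ..
  finally show ?thesis by simp
qed

lemma E_integrable_continuous:
  fixes f :: "pt \<Rightarrow> real"
  assumes "continuous_on UNIV f" shows "integrable (lebesgue_on E) f"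
  by (rule square_integrable_integrable[OF finite_measure_lebesgue_on_bounded[OF bounded_E E_lebesgue]
        square_integrable_continuous[OF assms bounded_E E_lebesgue]])

lemma inverse_kappa_ext_integrable: "integrable (lebesgue_on E) (\<lambda>z. 1 / kappa_ext (snd z))"
  using kappa_ext_pos by (intro E_integrable_continuous continuous_intros continuous_on_compose2[OF kappa_ext_continuous])
    (auto simp: less_imp_neq[symmetric])

lemma inverse_kappa_ext_integral: "(\<integral>z. 1 / kappa_ext (snd z) \<partial>lebesgue_on E) = h"
  using E_integral_slice[of "\<lambda>_. 1"] h_pos by (simp add: measure_restrict_space)

lemma area_le: "(\<integral>z. 1 \<partial>lebesgue_on E) \<le> e2 * h"
proof -
  have "e1 * h \<le> e2 * h" using e12 h_pos by (intro mult_right_mono) auto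
  then show ?thesis unfolding area_E by (simp add: algebra_simps)
qed

text \<open>By slicing, the first part of the bound in \<open>lift_bounds\<close> integrates to
  exactly 3 times \<open>stab\<close>. The difference of the nodal values contributes at most
  \<open>8 * (e2 / h) * M\<^sup>2\<close>, which is at most 48 times \<open>stab\<close> because
  \<open>e2 / h \<le> h / e2\<close>; 51 = 3 + 48.\<close>

lemma lift_energy: "(\<integral>z. (norm (grad (lift \<alpha> \<beta>) z))\<^sup>2 \<partial>lebesgue_on E) \<le> 51 * stab \<alpha> \<beta>"
proof -
  define M where "M = max \<bar>\<alpha>\<bar> \<bar>\<beta>\<bar>"
  define q where "q y = (left_values \<alpha> \<beta> y)\<^sup>2 / kappa_ext y" for y
  have qc: "continuous_on UNIV q" unfolding q_def[abs_def] by (rule stab_integrand_continuous)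
  have q0: "0 \<le> q y" for y using kappa_ext_pos[of y] by (simp add: q_def)
  have iq: "integrable (lebesgue_on E) (\<lambda>z. q (snd z) / kappa_ext (snd z))"
    using kappa_ext_pos by (intro E_integrable_continuous continuous_intros continuous_on_compose2[OF kappa_ext_continuous]
        continuous_on_compose2[OF qc]) (auto simp: less_imp_neq[symmetric])
  have i1: "integrable (lebesgue_on E) (\<lambda>z. 8 * M\<^sup>2 / h\<^sup>2 * 1)"
    by (intro E_integrable_continuous continuous_intros)
  have "(\<integral>z. (norm (grad (lift \<alpha> \<beta>) z))\<^sup>2 \<partial>lebesgue_on E)
      \<le> (\<integral>z. 3 * (q (snd z) / kappa_ext (snd z)) + 8 * M\<^sup>2 / h\<^sup>2 * 1 \<partial>lebesgue_on E)"
  proof (rule integral_mono)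
    show "integrable (lebesgue_on E) (\<lambda>z. (norm (grad (lift \<alpha> \<beta>) z))\<^sup>2)"
      using square_integrable_grad[OF smooth_lift] by (simp add: square_integrable_def)
    show "integrable (lebesgue_on E) (\<lambda>z. 3 * (q (snd z) / kappa_ext (snd z)) + 8 * M\<^sup>2 / h\<^sup>2 * 1)"
      by (rule Bochner_Integration.integrable_add[OF integrable_mult_right[OF iq] i1])
    fix z assume "z \<in> space (lebesgue_on E)"
    then show "(norm (grad (lift \<alpha> \<beta>) z))\<^sup>2 \<le> 3 * (q (snd z) / kappa_ext (snd z)) + 8 * M\<^sup>2 / h\<^sup>2 * 1"
      using lift_bounds(2)[of z \<alpha> \<beta>] by (simp add: space_restrict_space q_def M_def)
  qed
  also have "\<dots> = 3 * (\<integral>z. q (snd z) / kappa_ext (snd z) \<partial>lebesgue_on E) + 8 * M\<^sup>2 / h\<^sup>2 * (\<integral>z. 1 \<partial>lebesgue_on E)"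
    unfolding Bochner_Integration.integral_add[OF integrable_mult_right[OF iq] i1] integral_mult_right_zero ..
  also have "(\<integral>z. q (snd z) / kappa_ext (snd z) \<partial>lebesgue_on E) = stab \<alpha> \<beta>"
    using E_integral_slice[OF qc q0] by (simp only: stab_def q_def[abs_def])
  also have "8 * M\<^sup>2 / h\<^sup>2 * (\<integral>z. 1 \<partial>lebesgue_on E) \<le> 8 * M\<^sup>2 / h\<^sup>2 * (e2 * h)"
    by (intro mult_left_mono area_le) simp
  also have "8 * M\<^sup>2 / h\<^sup>2 * (e2 * h) = 8 * (e2 / h * M\<^sup>2)"
    using h_pos by (simp add: power2_eq_square field_simps)
  also have "e2 / h * M\<^sup>2 \<le> 6 * stab \<alpha> \<beta>"
  proof -
    have "e2 / h * M\<^sup>2 \<le> h / e2 * M\<^sup>2"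
    proof (rule mult_right_mono)
      have "e2 / h \<le> 1" "1 \<le> h / e2" using e2h e2_pos h_pos by simp_all
      then show "e2 / h \<le> h / e2" by linarith
    qed simp
    also have "\<dots> \<le> 6 * stab \<alpha> \<beta>"
      using stab_lower[of \<alpha> \<beta>] e2_pos unfolding M_def by (simp add: field_simps)
    finally show ?thesis .
  qed
  finally show ?thesis by simp
qed

text \<open>The inverse width integrates to \<open>h\<close> over the element. Dividing by an area
  of order \<open>e2 * h\<close> gives, for nodal values of size \<open>m\<close>, a mean gradient
  of order \<open>m / e2\<close> horizontally and \<open>m / h\<close> vertically, so its variation
  across the element is of order \<open>m\<close>. With \<open>slope \<le> 1\<close> alone the
  vertical bound would be too large by a factor \<open>h / e2\<close>.\<close>

lemma lift_grad_mean:
  defines "M \<alpha> \<beta> \<equiv> max \<bar>\<alpha>\<bar> \<bar>\<beta>\<bar>"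
  shows "\<bar>\<integral>z. grad (lift \<alpha> \<beta>) z \<bullet> (1, 0) \<partial>lebesgue_on E\<bar> \<le> M \<alpha> \<beta> * h"
    "\<bar>\<integral>z. grad (lift \<alpha> \<beta>) z \<bullet> (0, 1) \<partial>lebesgue_on E\<bar> \<le> 3 * M \<alpha> \<beta> * e2"
proof -
  let ?M = "lebesgue_on E"
  define m where "m = M \<alpha> \<beta>"
  have m0: "0 \<le> m" by (simp add: m_def M_def)
  have gc: "continuous_on UNIV (grad (lift \<alpha> \<beta>))" by (rule smooth_grad_continuous[OF smooth_lift])
  have i: "integrable ?M (\<lambda>z. \<bar>grad (lift \<alpha> \<beta>) z \<bullet> e\<bar>)" for e
    by (intro E_integrable_continuous continuous_intros gc)
  have i1: "integrable ?M (\<lambda>z. c * (1::real))" for c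
    by (intro E_integrable_continuous continuous_intros)
  have "\<bar>\<integral>z. grad (lift \<alpha> \<beta>) z \<bullet> (1, 0) \<partial>?M\<bar> \<le> (\<integral>z. \<bar>grad (lift \<alpha> \<beta>) z \<bullet> (1, 0)\<bar> \<partial>?M)"
    by (rule integral_abs_bound)
  also have "\<dots> \<le> (\<integral>z. m * (1 / kappa_ext (snd z)) \<partial>?M)"
    by (rule integral_mono[OF i integrable_mult_right[OF inverse_kappa_ext_integrable]])
      (use lift_bounds(3)[of _ \<alpha> \<beta>] in \<open>simp add: space_restrict_space m_def M_def\<close>)
  also have "\<dots> = m * h" by (simp only: integral_mult_right_zero inverse_kappa_ext_integral)
  finally show "\<bar>\<integral>z. grad (lift \<alpha> \<beta>) z \<bullet> (1, 0) \<partial>?M\<bar> \<le> M \<alpha> \<beta> * h" by (simp add: m_def)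
  have "\<bar>\<integral>z. grad (lift \<alpha> \<beta>) z \<bullet> (0, 1) \<partial>?M\<bar> \<le> (\<integral>z. \<bar>grad (lift \<alpha> \<beta>) z \<bullet> (0, 1)\<bar> \<partial>?M)"
    by (rule integral_abs_bound)
  also have "\<dots> \<le> (\<integral>z. 2 * m / h * 1 + m * (e2 / h) * (1 / kappa_ext (snd z)) \<partial>?M)"
    by (rule integral_mono[OF i Bochner_Integration.integrable_add[OF i1 integrable_mult_right[OF inverse_kappa_ext_integrable]]])
      (use lift_bounds(4)[of _ \<alpha> \<beta>] in \<open>simp add: space_restrict_space m_def M_def\<close>)
  also have "\<dots> = 2 * m / h * (\<integral>z. 1 \<partial>?M) + m * (e2 / h) * h"
    by (subst Bochner_Integration.integral_add[OF i1 integrable_mult_right[OF inverse_kappa_ext_integrable]])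
      (simp only: integral_mult_right_zero inverse_kappa_ext_integral)
  also have "\<dots> \<le> 2 * m / h * (e2 * h) + m * (e2 / h) * h"
    using m0 h_pos by (intro add_right_mono mult_left_mono area_le) auto
  also have "\<dots> = 3 * m * e2" using h_pos by simp
  finally show "\<bar>\<integral>z. grad (lift \<alpha> \<beta>) z \<bullet> (0, 1) \<partial>?M\<bar> \<le> 3 * M \<alpha> \<beta> * e2" by (simp add: m_def)
qed

section \<open>Boundary values and the stabilization form\<close>

lemma B_bdry_edge:
  assumes "g \<in> B_bdry vs" "(a, b) \<in> edges vs" "t \<in> {0..1}"
  shows "g (linepath a b t) = (1 - t) * g a + t * g b"
proof -
  obtain p where p: "p \<in> P1" "\<forall>z\<in>closed_segment a b. g z = p z"
    using assms(1,2) unfolding B_bdry_def by blast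
  obtain c w where w: "p = (\<lambda>z. c + w \<bullet> z)" using p(1) unfolding P1_def by blast
  have "linepath a b t \<in> closed_segment a b"
    using assms(3) linepath_image_01 by blast
  then have "g (linepath a b t) = p (linepath a b t)" "g a = p a" "g b = p b" using p(2) by auto
  then show ?thesis by (simp add: w linepath_def inner_add_right algebra_simps)
qed

lemma boundary_values_lift:
  assumes g: "g \<in> B_bdry vs" and z: "g (e2, 0) = 0" "g (e1, h) = 0"
    and ab: "(a, b) \<in> edges vs" and t: "t \<in> {0..1}"
  shows "g (linepath a b t) = lift (g (0, h)) (g (0, 0)) (linepath a b t)"
proof -
  define A B where "A = g (0, h)" and "B = g (0, 0)"
  note le = B_bdry_edge[OF g ab t]
  have k0: "kappa h e1 e2 0 = e2" "kappa h e1 e2 h = e1" using h_pos by (simp_all add: kappa_def)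
  have kp: "0 < k (t * h)" using t h_pos by (intro k_pos) (auto simp: mult_left_le_one_le)
  consider "(a, b) = ((0, h), (0, 0))" | "(a, b) = ((0, 0), (e2, 0))" | "(a, b) = ((e2, 0), (e1, h))"
    | "(a, b) = ((e1, h), (0, h))"
    using ab unfolding edges_quad by blast
  then have "g (linepath a b t) = lift A B (linepath a b t)"
  proof cases
    case 1
    then have ab': "a = (0, h)" "b = (0, 0)" by auto
    have p: "linepath (0, h) (0, 0) t = (0, (1 - t) * h)" by (simp add: linepath_def algebra_simps)
    have "(1 - t) * h \<le> h" using t h_pos by (simp add: mult_left_le_one_le)
    then have "lift A B (0, (1 - t) * h) = B + (A - B) / h * ((1 - t) * h)" by (simp add: lift_eq left_values_def)
    also have "\<dots> = (1 - t) * A + t * B" using h_pos by (simp add: field_simps)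
    finally show ?thesis using le unfolding ab' p by (simp add: A_def B_def)
  next
    case 2
    then have ab': "a = (0, 0)" "b = (e2, 0)" by auto
    have p: "linepath (0, 0) (e2, 0) t = (t * e2, 0)" by (simp add: linepath_def)
    have "lift A B (t * e2, 0) = (1 - t) * B" using h_pos e2_pos by (simp add: lift_eq left_values_def k0)
    then show ?thesis using le z unfolding ab' p by (simp add: B_def)
  next
    case 3
    then have ab': "a = (e2, 0)" "b = (e1, h)" by auto
    have p: "linepath (e2, 0) (e1, h) t = (k (t * h), t * h)"
      unfolding linepath_def k_scale by (simp add: algebra_simps)
    have "t * h \<le> h" using t h_pos by (simp add: mult_left_le_one_le)
    then have "lift A B (k (t * h), t * h) = 0" using kp by (simp add: lift_eq)
    then show ?thesis using le z unfolding ab' p by simp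
  next
    case 4
    then have ab': "a = (e1, h)" "b = (0, h)" by auto
    have p: "linepath (e1, h) (0, h) t = ((1 - t) * e1, h)" by (simp add: linepath_def algebra_simps)
    have "lift A B ((1 - t) * e1, h) = t * A" using h_pos e1 by (simp add: lift_eq left_values_def k0)
    then show ?thesis using le z unfolding ab' p by (simp add: A_def)
  qed
  then show ?thesis by (simp add: A_def B_def)
qed

text \<open>An affine function that vanishes at two distinct parameters vanishes at both ends. Such
  parameters exist because the chosen trace vanishes, and agrees with \<open>g\<close>, off null
  sets, and a null set with one further point cannot exhaust the unit interval.\<close>

lemma trace_zero_on_slanted_edge:
  assumes v: "v \<in> H1 E" and g: "g \<in> B_bdry vs" "is_trace vs v g"
    and z: "AE t in lebesgue_on {0..1}. tr vs v (linepath (e1, h) (e2, 0) t) = 0"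
  shows "g (e2, 0) = 0" "g (e1, h) = 0"
proof -
  have ab: "((e2, 0), (e1, h)) \<in> edges vs" by (simp add: edges_quad)
  obtain N1 where N1: "negligible N1"
    "\<And>t. t \<in> {0..1} \<Longrightarrow> t \<notin> N1 \<Longrightarrow> g (linepath (e2, 0) (e1, h) t) = tr vs v (linepath (e2, 0) (e1, h) t)"
    using AE_lebesgue_onE[OF is_trace_unique[OF v g(2) is_trace_tr[OF g(2)] ab]] by auto
  obtain N2 where N2: "negligible N2"
    "\<And>t. t \<in> {0..1} \<Longrightarrow> t \<notin> N2 \<Longrightarrow> tr vs v (linepath (e1, h) (e2, 0) t) = 0"
    using AE_lebesgue_onE[OF z] by auto
  \<comment> \<open>The hypothesis runs along the edge from \<open>(e1, h)\<close>, whereas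
    \<open>edges\<close> starts at \<open>(e2, 0)\<close>; the reflection of the parameter
    reconciles the two.\<close>
  define N where "N = N1 \<union> (\<lambda>t. 1 + (-1) * t) ` N2"
  have N: "negligible N" unfolding N_def by (intro negligible_Un N1 negligible_affine_image N2)
  have g0: "g (linepath (e2, 0) (e1, h) t) = 0" if "t \<in> {0..1}" "t \<notin> N" for t
  proof -
    have "1 - t \<notin> N2"
    proof
      assume "1 - t \<in> N2"
      then have "1 + (-1) * (1 - t) \<in> (\<lambda>t. 1 + (-1) * t) ` N2" by (rule imageI)
      then show False using that by (simp add: N_def)
    qed
    then have "tr vs v (linepath (e1, h) (e2, 0) (1 - t)) = 0" using N2(2) that by auto
    moreover have "linepath (e1, h) (e2, 0) (1 - t) = linepath (e2, 0) (e1, h) t"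
      by (simp add: linepath_def)
    ultimately show ?thesis using N1(2) that by (simp add: N_def)
  qed
  have ex: "\<exists>t. t \<in> {0..1} \<and> t \<notin> N \<and> t \<noteq> u" for u :: real
  proof (rule ccontr)
    assume "\<not> ?thesis"
    then have "{0..1} \<subseteq> insert u N" by auto
    moreover have "negligible (insert u N)" using N by simp
    ultimately have "negligible {0..1::real}" using negligible_subset by blast
    then show False using negligible_iff_measure0[of "{0..1::real}"] negligible_iff_emeasure0[of "{0..1::real}"] by simp
  qed
  obtain t where t: "t \<in> {0..1}" "t \<notin> N" using ex by blast
  obtain u where u: "u \<in> {0..1}" "u \<notin> N" "u \<noteq> t" using ex by blast
  have a: "(1 - t) * g (e2, 0) + t * g (e1, h) = 0" "(1 - u) * g (e2, 0) + u * g (e1, h) = 0"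
    using B_bdry_edge[OF g(1) ab t(1)] B_bdry_edge[OF g(1) ab u(1)] g0[OF t] g0[OF u(1,2)] by simp_all
  define X Y where "X = g (e2, 0)" and "Y = g (e1, h)"
  have "X + t * (Y - X) = 0" "X + u * (Y - X) = 0" using a by (simp_all add: X_def Y_def algebra_simps)
  then have "t * (Y - X) = u * (Y - X)" by linarith
  then have "Y = X" using u by simp
  with a show "g (e2, 0) = 0" "g (e1, h) = 0" by (simp_all add: X_def Y_def algebra_simps)
qed

text \<open>On the left edge the chosen trace equals the affine function almost everywhere. The edge
  parameter runs downwards, \<open>y = h - h * t\<close>, an affine map that keeps null sets null,
  and changing the integrand on a null set leaves the integral alone.\<close>

lemma s_E_eq_stab:
  assumes v: "v \<in> H1 E" and g: "g \<in> B_bdry vs" "is_trace vs v g"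
  shows "s_E h e1 e2 v v = stab (g (0, h)) (g (0, 0))"
proof -
  have ab: "((0, h), (0, 0)) \<in> edges vs" by (simp add: edges_quad)
  obtain N1 where N1: "negligible N1"
    "\<And>t. t \<in> {0..1} \<Longrightarrow> t \<notin> N1 \<Longrightarrow> g (linepath (0, h) (0, 0) t) = tr vs v (linepath (0, h) (0, 0) t)"
    using AE_lebesgue_onE[OF is_trace_unique[OF v g(2) is_trace_tr[OF g(2)] ab]] by auto
  define N where "N = (\<lambda>t. h + (- h) * t) ` N1"
  have N: "negligible N" unfolding N_def by (rule negligible_affine_image[OF N1(1)])
  define q where "q y = (left_values (g (0, h)) (g (0, 0)) y)\<^sup>2 / kappa_ext y" for y
  define r where "r y = tr vs v (0, y) * tr vs v (0, y) / k y" for y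
  have eq: "r y = q y" if y: "y \<in> {0..h} - N" for y
  proof -
    define t where "t = 1 - y / h"
    have t: "t \<in> {0..1}" using y h_pos by (auto simp: t_def)
    have ty: "y = h + (- h) * t" using h_pos by (simp add: t_def field_simps)
    then have "t \<notin> N1" using y by (auto simp: N_def)
    have p: "linepath (0, h) (0, 0) t = (0, y)" by (simp add: linepath_def ty algebra_simps)
    have "tr vs v (0, y) = g (0, y)" using N1(2)[OF t \<open>t \<notin> N1\<close>] by (simp add: p)
    also have "\<dots> = left_values (g (0, h)) (g (0, 0)) y"
    proof -
      have "left_values A B (h + (- h) * t) = (1 - t) * A + t * B" for A B
        using h_pos by (simp add: left_values_def field_simps)
      then show ?thesis using B_bdry_edge[OF g(1) ab t] unfolding p ty by simp
    qed
    finally show ?thesis using y by (simp add: r_def q_def kappa_ext_eq power2_eq_square)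
  qed
  have qa: "q absolutely_integrable_on {0..h}"
    by (rule absolutely_integrable_continuous_real)
      (use stab_integrand_continuous in \<open>auto simp: q_def[abs_def] intro: continuous_on_subset\<close>)
  then have ra: "r absolutely_integrable_on {0..h}"
    by (rule absolutely_integrable_spike[OF _ N]) (use eq in auto)
  have "s_E h e1 e2 v v = (LINT y:{0..h}|lebesgue. r y)"
    by (simp add: s_E_def r_def)
  also have "\<dots> = integral {0..h} r" by (rule set_lebesgue_integral_eq_integral(2)[OF ra])
  also have "\<dots> = integral {0..h} q" by (rule integral_spike[OF N]) (use eq in auto)
  also have "\<dots> = (LINT y:{0..h}|lebesgue. q y)" by (rule set_lebesgue_integral_eq_integral(2)[OF qa, symmetric])
  finally show ?thesis by (simp add: stab_def q_def LINT_restrict)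
qed

lemma edge_int_cong_trace:
  assumes v: "v \<in> H1 E" and g: "is_trace vs v g" and ab: "(a, b) \<in> edges vs" and f: "continuous_on UNIV f"
  shows "edge_int a b (\<lambda>z. tr vs v z - f z) = edge_int a b g - edge_int a b f"
proof -
  let ?N = "lebesgue_on {0..1::real}"
  have fin: "finite_measure ?N" by (rule finite_measure_lebesgue_on_bounded) auto
  have sf: "square_integrable ?N (\<lambda>t. f (linepath a b t))"
    by (rule square_integrable_continuous) (auto simp: linepath_def intro!: continuous_intros continuous_on_compose2[OF f])
  have sg: "square_integrable ?N (\<lambda>t. g (linepath a b t))" "square_integrable ?N (\<lambda>t. tr vs v (linepath a b t))"
    by (rule is_trace_square_integrable[OF g ab] is_trace_square_integrable[OF is_trace_tr[OF g] ab])+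
  have "edge_int a b (\<lambda>z. tr vs v z - f z) = (\<integral>t. g (linepath a b t) - f (linepath a b t) \<partial>?N)"
    unfolding edge_int_def
  proof (rule integral_cong_AE)
    show "AE t in ?N. tr vs v (linepath a b t) - f (linepath a b t) = g (linepath a b t) - f (linepath a b t)"
      using is_trace_unique[OF v g is_trace_tr[OF g] ab] by eventually_elim simp
  qed (use sf sg in \<open>auto simp: square_integrable_def\<close>)
  also have "\<dots> = edge_int a b g - edge_int a b f"
    unfolding edge_int_def
    by (intro Bochner_Integration.integral_diff square_integrable_integrable[OF fin] sf sg)
  finally show ?thesis .
qed

end

section \<open>A bump function\<close>

lemma integrable_lborel_support:
  fixes f :: "'a::euclidean_space \<Rightarrow> real"
  assumes c: "continuous_on UNIV f" and S: "bounded S" "S \<in> sets lebesgue" and z: "\<And>x. x \<notin> S \<Longrightarrow> f x = 0"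
  shows "integrable lborel f" "(\<integral>x. f x \<partial>lborel) = (\<integral>x. f x \<partial>lebesgue_on S)"
proof -
  have m: "f \<in> borel_measurable lborel" using borel_measurable_continuous_onI[OF c] by simp
  have i: "integrable (lebesgue_on S) f"
    by (rule square_integrable_integrable[OF finite_measure_lebesgue_on_bounded[OF S] square_integrable_continuous[OF c S]])
  have eq: "(\<lambda>x. indicator S x *\<^sub>R f x) = f" using z by (auto simp: indicator_def fun_eq_iff)
  have "integrable lebesgue (\<lambda>x. indicator S x *\<^sub>R f x)"
    using i S(2) by (subst (asm) integrable_restrict_space) auto
  then have "integrable lebesgue f" unfolding eq .
  then show "integrable lborel f" using integrable_completion[OF m] by simp
  have "(\<integral>x. f x \<partial>lebesgue_on S) = (\<integral>x. indicator S x *\<^sub>R f x \<partial>lebesgue)"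
    using S(2) by (simp add: integral_restrict_space)
  also have "\<dots> = (\<integral>x. f x \<partial>lborel)"
    unfolding eq by (rule integral_completion[OF m])
  finally show "(\<integral>x. f x \<partial>lborel) = (\<integral>x. f x \<partial>lebesgue_on S)" by simp
qed

text \<open>For \<open>t\<close> strictly between -1 and 1 this is
  \<open>exp (- 2 / (1 - t\<^sup>2))\<close>. It is even, which makes odd moments vanish.\<close>

definition bump :: "real \<Rightarrow> real" where
  "bump t = flat 0 (1 + (-1) * t) * flat 0 (1 + 1 * t)"

lemma Ck1_bump: "Ck1 k bump"
  unfolding bump_def[abs_def] by (intro Ck1_mult Ck1_comp_affine Ck1_flat)

lemma bump_0: "1 \<le> \<bar>t\<bar> \<Longrightarrow> bump t = 0"
  by (auto simp: bump_def flat_def abs_if split: if_splits)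

lemma bump_nonneg: "0 \<le> bump t"
  unfolding bump_def by (intro mult_nonneg_nonneg flat_nonneg)

lemma bump_pos: "\<bar>t\<bar> < 1 \<Longrightarrow> 0 < bump t"
  unfolding bump_def by (intro mult_pos_pos flat_pos) auto

lemma bump_even: "bump (- t) = bump t"
  by (simp add: bump_def mult.commute)

lemma bump_continuous: "continuous_on A bump"
  using Ck1_continuous[OF Ck1_bump] continuous_on_subset by blast

text \<open>The radius 6 accommodates the rescaled coordinates of the element, which run from -2 to
  6.\<close>

lemma bump_deriv:
  obtains bump' B where "\<And>x. (bump has_real_derivative bump' x) (at x)"
    "\<And>x. \<bar>bump x\<bar> \<le> B" "\<And>x. \<bar>x\<bar> \<le> 6 \<Longrightarrow> \<bar>bump' x\<bar> \<le> B" "0 \<le> B"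
proof -
  obtain s' where d: "\<And>x. (bump has_real_derivative s' x) (at x)" and c: "Ck1 0 s'"
    using Ck1_bump[of "Suc 0"] by (blast elim!: Ck1_SucE)
  have c': "continuous_on UNIV s'" using c by simp
  obtain B1 where B1: "B1 > 0" "\<And>x. x \<in> {-6..6} \<Longrightarrow> norm (s' x) \<le> B1"
    using continuous_bounded_on_bounded[OF c', of "{-6..6}"] by auto
  obtain B2 where B2: "B2 > 0" "\<And>x. x \<in> {-6..6} \<Longrightarrow> norm (bump x) \<le> B2"
    using continuous_bounded_on_bounded[OF bump_continuous, of "{-6..6}"] by auto
  have "\<bar>bump x\<bar> \<le> B1 + B2" for x
    using B1(1) B2(1) B2(2)[of x] bump_0[of x] by (cases "x \<in> {-6..6}") auto
  moreover have "\<bar>s' x\<bar> \<le> B1 + B2" if "\<bar>x\<bar> \<le> 6" for x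
    using B1(2)[of x] B2(1) that by (auto simp: abs_le_iff)
  ultimately show ?thesis using that[OF d, of "B1 + B2"] B1(1) B2(1) by simp
qed

section \<open>Moments of the bump function\<close>

definition bmoment :: "nat \<Rightarrow> real" where
  "bmoment i = (\<integral>t. bump t * t ^ i \<partial>lborel)"

lemma bump_power_integrable: "integrable lborel (\<lambda>t. bump t * t ^ i)"
  by (rule integrable_lborel_support(1)[of _ "{-1..1}"])
    (auto intro!: continuous_intros bump_continuous bump_0)

lemma bmoment_odd: "bmoment 1 = 0"
proof -
  have "bmoment 1 = \<bar>-1\<bar> *\<^sub>R (\<integral>t. bump (0 + -1 * t) * (0 + -1 * t) ^ 1 \<partial>lborel)"
    unfolding bmoment_def by (rule lborel_integral_real_affine) simp
  also have "\<dots> = - bmoment 1" by (simp add: bump_even bmoment_def)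
  finally show ?thesis by simp
qed

lemma bmoment_pos:
  assumes "even i" shows "0 < bmoment i"
proof -
  have nn: "0 \<le> bump t * t ^ i" for t using assms bump_nonneg by (simp add: zero_le_even_power)
  have "bmoment i \<noteq> 0"
  proof
    assume "bmoment i = 0"
    then have "AE t in lborel. bump t * t ^ i = 0"
      unfolding bmoment_def using integral_nonneg_eq_0_iff_AE[OF bump_power_integrable, of i] nn by simp
    moreover have "t \<notin> {0<..<1}" if "bump t * t ^ i = 0" for t :: real
    proof
      assume "t \<in> {0<..<1}"
      then have "0 < bump t * t ^ i" by (auto intro!: mult_pos_pos bump_pos zero_less_power)
      with that show False by (metis less_irrefl)
    qed
    ultimately have "AE t in lborel. t \<notin> {0<..<1::real}"
      by (rule eventually_mono)
    then have "emeasure lborel {0<..<1::real} = 0"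
      by (simp add: AE_iff_null_sets null_setsD1)
    then show False by simp
  qed
  moreover have "0 \<le> bmoment i" unfolding bmoment_def using nn by (intro Bochner_Integration.integral_nonneg) auto
  ultimately show ?thesis by simp
qed

text \<open>The mixed term is odd and drops out. The coefficients \<open>A\<close> and
  \<open>D\<close> are kept general so that the formula can be applied in one variable and again, to
  its own outcome, in the other.\<close>

lemma bmoment_quadratic:
  "(\<integral>t. bump t * ((u + c * t)\<^sup>2 * A + D) \<partial>lborel) = (u\<^sup>2 * A + D) * bmoment 0 + c\<^sup>2 * A * bmoment 2"
proof -
  have "(\<lambda>t. bump t * ((u + c * t)\<^sup>2 * A + D))
      = (\<lambda>t. (u\<^sup>2 * A + D) * (bump t * t ^ 0) + 2 * u * c * A * (bump t * t ^ 1) + c\<^sup>2 * A * (bump t * t ^ 2))"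
    by (auto simp: power2_eq_square algebra_simps)
  then show ?thesis
    using bump_power_integrable[of 0] bump_power_integrable[of 1] bump_power_integrable[of 2] bmoment_odd
    by (simp add: bmoment_def)
qed

text \<open>Rescaling maps the box with centre \<open>(e / 4, h / 4)\<close> and half-sides
  \<open>e / 8\<close>, \<open>h / 8\<close> to the square between -1 and 1. There 1 and the two
  coordinates are orthogonal for the bump weight, so the square of an affine function has a
  diagonal, hence coercive, integral; \<open>e * h / 64\<close> is the Jacobian.\<close>

lemma bump_box_integral:
  fixes h e a c1 c2 :: real
  assumes hs: "0 < h" "0 < e"
  defines "F \<equiv> (\<lambda>z::pt. bump (8 * fst z / e - 2) * bump (8 * snd z / h - 2)
      * (a + c1 * (8 * fst z / e - 2) + c2 * (8 * snd z / h - 2))\<^sup>2)"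
  assumes F: "integrable lborel F"
  shows "(\<integral>z. F z \<partial>lborel) = e * h / 64 * (bmoment 0 * bmoment 0 * a\<^sup>2 + bmoment 0 * bmoment 2 * (c1\<^sup>2 + c2\<^sup>2))"
proof -
  have "(\<integral>z. F z \<partial>lborel) = (\<integral>x. (\<integral>y. F (x, y) \<partial>lborel) \<partial>lborel)"
    using lborel_pair.integral_fst'[of F] F by (simp add: lborel_prod)
  also have "(\<lambda>x. \<integral>y. F (x, y) \<partial>lborel) = (\<lambda>x. h / 8 * (bump (8 * x / e - 2)
      * ((a + c1 * (8 * x / e - 2))\<^sup>2 * bmoment 0 + c2\<^sup>2 * bmoment 2)))"
  proof
    fix x
    define X where "X = 8 * x / e - 2"
    have "(\<integral>y. F (x, y) \<partial>lborel) = \<bar>h / 8\<bar> *\<^sub>R (\<integral>t. F (x, h / 4 + h / 8 * t) \<partial>lborel)"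
      by (rule lborel_integral_real_affine) (use hs in simp)
    also have "(\<lambda>t. F (x, h / 4 + h / 8 * t)) = (\<lambda>t. bump X * (bump t * (((a + c1 * X) + c2 * t)\<^sup>2 * 1 + 0)))"
    proof
      fix t
      have "8 * (h / 4 + h / 8 * t) / h - 2 = t" using hs by (simp add: field_simps)
      then show "F (x, h / 4 + h / 8 * t) = bump X * (bump t * (((a + c1 * X) + c2 * t)\<^sup>2 * 1 + 0))"
        by (simp add: F_def X_def mult.assoc)
    qed
    also have "\<bar>h / 8\<bar> *\<^sub>R (\<integral>t. bump X * (bump t * (((a + c1 * X) + c2 * t)\<^sup>2 * 1 + 0)) \<partial>lborel)
        = h / 8 * (bump X * ((a + c1 * X)\<^sup>2 * bmoment 0 + c2\<^sup>2 * bmoment 2))"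
      unfolding integral_mult_right_zero bmoment_quadratic using hs by simp
    finally show "(\<integral>y. F (x, y) \<partial>lborel) = h / 8 * (bump (8 * x / e - 2)
      * ((a + c1 * (8 * x / e - 2))\<^sup>2 * bmoment 0 + c2\<^sup>2 * bmoment 2))" by (simp add: X_def)
  qed
  also have "(\<integral>x. h / 8 * (bump (8 * x / e - 2)
      * ((a + c1 * (8 * x / e - 2))\<^sup>2 * bmoment 0 + c2\<^sup>2 * bmoment 2)) \<partial>lborel)
      = h / 8 * (\<integral>x. bump (8 * x / e - 2) * ((a + c1 * (8 * x / e - 2))\<^sup>2 * bmoment 0 + c2\<^sup>2 * bmoment 2) \<partial>lborel)"
    by (rule integral_mult_right_zero)
  also have "(\<integral>x. bump (8 * x / e - 2) * ((a + c1 * (8 * x / e - 2))\<^sup>2 * bmoment 0 + c2\<^sup>2 * bmoment 2) \<partial>lborel)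
      = \<bar>e / 8\<bar> *\<^sub>R (\<integral>t. bump (8 * (e / 4 + e / 8 * t) / e - 2)
        * ((a + c1 * (8 * (e / 4 + e / 8 * t) / e - 2))\<^sup>2 * bmoment 0 + c2\<^sup>2 * bmoment 2) \<partial>lborel)"
    by (rule lborel_integral_real_affine) (use hs in simp)
  also have "(\<lambda>t. bump (8 * (e / 4 + e / 8 * t) / e - 2)
        * ((a + c1 * (8 * (e / 4 + e / 8 * t) / e - 2))\<^sup>2 * bmoment 0 + c2\<^sup>2 * bmoment 2))
      = (\<lambda>t. bump t * ((a + c1 * t)\<^sup>2 * bmoment 0 + c2\<^sup>2 * bmoment 2))"
  proof
    fix t
    have "8 * (e / 4 + e / 8 * t) / e - 2 = t" using hs by (simp add: field_simps)
    then show "bump (8 * (e / 4 + e / 8 * t) / e - 2)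
        * ((a + c1 * (8 * (e / 4 + e / 8 * t) / e - 2))\<^sup>2 * bmoment 0 + c2\<^sup>2 * bmoment 2)
      = bump t * ((a + c1 * t)\<^sup>2 * bmoment 0 + c2\<^sup>2 * bmoment 2)" by simp
  qed
  finally show ?thesis
    unfolding bmoment_quadratic using hs by (simp add: algebra_simps)
qed

section \<open>The projection\<close>

context trapezoid
begin

lemma wgrad_square_integrable: "v \<in> H1 E \<Longrightarrow> square_integrable (lebesgue_on E) (wgrad E v)"
  using is_weak_grad_wgrad[of v E] E_lebesgue by (simp add: is_weak_grad_def L2_iff_square_integrable)

lemma H1_square_integrable: "v \<in> H1 E \<Longrightarrow> square_integrable (lebesgue_on E) v"
  using E_lebesgue by (simp add: H1_def L2_iff_square_integrable)

text \<open>Subtracting the smooth lifting from the sequence that defines the trace gives smooth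
  functions whose boundary values tend to zero; cutting these off yields test functions converging
  to \<open>v - w\<close> together with their gradients. Testing the weak Laplacian and the constant
  fields passes to the limit. The second identity makes the mean gradients of \<open>v\<close> and
  \<open>w\<close> equal.\<close>

lemma test_with_difference:
  assumes v: "v \<in> H1 E" and p: "p \<in> P1" "laplacian_is E v p"
    and g: "g \<in> B_bdry vs" "is_trace vs v g" and z: "g (e2, 0) = 0" "g (e1, h) = 0"
  defines "w \<equiv> lift (g (0, h)) (g (0, 0))"
  shows "(\<integral>z. wgrad E v z \<bullet> (wgrad E v z - grad w z) \<partial>lebesgue_on E) = - (\<integral>z. p z * (v z - w z) \<partial>lebesgue_on E)"
    "i \<in> Basis \<Longrightarrow> (\<integral>z. i \<bullet> (wgrad E v z - grad w z) \<partial>lebesgue_on E) = 0"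
proof -
  let ?M = "lebesgue_on E"
  define G where "G = wgrad E v"
  define U GU where "U z = v z - w z" and "GU z = G z - grad w z" for z
  have sw: "smooth w" unfolding w_def by (rule smooth_lift)
  have sG: "square_integrable ?M G" unfolding G_def by (rule wgrad_square_integrable[OF v])
  have sU: "square_integrable ?M U" unfolding U_def[abs_def] by (rule square_integrable_diff[OF H1_square_integrable[OF v] square_integrable_smooth[OF sw]])
  have sGU: "square_integrable ?M GU" unfolding GU_def[abs_def] by (rule square_integrable_diff[OF sG square_integrable_grad[OF sw]])
  obtain \<phi> where \<phi>: "\<And>n. smooth (\<phi> n)" "(\<lambda>n. \<integral>z. (\<phi> n z - v z)\<^sup>2 \<partial>?M) \<longlonglongrightarrow> 0"
    "(\<lambda>n. \<integral>z. (norm (grad (\<phi> n) z - G z))\<^sup>2 \<partial>?M) \<longlonglongrightarrow> 0" "(\<lambda>n. boundary_sq (\<lambda>z. \<phi> n z - g z)) \<longlonglongrightarrow> 0"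
    unfolding G_def by (rule is_traceE[OF g(2)]) blast
  define \<psi> where "\<psi> n z = \<phi> n z - w z" for n z
  have s\<psi>: "smooth (\<psi> n)" for n unfolding \<psi>_def[abs_def] by (rule smooth_diff[OF \<phi>(1) sw])
  have bd: "boundary_sq (\<psi> n) = boundary_sq (\<lambda>z. \<phi> n z - g z)" for n
  proof -
    have "edge_sq a b (\<psi> n) = edge_sq a b (\<lambda>z. \<phi> n z - g z)" if "(a, b) \<in> edges vs" for a b
      unfolding edge_sq_def
      by (rule Bochner_Integration.integral_cong)
        (use boundary_values_lift[OF g(1) z that] in \<open>simp_all add: \<psi>_def w_def space_restrict_space\<close>)
    then show ?thesis unfolding boundary_sq_def by (simp add: edges_quad)
  qed
  have l1: "(\<lambda>n. \<integral>z. (\<psi> n z - U z)\<^sup>2 \<partial>?M) \<longlonglongrightarrow> 0" using \<phi>(2) by (simp add: \<psi>_def U_def)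
  have "grad (\<psi> n) z - GU z = grad (\<phi> n) z - G z" for n z
    unfolding \<psi>_def[abs_def] grad_diff[OF \<phi>(1) sw] by (simp add: GU_def)
  then have l2: "(\<lambda>n. \<integral>z. (norm (grad (\<psi> n) z - GU z))\<^sup>2 \<partial>?M) \<longlonglongrightarrow> 0" using \<phi>(3) by simp
  have l3: "(\<lambda>n. boundary_sq (\<psi> n)) \<longlonglongrightarrow> 0" using \<phi>(4) by (simp add: bd)
  obtain \<theta> where \<theta>: "\<And>m. test_fun E (\<theta> m)" "(\<lambda>m. \<integral>z. (\<theta> m z - U z)\<^sup>2 \<partial>?M) \<longlonglongrightarrow> 0"
    "(\<lambda>m. \<integral>z. (norm (grad (\<theta> m) z - GU z))\<^sup>2 \<partial>?M) \<longlonglongrightarrow> 0"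
    by (rule test_fun_approx[OF s\<psi> sU sGU l1 l2 l3]) blast
  have s\<theta>: "smooth (\<theta> m)" for m using \<theta>(1) by (simp add: test_fun_def)
  have sp: "square_integrable ?M p" by (rule square_integrable_smooth[OF smooth_P1[OF p(1)]])
  have "(\<lambda>m. \<integral>z. G z \<bullet> grad (\<theta> m) z \<partial>?M) \<longlonglongrightarrow> (\<integral>z. G z \<bullet> GU z \<partial>?M)"
    by (rule square_integrable_inner_tendsto[OF sG square_integrable_grad[OF s\<theta>] sGU \<theta>(3)])
  moreover have "(\<integral>z. G z \<bullet> grad (\<theta> m) z \<partial>?M) = - (\<integral>z. p z * \<theta> m z \<partial>?M)" for m
    unfolding G_def by (rule weak_laplace[OF v p(2) \<theta>(1) bounded_E E_lebesgue])
  moreover have "(\<lambda>m. - (\<integral>z. p z * \<theta> m z \<partial>?M)) \<longlonglongrightarrow> - (\<integral>z. p z * U z \<partial>?M)"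
    using square_integrable_inner_tendsto[OF sp square_integrable_smooth[OF s\<theta>] sU] \<theta>(2) by (intro tendsto_minus) simp
  ultimately show "(\<integral>z. wgrad E v z \<bullet> (wgrad E v z - grad w z) \<partial>?M) = - (\<integral>z. p z * (v z - w z) \<partial>?M)"
    unfolding U_def[symmetric] G_def[symmetric] GU_def[symmetric] using LIMSEQ_unique by auto
  assume i: "i \<in> Basis"
  have "square_integrable ?M (\<lambda>_. i)" by (rule square_integrable_continuous[OF continuous_on_const bounded_E E_lebesgue])
  then have "(\<lambda>m. \<integral>z. i \<bullet> grad (\<theta> m) z \<partial>?M) \<longlonglongrightarrow> (\<integral>z. i \<bullet> GU z \<partial>?M)"
    by (rule square_integrable_inner_tendsto[OF _ square_integrable_grad[OF s\<theta>] sGU \<theta>(3)])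
  moreover have "(\<integral>z. i \<bullet> grad (\<theta> m) z \<partial>?M) = 0" for m
    using test_fun_pderiv_integral_0[OF \<theta>(1) bounded_E E_lebesgue i, of m]
    by (simp add: inner_commute[of i] grad_inner_Basis[OF i])
  ultimately have "(\<lambda>m. 0) \<longlonglongrightarrow> (\<integral>z. i \<bullet> GU z \<partial>?M)" by simp
  then show "(\<integral>z. i \<bullet> (wgrad E v z - grad w z) \<partial>?M) = 0"
    unfolding G_def[symmetric] GU_def[symmetric] using LIMSEQ_unique[OF _ tendsto_const] by auto
qed

section \<open>The projection in explicit form\<close>

definition area :: real where "area = measure (lebesgue_on E) E"

lemma area_eq: "area = (e1 + e2) * h / 2"
  using area_E by (simp add: area_def space_restrict_space)

lemma area_pos: "0 < area"
  using e1 e2_pos h_pos by (simp add: area_eq)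

definition perimeter :: real where "perimeter = h + e2 + dist (e2, 0::real) (e1, h) + e1"

lemma perimeter_pos: "0 < perimeter"
  using h_pos e1 e2_pos zero_le_dist[of "(e2, 0::real)" "(e1, h)"] unfolding perimeter_def by linarith

lemma bdry_integral_affine: "bdry_integral vs (\<lambda>z. c + w \<bullet> z) = c * perimeter + bdry_integral vs (\<lambda>z. w \<bullet> z)"
  unfolding bdry_integral_quad edge_int_affine perimeter_def by (simp add: algebra_simps)

text \<open>Gradients of affine functions are the constant vectors, so orthogonality forces the
  gradient of the projection to be the mean of the weak gradient; the boundary condition fixes the
  constant since the perimeter is positive. Under the boundary integral the chosen trace may be
  replaced by the known \<open>g\<close>.\<close>

lemma Pi_nabla_eq:
  assumes v: "v \<in> H1 E" and g: "is_trace vs v g"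
  defines "a \<equiv> (1 / area) *\<^sub>R (\<integral>z. wgrad E v z \<partial>lebesgue_on E)"
  shows "Pi_nabla vs v = (\<lambda>z. (bdry_integral vs g - bdry_integral vs (\<lambda>z. a \<bullet> z)) / perimeter + a \<bullet> z)"
proof -
  let ?M = "lebesgue_on E"
  define G where "G = wgrad E v"
  define c where "c = (bdry_integral vs g - bdry_integral vs (\<lambda>z. a \<bullet> z)) / perimeter"
  have fin: "finite_measure ?M" by (rule finite_measure_lebesgue_on_bounded[OF bounded_E E_lebesgue])
  have iG: "integrable ?M G" unfolding G_def by (rule square_integrable_integrable[OF fin wgrad_square_integrable[OF v]])
  have ic: "integrable ?M (\<lambda>_. b)" for b :: pt
    by (rule square_integrable_integrable[OF fin square_integrable_continuous[OF continuous_on_const bounded_E E_lebesgue]])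
  have orth: "(\<integral>z. (G z - b) \<bullet> w \<partial>?M) = area *\<^sub>R (a - b) \<bullet> w" for b w
  proof -
    have "(\<integral>z. (G z - b) \<bullet> w \<partial>?M) = (\<integral>z. G z - b \<partial>?M) \<bullet> w"
      by (rule integral_inner_left) (intro Bochner_Integration.integrable_diff iG ic)
    also have "(\<integral>z. G z - b \<partial>?M) = area *\<^sub>R (a - b)"
      unfolding Bochner_Integration.integral_diff[OF iG ic] using area_pos
      by (simp add: a_def G_def area_def space_restrict_space scaleR_diff_right)
    finally show ?thesis by simp
  qed
  have bd: "bdry_integral vs (\<lambda>z. tr vs v z - (c' + w \<bullet> z))
      = bdry_integral vs g - (c' * perimeter + bdry_integral vs (\<lambda>z. w \<bullet> z))" for c' w
  proof -
    have e: "edge_int x y (\<lambda>z. tr vs v z - (c' + w \<bullet> z)) = edge_int x y g - edge_int x y (\<lambda>z. c' + w \<bullet> z)"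
      if "(x, y) \<in> edges vs" for x y
      by (rule edge_int_cong_trace[OF v g that]) (intro continuous_intros)
    have m: "((0, h), (0, 0)) \<in> edges vs" "((0, 0), (e2, 0)) \<in> edges vs"
      "((e2, 0), (e1, h)) \<in> edges vs" "((e1, h), (0, h)) \<in> edges vs"
      by (simp_all add: edges_quad)
    have "bdry_integral vs (\<lambda>z. tr vs v z - (c' + w \<bullet> z)) = bdry_integral vs g - bdry_integral vs (\<lambda>z. c' + w \<bullet> z)"
      unfolding bdry_integral_quad e[OF m(1)] e[OF m(2)] e[OF m(3)] e[OF m(4)] by (simp add: algebra_simps)
    then show ?thesis by (simp add: bdry_integral_affine)
  qed
  have "Pi_nabla vs v = (\<lambda>z. c + a \<bullet> z)"
    unfolding Pi_nabla_def
  proof (rule the_equality, intro conjI ballI)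
    show "(\<lambda>z. c + a \<bullet> z) \<in> P1" unfolding P1_def by blast
    show "bdry_integral vs (\<lambda>z. tr vs v z - (c + a \<bullet> z)) = 0"
      unfolding bd using perimeter_pos by (simp add: c_def)
    fix q assume "q \<in> P1"
    then obtain d w where q: "q = (\<lambda>z. d + w \<bullet> z)" unfolding P1_def by blast
    show "(LINT z:E|lebesgue. (wgrad E v z - grad (\<lambda>z. c + a \<bullet> z) z) \<bullet> grad q z) = 0"
      unfolding LINT_restrict[OF E_lebesgue] q grad_P1 using orth[of a w] by (simp add: G_def)
  next
    fix p assume p: "p \<in> P1 \<and> (\<forall>q\<in>P1. (LINT z:E|lebesgue. (wgrad E v z - grad p z) \<bullet> grad q z) = 0)
      \<and> bdry_integral vs (\<lambda>z. tr vs v z - p z) = 0"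
    then obtain c' a' where p': "p = (\<lambda>z. c' + a' \<bullet> z)" unfolding P1_def by blast
    \<comment> \<open>Testing with the affine function of gradient \<open>a - a'\<close> turns
      orthogonality into \<open>area\<close> times a squared norm.\<close>
    have "(\<lambda>z. 0 + (a - a') \<bullet> z) \<in> P1" unfolding P1_def by blast
    then have "(LINT z:E|lebesgue. (wgrad E v z - grad p z) \<bullet> grad (\<lambda>z. 0 + (a - a') \<bullet> z) z) = 0"
      using p by blast
    then have "area *\<^sub>R (a - a') \<bullet> (a - a') = 0"
      unfolding LINT_restrict[OF E_lebesgue] p' grad_P1 orth[symmetric] by (simp add: G_def)
    then have a: "a' = a" using area_pos by simp
    have "bdry_integral vs (\<lambda>z. tr vs v z - p z) = 0" using p by blast
    then have "c' = c" unfolding p' bd a using perimeter_pos by (simp add: c_def field_simps)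
    then show "p = (\<lambda>z. c + a \<bullet> z)" by (simp add: p' a)
  qed
  then show ?thesis by (simp add: c_def)
qed

lemma edge_in_hull:
  assumes "(a, b) \<in> edges vs" "t \<in> {0..1}"
  shows "0 \<le> fst (linepath a b t)" "fst (linepath a b t) \<le> e2" "0 \<le> snd (linepath a b t)" "snd (linepath a b t) \<le> h"
proof -
  have "a \<in> set vs" "b \<in> set vs" using assms(1) unfolding edges_quad by (auto simp: quad_def)
  then have "closed_segment a b \<subseteq> convex hull (set vs)"
    by (intro closed_segment_subset convex_convex_hull hull_inc)
  then have l: "linepath a b t \<in> convex hull (set vs)" using assms(2) linepath_image_01 by blast
  then show "0 \<le> fst (linepath a b t)" "0 \<le> snd (linepath a b t)" "snd (linepath a b t) \<le> h"
    unfolding hull_eq by blast+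
  then show "fst (linepath a b t) \<le> e2" using l k_le unfolding hull_eq by fastforce
qed

lemma inner_pt_le:
  assumes "0 \<le> fst z" "fst z \<le> e2" "0 \<le> snd z" "snd z \<le> h"
  shows "\<bar>w \<bullet> z\<bar> \<le> \<bar>fst w\<bar> * e2 + \<bar>snd w\<bar> * h"
proof -
  have "\<bar>w \<bullet> z\<bar> \<le> \<bar>fst w * fst z\<bar> + \<bar>snd w * snd z\<bar>" by (simp add: inner_prod_def)
  also have "\<dots> \<le> \<bar>fst w\<bar> * e2 + \<bar>snd w\<bar> * h"
    unfolding abs_mult using assms by (intro add_mono mult_left_mono) auto
  finally show ?thesis .
qed

text \<open>The mean gradient is that of the lifting, which \<open>lift_grad_mean\<close> controls;
  scaled by the size of the element its components contribute at most 2 + 6 = 8 times the nodal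
  bound. The boundary mean gives 1 + 8 = 9 for the constant, hence 17.\<close>

lemma Pi_nabla_bound:
  assumes v: "v \<in> H1 E" and p: "p \<in> P1" "laplacian_is E v p"
    and g: "g \<in> B_bdry vs" "is_trace vs v g" and z: "g (e2, 0) = 0" "g (e1, h) = 0"
    and x: "x \<in> E"
  shows "\<bar>Pi_nabla vs v x\<bar> \<le> 17 * max \<bar>g (0, h)\<bar> \<bar>g (0, 0)\<bar>"
proof -
  let ?M = "lebesgue_on E"
  define m where "m = max \<bar>g (0, h)\<bar> \<bar>g (0, 0)\<bar>"
  define w where "w = lift (g (0, h)) (g (0, 0))"
  define a where "a = (1 / area) *\<^sub>R (\<integral>z. wgrad E v z \<partial>?M)"
  define c where "c = (bdry_integral vs g - bdry_integral vs (\<lambda>z. a \<bullet> z)) / perimeter"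
  have m0: "0 \<le> m" by (simp add: m_def)
  have fin: "finite_measure ?M" by (rule finite_measure_lebesgue_on_bounded[OF bounded_E E_lebesgue])
  have iG: "integrable ?M (wgrad E v)" by (rule square_integrable_integrable[OF fin wgrad_square_integrable[OF v]])
  have iw: "integrable ?M (grad w)"
    unfolding w_def by (rule square_integrable_integrable[OF fin square_integrable_grad[OF smooth_lift]])
  have mean: "area * (a \<bullet> i) = (\<integral>z. grad w z \<bullet> i \<partial>?M)" if i: "i \<in> Basis" for i
  proof -
    have "0 = (\<integral>z. i \<bullet> (wgrad E v z - grad w z) \<partial>?M)"
      unfolding w_def using test_with_difference(2)[OF v p g z i] by simp
    also have "\<dots> = (\<integral>z. wgrad E v z \<bullet> i - grad w z \<bullet> i \<partial>?M)"
      by (simp add: inner_diff_right inner_commute)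
    also have "\<dots> = (\<integral>z. wgrad E v z \<bullet> i \<partial>?M) - (\<integral>z. grad w z \<bullet> i \<partial>?M)"
      by (intro Bochner_Integration.integral_diff integrable_inner_left iG iw)
    also have "(\<integral>z. wgrad E v z \<bullet> i \<partial>?M) = (\<integral>z. wgrad E v z \<partial>?M) \<bullet> i"
      by (rule integral_inner_left[OF iG])
    finally show ?thesis using area_pos by (simp add: a_def)
  qed
  \<comment> \<open>The area is comparable to \<open>e2 * h\<close> however small \<open>e1\<close>
    is.\<close>
  have ag: "e2 * h / 2 \<le> area" using e1 h_pos by (simp add: area_eq algebra_simps)
  have "e2 * h / 2 * \<bar>fst a\<bar> \<le> area * \<bar>fst a\<bar>" using ag by (rule mult_right_mono) simp
  also have "\<dots> = \<bar>area * (a \<bullet> (1, 0))\<bar>" using area_pos by (simp add: abs_mult inner_prod_def)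
  also have "\<dots> \<le> m * h"
    using lift_grad_mean(1)[of "g (0, h)" "g (0, 0)"] mean[of "(1, 0)"] by (simp add: Basis_pt w_def m_def)
  finally have a1: "\<bar>fst a\<bar> * e2 \<le> 2 * m" using h_pos by (simp add: mult.commute mult.left_commute)
  have "e2 * h / 2 * \<bar>snd a\<bar> \<le> area * \<bar>snd a\<bar>" using ag by (rule mult_right_mono) simp
  also have "\<dots> = \<bar>area * (a \<bullet> (0, 1))\<bar>" using area_pos by (simp add: abs_mult inner_prod_def)
  also have "\<dots> \<le> 3 * m * e2"
    using lift_grad_mean(2)[of "g (0, h)" "g (0, 0)"] mean[of "(0, 1)"] by (simp add: Basis_pt w_def m_def)
  finally have a2: "\<bar>snd a\<bar> * h \<le> 6 * m" using e2_pos by (simp add: mult.commute mult.left_commute)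
  have ae: "\<bar>a \<bullet> y\<bar> \<le> 8 * m" if "0 \<le> fst y" "fst y \<le> e2" "0 \<le> snd y" "snd y \<le> h" for y
    using inner_pt_le[OF that, of a] a1 a2 by linarith
  have gi: "\<bar>edge_int b d g\<bar> \<le> m" if bd: "(b, d) \<in> edges vs" for b d
  proof (rule edge_int_abs_le)
    show "integrable (lebesgue_on {0..1}) (\<lambda>t. g (linepath b d t))"
      by (rule square_integrable_integrable[OF finite_measure_lebesgue_on_bounded is_trace_square_integrable[OF g(2) bd]]) auto
    fix t :: real assume t: "t \<in> {0..1}"
    have e: "\<bar>g b\<bar> \<le> m" "\<bar>g d\<bar> \<le> m" using bd z m0 unfolding edges_quad by (auto simp: m_def)
    have "\<bar>g (linepath b d t)\<bar> \<le> (1 - t) * \<bar>g b\<bar> + t * \<bar>g d\<bar>"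
      unfolding B_bdry_edge[OF g(1) bd t] using t abs_triangle_ineq[of "(1 - t) * g b" "t * g d"] by (simp add: abs_mult)
    also have "\<dots> \<le> (1 - t) * m + t * m" using t e by (intro add_mono mult_left_mono) auto
    finally show "\<bar>g (linepath b d t)\<bar> \<le> m" by (simp add: algebra_simps)
  qed
  have ai: "\<bar>edge_int b d (\<lambda>z. a \<bullet> z)\<bar> \<le> 8 * m" if bd: "(b, d) \<in> edges vs" for b d
    by (rule edge_int_abs_le) (intro edge_int_integrable continuous_intros ae edge_in_hull[OF bd])+
  have le: "\<bar>bdry_integral vs f\<bar> \<le> perimeter * K" if "\<And>b d. (b, d) \<in> edges vs \<Longrightarrow> \<bar>edge_int b d f\<bar> \<le> K" for f K
  proof -
    let ?d = "dist (e2, 0::real) (e1, h)"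
    have "\<bar>bdry_integral vs f\<bar> \<le> \<bar>h * edge_int (0, h) (0, 0) f\<bar> + \<bar>e2 * edge_int (0, 0) (e2, 0) f\<bar>
        + \<bar>?d * edge_int (e2, 0) (e1, h) f\<bar> + \<bar>e1 * edge_int (e1, h) (0, h) f\<bar>"
      unfolding bdry_integral_quad by linarith
    also have "\<dots> \<le> h * K + e2 * K + ?d * K + e1 * K"
      unfolding abs_mult using h_pos e1 e2_pos that by (intro add_mono mult_mono) (auto simp: edges_quad)
    finally show ?thesis by (simp add: perimeter_def algebra_simps)
  qed
  have "\<bar>c\<bar> * perimeter = \<bar>bdry_integral vs g - bdry_integral vs (\<lambda>z. a \<bullet> z)\<bar>"
    using perimeter_pos by (simp add: c_def)
  also have "\<dots> \<le> perimeter * m + perimeter * (8 * m)"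
    using le[OF gi] le[OF ai] by (rule abs_triangle_ineq4[THEN order_trans, OF add_mono])
  finally have "\<bar>c\<bar> * perimeter \<le> (9 * m) * perimeter" by (simp add: algebra_simps)
  then have c: "\<bar>c\<bar> \<le> 9 * m" using perimeter_pos by simp
  have "\<bar>a \<bullet> x\<bar> \<le> 8 * m"
    using x k_le[of "snd x"] by (intro ae) (auto simp: E_eq)
  moreover have "Pi_nabla vs v x = c + a \<bullet> x"
    unfolding Pi_nabla_eq[OF v g(2)] c_def a_def ..
  ultimately show ?thesis using c unfolding m_def[symmetric] by linarith
qed

end

section \<open>The energy estimate\<close>

lemma sum3_sq_le: "(x + y + z)\<^sup>2 \<le> 3 * (x\<^sup>2 + y\<^sup>2 + z\<^sup>2)" for x y z :: real
proof -
  have "0 \<le> (x - y)\<^sup>2 + (y - z)\<^sup>2 + (x - z)\<^sup>2" by simp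
  then show ?thesis by (simp add: power2_eq_square algebra_simps)
qed

text \<open>The bump lives on a rectangle whose size is comparable to \<open>\<epsilon>\<^sub>2 \<times> h\<close>, which makes the constant
  independent of the shape although the element may be very thin at the top.\<close>

lemma laplacian_inverse_estimate:
  obtains C where "0 \<le> C" "\<And>h e1 e2 v p. trapezoid h e1 e2 \<Longrightarrow> v \<in> H1 (polygon (quad h e1 e2)) \<Longrightarrow> p \<in> P1
    \<Longrightarrow> laplacian_is (polygon (quad h e1 e2)) v p \<Longrightarrow> \<exists>S. (\<forall>z\<in>polygon (quad h e1 e2). \<bar>p z\<bar> \<le> S) \<and>
      S * e2 * sqrt (e2 * h) \<le> C * sqrt (\<integral>z. (norm (wgrad (polygon (quad h e1 e2)) v z))\<^sup>2
        \<partial>lebesgue_on (polygon (quad h e1 e2)))"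
proof -
  obtain bump' B where d: "\<And>x. (bump has_real_derivative bump' x) (at x)"
    and B: "\<And>x. \<bar>bump x\<bar> \<le> B" "\<And>x. \<bar>x\<bar> \<le> 6 \<Longrightarrow> \<bar>bump' x\<bar> \<le> B" "0 \<le> B"
    using bump_deriv by blast
  define c0 where "c0 = min (bmoment 0 * bmoment 0) (bmoment 0 * bmoment 2)"
  have c0: "0 < c0" using bmoment_pos[of 0] bmoment_pos[of 2] by (simp add: c0_def)
  \<comment> \<open>The factor 6 comes from the bound \<open>6 * S\<close> for \<open>p\<close>, 192
    = 64 * 3 from the Jacobian of the rescaling and the three-term square, and 104 from the gradient
    of the test function.\<close>
  define C where "C = 6 * (104 * 192 * B\<^sup>2 / c0)"
  have C0: "0 \<le> C" using c0 by (simp add: C_def)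
  show ?thesis
  proof (rule that[OF C0])
    fix h e1 e2 :: real and v p
    assume "trapezoid h e1 e2"
    then interpret trapezoid h e1 e2 .
    let ?M = "lebesgue_on E"
    assume v: "v \<in> H1 E" and p: "p \<in> P1" and lap: "laplacian_is E v p"
    obtain c w where pw: "p = (\<lambda>z. c + w \<bullet> z)" using p unfolding P1_def by blast
    \<comment> \<open>These coordinates are centred at the point \<open>(e2 / 4, h / 4)\<close>, and
      \<open>a\<close>, \<open>c1\<close>, \<open>c2\<close> are the coefficients of
      \<open>p\<close> in them, so \<open>S\<close> measures \<open>p\<close> in a scale-invariant
      way.\<close>
    define X Y :: "pt \<Rightarrow> real" where "X z = 8 * fst z / e2 - 2" and "Y z = 8 * snd z / h - 2" for z
    define c1 c2 a where "c1 = fst w * e2 / 8" and "c2 = snd w * h / 8" and "a = c + fst w * e2 / 4 + snd w * h / 4"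
    define S where "S = \<bar>a\<bar> + \<bar>c1\<bar> + \<bar>c2\<bar>"
    have S0: "0 \<le> S" by (simp add: S_def)
    have p_eq: "p z = a + c1 * X z + c2 * Y z" for z
      using e2_pos h_pos by (simp add: pw a_def c1_def c2_def X_def Y_def inner_prod_def field_simps)
    have XY: "\<bar>X z\<bar> \<le> 6" "\<bar>Y z\<bar> \<le> 6" if "z \<in> E" for z
    proof -
      have "0 < fst z" "fst z < e2" "0 < snd z" "snd z < h" using that k_le[of "snd z"] by (auto simp: E_eq)
      then have "0 \<le> 8 * fst z / e2" "8 * fst z / e2 \<le> 8" "0 \<le> 8 * snd z / h" "8 * snd z / h \<le> 8"
        using e2_pos h_pos by (simp_all add: pos_divide_le_eq)
      then show "\<bar>X z\<bar> \<le> 6" "\<bar>Y z\<bar> \<le> 6" by (simp_all add: X_def Y_def)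
    qed
    have p_le: "\<bar>p z\<bar> \<le> 6 * S" if z: "z \<in> E" for z
    proof -
      have "\<bar>p z\<bar> \<le> \<bar>a\<bar> + \<bar>c1 * X z\<bar> + \<bar>c2 * Y z\<bar>" unfolding p_eq by linarith
      also have "\<dots> \<le> \<bar>a\<bar> + \<bar>c1\<bar> * 6 + \<bar>c2\<bar> * 6"
        unfolding abs_mult using XY[OF z] by (intro add_mono mult_left_mono) auto
      finally show ?thesis by (simp add: S_def)
    qed
    define bX bY where "bX z = bump (X z)" and "bY z = bump (Y z)" for z
    have argX: "X z = - 2 + (8 / e2, 0) \<bullet> z" and argY: "Y z = - 2 + (0, 8 / h) \<bullet> z" for z
      by (simp_all add: X_def Y_def inner_prod_def)
    have sX: "smooth bX" and sY: "smooth bY"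
      unfolding bX_def[abs_def] bY_def[abs_def] argX argY by (rule smooth_comp_affine[OF Ck1_bump])+
    have gX: "grad bX z = bump' (X z) *\<^sub>R (8 / e2, 0)" and gY: "grad bY z = bump' (Y z) *\<^sub>R (0, 8 / h)" for z
      unfolding bX_def[abs_def] bY_def[abs_def] argX argY by (rule grad_comp_affine[OF d])+
    define \<phi> where "\<phi> z = (bX z * bY z) * p z" for z
    have sp: "smooth p" by (rule smooth_P1[OF p])
    have s\<phi>: "smooth \<phi>" unfolding \<phi>_def[abs_def] by (intro smooth_mult sX sY sp)
    let ?R = "cbox (e2 / 8, h / 8) (3 * e2 / 8, 3 * h / 8)"
    \<comment> \<open>Up to height \<open>3 * h / 8\<close> the width is at least
      \<open>5 * e2 / 8\<close>, so the rectangle fits whatever \<open>e1\<close> is.\<close>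
    have RE: "?R \<subseteq> E"
    proof
      fix z assume "z \<in> ?R"
      then have z: "e2 / 8 \<le> fst z" "fst z \<le> 3 * e2 / 8" "h / 8 \<le> snd z" "snd z \<le> 3 * h / 8"
        by (cases z; auto simp: cbox_Pair_iff)+
      have "slope * snd z \<le> e2 / h * (3 * h / 8)"
        using z slope_ge_0 e1 h_pos e2_pos by (intro mult_mono) (auto simp: slope_def divide_right_mono)
      then have "slope * snd z \<le> 3 * e2 / 8" using h_pos by simp
      then show "z \<in> E" using z e2_pos h_pos by (simp add: E_eq k_eq)
    qed
    have bR: "z \<in> ?R" if "bX z * bY z \<noteq> 0" for z
    proof -
      have "\<not> 1 \<le> \<bar>X z\<bar>" "\<not> 1 \<le> \<bar>Y z\<bar>" using that bump_0 by (auto simp: bX_def bY_def)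
      then have "- 1 < X z" "X z < 1" "- 1 < Y z" "Y z < 1" by linarith+
      then show ?thesis using e2_pos h_pos by (cases z) (auto simp: X_def Y_def cbox_Pair_iff field_simps)
    qed
    have t\<phi>: "test_fun E \<phi>"
      by (rule test_funI[OF s\<phi> _ compact_cbox RE]) (use bR in \<open>auto simp: \<phi>_def\<close>)
    define G where "G = wgrad E v"
    define X0 where "X0 = (\<integral>z. (norm (G z))\<^sup>2 \<partial>?M)"
    have sG: "square_integrable ?M G" unfolding G_def by (rule wgrad_square_integrable[OF v])
    \<comment> \<open>The integrand is the bump times the square of \<open>p\<close>; the diagonal
      form of \<open>bump_box_integral\<close> is bounded below by its smaller coefficient
      \<open>c0\<close>, which does not involve the element.\<close>
    have lower: "e2 * h / 64 * (c0 * (S\<^sup>2 / 3)) \<le> (\<integral>z. p z * \<phi> z \<partial>?M)"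
    proof -
      define F where "F z = bump (8 * fst z / e2 - 2) * bump (8 * snd z / h - 2)
        * (a + c1 * (8 * fst z / e2 - 2) + c2 * (8 * snd z / h - 2))\<^sup>2" for z
      have F: "F z = p z * \<phi> z" for z
        unfolding F_def \<phi>_def p_eq X_def Y_def bX_def bY_def by (simp add: power2_eq_square)
      have Fc: "continuous_on UNIV F"
        unfolding F by (intro continuous_intros smooth_continuous sp s\<phi>)
      have F0: "F z = 0" if "z \<notin> E" for z using test_fun_outside[OF t\<phi> that] by (simp add: F)
      have FI: "integrable lborel F" "(\<integral>z. F z \<partial>lborel) = (\<integral>z. F z \<partial>?M)"
        using integrable_lborel_support[OF Fc bounded_E E_lebesgue] F0 by blast+
      have "(\<integral>z. p z * \<phi> z \<partial>?M) = (\<integral>z. F z \<partial>lborel)"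
      proof -
        have "F = (\<lambda>z. p z * \<phi> z)" by (rule ext) (rule F)
        then show ?thesis using FI(2) by (simp only:)
      qed
      also have "\<dots> = e2 * h / 64 * (bmoment 0 * bmoment 0 * a\<^sup>2 + bmoment 0 * bmoment 2 * (c1\<^sup>2 + c2\<^sup>2))"
        using bump_box_integral[OF h_pos e2_pos FI(1)[unfolded F_def[abs_def]]] by (simp add: F_def)
      also have "\<dots> \<ge> e2 * h / 64 * (c0 * a\<^sup>2 + c0 * (c1\<^sup>2 + c2\<^sup>2))"
        using e2_pos h_pos by (intro mult_left_mono add_mono mult_right_mono) (auto simp: c0_def)
      moreover have "c0 * (S\<^sup>2 / 3) \<le> c0 * a\<^sup>2 + c0 * (c1\<^sup>2 + c2\<^sup>2)"
      proof -
        have "S\<^sup>2 / 3 \<le> a\<^sup>2 + (c1\<^sup>2 + c2\<^sup>2)" using sum3_sq_le[of "\<bar>a\<bar>" "\<bar>c1\<bar>" "\<bar>c2\<bar>"] by (simp add: S_def)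
        from mult_left_mono[OF this less_imp_le[OF c0]] show ?thesis by (simp add: distrib_left)
      qed
      then have "e2 * h / 64 * (c0 * (S\<^sup>2 / 3)) \<le> e2 * h / 64 * (c0 * a\<^sup>2 + c0 * (c1\<^sup>2 + c2\<^sup>2))"
        using e2_pos h_pos by (intro mult_left_mono) auto
      ultimately show ?thesis by linarith
    qed
    \<comment> \<open>Here 104 = 8 + 6 * 16: the derivative falls on \<open>p\<close> or on one of
      the two bumps. The scale \<open>1 / e2\<close> serves both directions because
      \<open>e2 \<le> h\<close>.\<close>
    define L where "L = 104 * B\<^sup>2 * S / e2"
    have L0: "0 \<le> L" using S0 e2_pos by (simp add: L_def)
    have he: "8 / h \<le> 8 / e2" using e2h e2_pos by (simp add: frac_le)
    have grad_le: "norm (grad \<phi> z) \<le> L" if z: "z \<in> E" for z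
    proof -
      have gb: "norm (grad bX z) \<le> B * (8 / e2)" "norm (grad bY z) \<le> B * (8 / e2)"
      proof -
        have "norm (grad bX z) = \<bar>bump' (X z)\<bar> * (8 / e2)" unfolding gX norm_scaleR using e2_pos by (simp add: norm_Pair)
        also have "\<dots> \<le> B * (8 / e2)" using B(2)[OF XY(1)[OF z]] e2_pos by (intro mult_right_mono) auto
        finally show "norm (grad bX z) \<le> B * (8 / e2)" .
        have "norm (grad bY z) = \<bar>bump' (Y z)\<bar> * (8 / h)" unfolding gY norm_scaleR using h_pos by (simp add: norm_Pair)
        also have "\<dots> \<le> B * (8 / e2)" using B(2)[OF XY(2)[OF z]] B(3) he h_pos by (intro mult_mono) auto
        finally show "norm (grad bY z) \<le> B * (8 / e2)" .
      qed
      have bb: "\<bar>bX z\<bar> \<le> B" "\<bar>bY z\<bar> \<le> B" by (simp_all add: bX_def bY_def B)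
      have "norm (bX z *\<^sub>R grad bY z + bY z *\<^sub>R grad bX z) \<le> B * (B * (8 / e2)) + B * (B * (8 / e2))"
        by (intro norm_triangle_le add_mono; unfold norm_scaleR; rule mult_mono[OF bb(1) gb(2) B(3) norm_ge_zero] mult_mono[OF bb(2) gb(1) B(3) norm_ge_zero])
      then have g1: "norm (grad (\<lambda>z. bX z * bY z) z) \<le> 16 * B\<^sup>2 / e2"
        unfolding grad_mult[OF sX sY] by (simp add: power2_eq_square)
      have "norm w \<le> \<bar>fst w\<bar> + \<bar>snd w\<bar>" using norm_Pair_le[of "fst w" "snd w"] by simp
      also have "\<dots> = 8 / e2 * \<bar>c1\<bar> + 8 / h * \<bar>c2\<bar>" using e2_pos h_pos by (simp add: c1_def c2_def abs_mult)
      also have "\<dots> \<le> 8 / e2 * \<bar>c1\<bar> + 8 / e2 * \<bar>c2\<bar>" using he by (intro add_left_mono mult_right_mono) auto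
      also have "\<dots> \<le> 8 / e2 * S"
        unfolding distrib_left[symmetric] using e2_pos by (intro mult_left_mono) (auto simp: S_def)
      finally have g2: "norm (grad p z) \<le> 8 / e2 * S" unfolding pw grad_P1 .
      have b2: "\<bar>bX z * bY z\<bar> \<le> B\<^sup>2" unfolding abs_mult power2_eq_square using bb B(3) by (intro mult_mono) auto
      have "norm (grad \<phi> z) \<le> \<bar>bX z * bY z\<bar> * norm (grad p z) + \<bar>p z\<bar> * norm (grad (\<lambda>z. bX z * bY z) z)"
        unfolding \<phi>_def[abs_def] grad_mult[OF smooth_mult[OF sX sY] sp]
        by (rule order_trans[OF norm_triangle_ineq]) simp
      also have "\<dots> \<le> B\<^sup>2 * (8 / e2 * S) + (6 * S) * (16 * B\<^sup>2 / e2)"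
        using b2 g1 g2 p_le[OF z] S0 by (intro add_mono mult_mono) auto
      also have "\<dots> = L" by (simp add: L_def field_simps)
      finally show ?thesis .
    qed
    have "(\<integral>z. (norm (grad \<phi> z))\<^sup>2 \<partial>?M) \<le> (\<integral>z. L\<^sup>2 * 1 \<partial>?M)"
    proof (rule integral_mono)
      show "integrable ?M (\<lambda>z. (norm (grad \<phi> z))\<^sup>2)" using square_integrable_grad[OF s\<phi>] by (simp add: square_integrable_def)
      show "integrable ?M (\<lambda>z. L\<^sup>2 * 1)" by (intro E_integrable_continuous continuous_intros)
    qed (auto simp: space_restrict_space intro!: power_mono grad_le)
    also have "\<dots> \<le> L\<^sup>2 * (e2 * h)" unfolding integral_mult_right_zero by (intro mult_left_mono area_le) simp
    finally have "sqrt (\<integral>z. (norm (grad \<phi> z))\<^sup>2 \<partial>?M) \<le> L * sqrt (e2 * h)"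
      using L0 real_sqrt_le_mono by (fastforce simp: real_sqrt_mult)
    then have "sqrt X0 * sqrt (\<integral>z. (norm (grad \<phi> z))\<^sup>2 \<partial>?M) \<le> sqrt X0 * (L * sqrt (e2 * h))"
      by (intro mult_left_mono) (simp_all add: X0_def)
    moreover have "(\<integral>z. p z * \<phi> z \<partial>?M) \<le> sqrt X0 * sqrt (\<integral>z. (norm (grad \<phi> z))\<^sup>2 \<partial>?M)"
      using square_integrable_Cauchy_Schwarz[OF sG square_integrable_grad[OF s\<phi>]] weak_laplace[OF v lap t\<phi> bounded_E E_lebesgue]
      by (simp add: X0_def G_def)
    ultimately have main: "e2 * h / 64 * (c0 * (S\<^sup>2 / 3)) \<le> sqrt X0 * (L * sqrt (e2 * h))"
      using lower by linarith
    define r where "r = sqrt (e2 * h)"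
    have r: "0 < r" "r\<^sup>2 = e2 * h" using e2_pos h_pos by (simp_all add: r_def)
    have "S * e2 * r \<le> (104 * 192 * B\<^sup>2 / c0) * sqrt X0"
    proof (cases "S = 0")
      case True
      then show ?thesis using c0 by (simp add: X0_def)
    next
      case False
      then have Sp: "0 < S" using S0 by simp
      \<comment> \<open>Both sides of \<open>main\<close> contain this positive factor, which is
        cancelled; positivity needs \<open>S\<close> nonzero, hence the case distinction.\<close>
      have "(c0 * S * r / 192 / e2) * (S * e2 * r) = e2 * h / 64 * (c0 * (S\<^sup>2 / 3))"
        unfolding r(2)[symmetric] using e2_pos by (simp add: power2_eq_square)
      also have "\<dots> \<le> sqrt X0 * (L * r)" using main by (simp add: r_def)
      also have "\<dots> = (c0 * S * r / 192 / e2) * ((104 * 192 * B\<^sup>2 / c0) * sqrt X0)"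
        using c0 by (simp add: L_def)
      finally show ?thesis
        using c0 Sp r(1) e2_pos by (subst (asm) mult_le_cancel_left_pos) auto
    qed
    then have "6 * (S * e2 * r) \<le> 6 * ((104 * 192 * B\<^sup>2 / c0) * sqrt X0)" by (rule mult_left_mono) simp
    then have "(6 * S) * e2 * sqrt (e2 * h) \<le> C * sqrt X0" by (simp add: C_def r_def)
    then show "\<exists>S. (\<forall>z\<in>E. \<bar>p z\<bar> \<le> S) \<and> S * e2 * sqrt (e2 * h) \<le> C * sqrt (\<integral>z. (norm (wgrad E v z))\<^sup>2 \<partial>?M)"
      using p_le unfolding X0_def G_def by blast
  qed
qed

context trapezoid
begin

text \<open>The constants: 51 from \<open>lift_energy\<close>, 18 = 17 + 1 from bounding the
  projection and the lifting separately, 6 from \<open>stab_lower\<close>. The inverse estimate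
  enters as a hypothesis with a given \<open>C\<close>, because that constant has to be fixed before
  the element is.\<close>

lemma energy_le:
  assumes v: "v \<in> V_space vs"
    and z: "AE t in lebesgue_on {0..1}. tr vs v (linepath (e1, h) (e2, 0) t) = 0"
    and inverse_estimate: "\<And>p. p \<in> P1 \<Longrightarrow> laplacian_is E v p \<Longrightarrow> \<exists>S. (\<forall>z\<in>E. \<bar>p z\<bar> \<le> S) \<and>
      S * e2 * sqrt (e2 * h) \<le> C * sqrt (\<integral>z. (norm (wgrad E v z))\<^sup>2 \<partial>lebesgue_on E)"
    and C: "0 \<le> C"
  shows "(H1_seminorm E v)\<^sup>2 \<le> (sqrt 51 + 18 * sqrt 6 * C)\<^sup>2 * s_E h e1 e2 v v"
proof -
  let ?M = "lebesgue_on E"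
  have vH: "v \<in> H1 E" using v by (simp add: V_space_def)
  obtain g where g: "g \<in> B_bdry vs" "is_trace vs v g" using v by (auto simp: V_space_def)
  obtain p where p: "p \<in> P1" "laplacian_is E v p" using v by (auto simp: V_space_def)
  have enh: "(\<integral>z. (v z - Pi_nabla vs v z) * p z \<partial>?M) = 0"
    using v p(1) by (simp add: V_space_def LINT_restrict[OF E_lebesgue])
  note gz = trace_zero_on_slanted_edge[OF vH g z]
  define m where "m = max \<bar>g (0, h)\<bar> \<bar>g (0, 0)\<bar>"
  have m0: "0 \<le> m" by (simp add: m_def)
  define w where "w = lift (g (0, h)) (g (0, 0))"
  define s where "s = stab (g (0, h)) (g (0, 0))"
  have s_eq: "s_E h e1 e2 v v = s" unfolding s_def by (rule s_E_eq_stab[OF vH g])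
  have ms: "h * m\<^sup>2 \<le> 6 * e2 * s" unfolding m_def s_def by (rule stab_lower)
  have s0: "0 \<le> s"
  proof -
    have "0 \<le> 6 * e2 * s" using ms h_pos by (smt (verit) mult_nonneg_nonneg zero_le_power2)
    then show ?thesis using e2_pos by (simp add: zero_le_mult_iff)
  qed
  define G where "G = wgrad E v"
  define X where "X = (\<integral>z. (norm (G z))\<^sup>2 \<partial>?M)"
  have X0: "0 \<le> X" by (simp add: X_def)
  have sw: "smooth w" unfolding w_def by (rule smooth_lift)
  have sG: "square_integrable ?M G" unfolding G_def by (rule wgrad_square_integrable[OF vH])
  note sgw = square_integrable_grad[OF sw] and sp = square_integrable_smooth[OF smooth_P1[OF p(1)]] and sv = H1_square_integrable[OF vH]
  obtain S where S: "\<And>z. z \<in> E \<Longrightarrow> \<bar>p z\<bar> \<le> S" "S * e2 * sqrt (e2 * h) \<le> C * sqrt X"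
    using inverse_estimate[OF p] unfolding X_def G_def by blast
  \<comment> \<open>A bound for an absolute value is nonnegative as soon as \<open>E\<close> has a
    point; any point would serve.\<close>
  have "(e2 / 2, h / 4) \<in> E"
  proof -
    have "slope * (h / 4) = (e2 - e1) / 4" using slope_h by simp
    then show ?thesis using e1 e2_pos h_pos by (simp add: E_eq k_eq)
  qed
  then have S0: "0 \<le> S" using S(1) abs_ge_zero order_trans by blast
  have "Pi_nabla vs v \<in> P1" unfolding Pi_nabla_eq[OF vH g(2)] P1_def by blast
  then have sPi: "square_integrable ?M (Pi_nabla vs v)" by (intro square_integrable_smooth smooth_P1)
  have first: "(\<integral>z. G z \<bullet> grad w z \<partial>?M) \<le> sqrt X * (sqrt 51 * sqrt s)"
  proof -
    have "\<bar>\<integral>z. G z \<bullet> grad w z \<partial>?M\<bar> \<le> sqrt X * sqrt (\<integral>z. (norm (grad w z))\<^sup>2 \<partial>?M)"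
      unfolding X_def by (rule square_integrable_Cauchy_Schwarz[OF sG sgw])
    also have "\<dots> \<le> sqrt X * sqrt (51 * s)"
      using lift_energy unfolding w_def s_def by (intro mult_left_mono real_sqrt_le_mono) (simp_all add: X0)
    finally show ?thesis by (simp add: real_sqrt_mult)
  qed
  \<comment> \<open>The enhancement constraint, with \<open>p\<close> itself as the test polynomial,
    exchanges \<open>v\<close> for its projection.\<close>
  have "(\<integral>z. p z * (v z - w z) \<partial>?M) = (\<integral>z. (v z - Pi_nabla vs v z) * p z + p z * (Pi_nabla vs v z - w z) \<partial>?M)"
    by (rule Bochner_Integration.integral_cong) (simp_all add: algebra_simps)
  also have "\<dots> = (\<integral>z. p z * (Pi_nabla vs v z - w z) \<partial>?M)"
    by (subst Bochner_Integration.integral_add)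
      (simp_all add: enh square_integrable_mult square_integrable_diff sv sPi sp square_integrable_smooth[OF sw])
  finally have pv: "(\<integral>z. p z * (v z - w z) \<partial>?M) = (\<integral>z. p z * (Pi_nabla vs v z - w z) \<partial>?M)" .
  have second: "\<bar>\<integral>z. p z * (v z - w z) \<partial>?M\<bar> \<le> sqrt X * (18 * sqrt 6 * C * sqrt s)"
  proof -
    have "\<bar>\<integral>z. p z * (Pi_nabla vs v z - w z) \<partial>?M\<bar> \<le> (\<integral>z. \<bar>p z * (Pi_nabla vs v z - w z)\<bar> \<partial>?M)"
      by (rule integral_abs_bound)
    also have "\<dots> \<le> (\<integral>z. (S * (18 * m)) * 1 \<partial>?M)"
    proof (rule integral_mono)
      show "integrable ?M (\<lambda>z. \<bar>p z * (Pi_nabla vs v z - w z)\<bar>)"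
        by (intro integrable_abs square_integrable_mult square_integrable_diff sPi sp square_integrable_smooth[OF sw])
      show "integrable ?M (\<lambda>z. (S * (18 * m)) * 1)" by (intro E_integrable_continuous continuous_intros)
      fix z assume "z \<in> space ?M"
      then have z: "z \<in> E" by (simp add: space_restrict_space)
      have "\<bar>Pi_nabla vs v z - w z\<bar> \<le> 18 * m"
        using Pi_nabla_bound[OF vH p g gz z] lift_bounds(1)[OF z, of "g (0, h)" "g (0, 0)"]
        unfolding m_def[symmetric] w_def[symmetric] by linarith
      then show "\<bar>p z * (Pi_nabla vs v z - w z)\<bar> \<le> (S * (18 * m)) * 1"
        unfolding abs_mult using S(1)[OF z] S0 by (simp add: mult_mono)
    qed
    also have "\<dots> \<le> (S * (18 * m)) * (e2 * h)"
      unfolding integral_mult_right_zero using S0 m0 by (intro mult_left_mono area_le) auto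
    \<comment> \<open>The powers of \<open>e2\<close> and \<open>h\<close> are distributed so that
      each factor has a bound free of \<open>h / e2\<close>: the first by the inverse estimate, the
      second by \<open>stab_lower\<close>.\<close>
    also have "\<dots> = 18 * (S * e2 * sqrt (e2 * h)) * (m * sqrt (h / e2))"
    proof -
      have "sqrt (e2 * h) * sqrt (h / e2) = sqrt (h * h)"
        unfolding real_sqrt_mult[symmetric] using e2_pos by simp
      then have "sqrt (e2 * h) * sqrt (h / e2) = h" using h_pos by simp
      then show ?thesis by (simp add: mult.commute mult.left_commute)
    qed
    also have "\<dots> \<le> 18 * (C * sqrt X) * (sqrt 6 * sqrt s)"
    proof (rule mult_mono)
      have "m\<^sup>2 * (h / e2) \<le> 6 * s" using ms e2_pos by (simp add: field_simps)
      from real_sqrt_le_mono[OF this] show "m * sqrt (h / e2) \<le> sqrt 6 * sqrt s"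
        using m0 by (simp only: real_sqrt_mult real_sqrt_abs abs_of_nonneg)
      show "0 \<le> m * sqrt (h / e2)" using m0 h_pos e2_pos by simp
    qed (use S(2) C X0 in auto)
    finally show ?thesis unfolding pv by (simp only: mult_ac)
  qed
  have "X = (\<integral>z. G z \<bullet> grad w z + G z \<bullet> (G z - grad w z) \<partial>?M)"
    unfolding X_def by (rule Bochner_Integration.integral_cong) (simp_all add: power2_norm_eq_inner inner_diff_right)
  also have "\<dots> = (\<integral>z. G z \<bullet> grad w z \<partial>?M) + (\<integral>z. G z \<bullet> (G z - grad w z) \<partial>?M)"
    by (intro Bochner_Integration.integral_add square_integrable_inner sG sgw square_integrable_diff)
  also have "(\<integral>z. G z \<bullet> (G z - grad w z) \<partial>?M) = - (\<integral>z. p z * (v z - w z) \<partial>?M)"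
    unfolding G_def w_def by (rule test_with_difference(1)[OF vH p g gz])
  finally have "X \<le> sqrt X * (sqrt 51 * sqrt s) + sqrt X * (18 * sqrt 6 * C * sqrt s)"
    using first second by linarith
  then have le: "sqrt X * sqrt X \<le> sqrt X * ((sqrt 51 + 18 * sqrt 6 * C) * sqrt s)"
    using X0 by (simp add: algebra_simps)
  \<comment> \<open>One factor \<open>sqrt X\<close> is cancelled, so a vanishing seminorm needs its
    own case.\<close>
  have "sqrt X \<le> (sqrt 51 + 18 * sqrt 6 * C) * sqrt s"
  proof (cases "X = 0")
    case True
    then show ?thesis using C s0 by simp
  next
    case False
    then have "0 < sqrt X" using X0 by simp
    with le show ?thesis by (simp only: mult_le_cancel_left_pos)
  qed
  then have "(sqrt X)\<^sup>2 \<le> ((sqrt 51 + 18 * sqrt 6 * C) * sqrt s)\<^sup>2"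
    using X0 by (intro power_mono) auto
  then have "X \<le> (sqrt 51 + 18 * sqrt 6 * C)\<^sup>2 * s" using X0 s0 by (simp add: power_mult_distrib)
  moreover have "(H1_seminorm E v)\<^sup>2 = X"
    unfolding H1_seminorm_def LINT_restrict[OF E_lebesgue] X_def G_def by simp
  ultimately show ?thesis by (simp add: s_eq)
qed

end

theorem lemma6p4:
  shows "\<exists>C::real. \<forall>(h::real) (\<epsilon>\<^sub>1::real) (\<epsilon>\<^sub>2::real).
           0 < \<epsilon>\<^sub>1 \<and> \<epsilon>\<^sub>1 \<le> \<epsilon>\<^sub>2 \<and> \<epsilon>\<^sub>2 \<le> h \<longrightarrow>
           (\<forall>v \<in> V_space (quad h \<epsilon>\<^sub>1 \<epsilon>\<^sub>2).
              (AE t in lebesgue_on {0..1}. tr (quad h \<epsilon>\<^sub>1 \<epsilon>\<^sub>2) v (linepath (\<epsilon>\<^sub>1, h) (\<epsilon>\<^sub>2, 0) t) = 0) \<longrightarrow>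
              (H1_seminorm (polygon (quad h \<epsilon>\<^sub>1 \<epsilon>\<^sub>2)) v)\<^sup>2 \<le> C * s_E h \<epsilon>\<^sub>1 \<epsilon>\<^sub>2 v v)"
proof -
  \<comment> \<open>The constant is obtained before the element is fixed; this is the claimed
    uniformity, and the reason why the inverse estimate quantifies over all trapezoids.\<close>
  obtain C where C0: "0 \<le> C" and C: "\<And>h e1 e2 v p. trapezoid h e1 e2 \<Longrightarrow> v \<in> H1 (polygon (quad h e1 e2)) \<Longrightarrow> p \<in> P1
    \<Longrightarrow> laplacian_is (polygon (quad h e1 e2)) v p \<Longrightarrow> \<exists>S. (\<forall>z\<in>polygon (quad h e1 e2). \<bar>p z\<bar> \<le> S) \<and>
      S * e2 * sqrt (e2 * h) \<le> C * sqrt (\<integral>z. (norm (wgrad (polygon (quad h e1 e2)) v z))\<^sup>2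
        \<partial>lebesgue_on (polygon (quad h e1 e2)))"
    by (rule laplacian_inverse_estimate) blast
  show ?thesis
  proof (intro exI allI impI ballI)
    fix h e1 e2 :: real and v
    assume "0 < e1 \<and> e1 \<le> e2 \<and> e2 \<le> h"
    then have T: "trapezoid h e1 e2" by (simp add: trapezoid_def)
    assume v: "v \<in> V_space (quad h e1 e2)"
      and z: "AE t in lebesgue_on {0..1}. tr (quad h e1 e2) v (linepath (e1, h) (e2, 0) t) = 0"
    have "v \<in> H1 (polygon (quad h e1 e2))" using v by (simp add: V_space_def)
    from trapezoid.energy_le[OF T v z C[OF T this] C0]
    show "(H1_seminorm (polygon (quad h e1 e2)) v)\<^sup>2 \<le> (sqrt 51 + 18 * sqrt 6 * C)\<^sup>2 * s_E h e1 e2 v v" .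
  qed
qed

end
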